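(* Let $N\ge2$, $1\le q<p<\infty$, and let $\Omega\subset\mathbb{R}^N$ be a bounded convex open set. Then \[ \lambda_{p,q}(\Omega)\,|\Omega|^{\frac{p-q}q}\ \le\ \frac{\omega_N^{\frac{p-q}q}\,\lambda_{p,q}(B_1)}{r_\Omega^p}, \] with equality if and only if $\Omega$ is a ball.
   Context: $\lambda_{p,q}(\Omega):=\inf\{\int_\Omega|\nabla\psi|^p\,dx:\ \psi\in C_0^\infty(\Omega),\ \int_\Omega|\psi|^q\,dx=1\}$; $B_1$ is the unit open ball of $\mathbb{R}^N$ and $\omega_N=|B_1|$; $r_\Omega$ is the inradius (radius of the largest ball contained in $\Omega$); $|\Omega|$ is Lebesgue measure. *)

theory Defs
  imports "HOL-Analysis.Analysis"
begin

fun iter_partial :: "'a::euclidean_space list \<Rightarrow> ('a \<Rightarrow> real) \<Rightarrow> 'a \<Rightarrow> real" where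
  "iter_partial [] f = f"
| "iter_partial (v # vs) f = (\<lambda>x. frechet_derivative (iter_partial vs f) (at x) v)"

definition smooth :: "('a::euclidean_space \<Rightarrow> real) \<Rightarrow> bool" where
  "smooth f \<longleftrightarrow> (\<forall>vs. set vs \<subseteq> Basis \<longrightarrow> (\<forall>x. iter_partial vs f differentiable (at x)))"

definition tsupport :: "('a::euclidean_space \<Rightarrow> real) \<Rightarrow> 'a set" where
  "tsupport f = closure {x. f x \<noteq> 0}"

definition C0_infty :: "'a::euclidean_space set \<Rightarrow> ('a \<Rightarrow> real) set" where
  "C0_infty \<Omega> = {\<psi>. smooth \<psi> \<and> compact (tsupport \<psi>) \<and> tsupport \<psi> \<subseteq> \<Omega>}"

definition grad :: "('a::euclidean_space \<Rightarrow> real) \<Rightarrow> 'a \<Rightarrow> 'a" where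
  "grad f x = (\<Sum>b\<in>Basis. frechet_derivative f (at x) b *\<^sub>R b)"

definition lambda_pq :: "real \<Rightarrow> real \<Rightarrow> 'a::euclidean_space set \<Rightarrow> real" where
  "lambda_pq p q \<Omega> = Inf {integral \<Omega> (\<lambda>x. norm (grad \<psi> x) powr p) | \<psi>.
      \<psi> \<in> C0_infty \<Omega> \<and> integral \<Omega> (\<lambda>x. \<bar>\<psi> x\<bar> powr q) = 1}"

definition inradius :: "'a::euclidean_space set \<Rightarrow> real" where
  "inradius \<Omega> = Sup {r. \<exists>x. ball x r \<subseteq> \<Omega>}"

end

(* Let j be the Minkowski functional of the set, centred at an incentre, and let V be a test function
   on the unit ball. For every direction e the function x |-> V (j x e) is a Lipschitz test function
   on the set; since |grad j| <= 1 / r, and since {j < t} has volume proportional to t^N, its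
   Rayleigh quotient is controlled by the one-dimensional profile t |-> V (t e). Averaging over e
   (convexity of s |-> s^(p/q)) bounds the energy of these functions by that of V, which gives the
   inequality without symmetrization and without the existence of extremals.

   On a polytope circumscribed about its inball |grad j| = 1 / r almost everywhere, so strictness
   does not come from the gradient of j. Instead one cuts off a small cap {x . nu >= h}: with H the
   supremum of x . nu on the set and D the cone over the cut, the cut costs a volume of at most
   ((H / h)^N - 1) |D|, whereas on D the gradient of the new functional drops from 1 / r to
   1 / h. As h tends to H the gain wins. *)
theory Submission
  imports Defs
begin

section \<open>Smooth functions and mollifiers\<close>

text \<open>\<open>C0_infty\<close> admits only functions with all iterated derivatives, whereas V
  (j x e) is merely Lipschitz and j has kinks. So every test function is mollified, and the
  pointwise Lipschitz constant \<open>loc_lip\<close>, an upper bound that survives mollification,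
  takes the place of |grad j|. Only the radial part of grad V enters a profile, and it is bounded by
  |grad V|. The mass of each profile function is |\<Omega>| times a ray integral of |V|^q, whatever
  the shape of \<Omega>; the shape enters only through |\<Omega>| and the slope of j. Since no
  extremal V is at hand, strictness has to come from a factor below 1 that is the same for all V. If
  \<Omega> is not its inball, some direction \<nu> has H > r; as h tends to H, the relative cost (H
  / h)^N - 1 tends to 0 while the relative gain 1 - (r / h)^p tends to 1 - (r / H)^p > 0. Such a
  factor yields a strict inequality only if \<open>lambda_pq\<close> of the unit ball is positive,
  hence the Poincare inequality. For balls the reverse inequality is scaling.\<close>

lemma smooth_coinduct:
  assumes "f \<in> F"
    and diff: "\<And>g x. g \<in> F \<Longrightarrow> g differentiable (at x)"
    and clos: "\<And>g b. g \<in> F \<Longrightarrow> b \<in> Basis \<Longrightarrow> (\<lambda>x. frechet_derivative g (at x) b) \<in> F"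
  shows "smooth f"
proof -
  have "iter_partial vs f \<in> F" if "set vs \<subseteq> Basis" for vs
    using that by (induction vs) (auto intro: assms(1) clos)
  then show ?thesis unfolding smooth_def using diff by blast
qed

text \<open>\<open>iter_partial\<close> applies the head of the list last, so the iterated
  derivatives of a partial derivative of \<open>f\<close> correspond to lists that end in
  \<open>b\<close>. Taking all iterated partials of \<open>f\<close> as the class in
  \<open>smooth_coinduct\<close> settles this without reasoning about appended lists.\<close>

lemma smooth_partial: "smooth f \<Longrightarrow> b \<in> Basis \<Longrightarrow> smooth (\<lambda>x. frechet_derivative f (at x) b)"
proof (rule smooth_coinduct[where F="{iter_partial vs f | vs. set vs \<subseteq> Basis}"], goal_cases)
  case 1
  have "(\<lambda>x. frechet_derivative f (at x) b) = iter_partial [b] f" by simp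
  then show ?case using 1 by (intro CollectI exI[of _ "[b]"]) auto
next
  case (2 g x)
  then show ?case unfolding smooth_def by auto
next
  case (3 g c)
  then obtain vs where "g = iter_partial vs f" "set vs \<subseteq> Basis" by auto
  with 3 show ?case by (intro CollectI exI[of _ "c # vs"]) auto
qed

lemma smooth_differentiable: "smooth f \<Longrightarrow> f differentiable (at x)"
  unfolding smooth_def by (metis empty_set empty_subsetI iter_partial.simps(1))

lemma smooth_continuous: "smooth f \<Longrightarrow> continuous_on S f"
  by (meson smooth_differentiable differentiable_imp_continuous_within continuous_at_imp_continuous_on)

text \<open>The class of all \<open>c * g (a + s *\<^sub>R x)\<close> with \<open>g\<close> smooth
  is closed under partial derivatives, because each of them only multiplies \<open>c\<close> by
  \<open>s\<close>. The factor \<open>c\<close> is part of the statement to make this class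
  stable.\<close>

lemma smooth_affine:
  assumes "smooth f"
  shows "smooth (\<lambda>x. c * f (a + s *\<^sub>R x))"
proof (rule smooth_coinduct[where F="{\<lambda>x. c * g (a + s *\<^sub>R x) | c g. smooth g}"])
  show "(\<lambda>x. c * f (a + s *\<^sub>R x)) \<in> {\<lambda>x. c * g (a + s *\<^sub>R x) | c g. smooth g}"
    using assms by blast
  have der: "((\<lambda>x. c * g (a + s *\<^sub>R x)) has_derivative
      (\<lambda>h. c * frechet_derivative g (at (a + s *\<^sub>R x)) (s *\<^sub>R h))) (at x)"
    if "smooth g" for g c x
  proof -
    have "(g has_derivative frechet_derivative g (at (a + s *\<^sub>R x))) (at (a + s *\<^sub>R x))"
      using smooth_differentiable[OF that] by (simp add: frechet_derivative_works)
    moreover have "((\<lambda>x. a + s *\<^sub>R x) has_derivative (\<lambda>h. s *\<^sub>R h)) (at x)"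
      by (auto intro!: derivative_eq_intros)
    ultimately show ?thesis
      by (intro has_derivative_mult_right has_derivative_compose[where f="\<lambda>x. a + s *\<^sub>R x" and g=g])
  qed
  show "g differentiable (at x)" if "g \<in> {\<lambda>x. c * g (a + s *\<^sub>R x) | c g. smooth g}" for g x
    using that der unfolding differentiable_def by blast
  show "(\<lambda>x. frechet_derivative g (at x) b) \<in> {\<lambda>x. c * g (a + s *\<^sub>R x) | c g. smooth g}"
    if gF: "g \<in> {\<lambda>x. c * g (a + s *\<^sub>R x) | c g. smooth g}" and b: "b \<in> Basis" for g b
  proof -
    obtain c k where g: "g = (\<lambda>x. c * k (a + s *\<^sub>R x))" and k: "smooth k" using gF by blast
    have "frechet_derivative g (at x) b = (c * s) * frechet_derivative k (at (a + s *\<^sub>R x)) b" for x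
    proof -
      have "linear (frechet_derivative k (at (a + s *\<^sub>R x)))"
        using smooth_differentiable[OF k] by (rule linear_frechet_derivative)
      then show ?thesis
        unfolding g frechet_derivative_at[OF der[OF k], symmetric] by (simp add: linear_cmul)
    qed
    then have "(\<lambda>x. frechet_derivative g (at x) b) =
        (\<lambda>x. (c * s) * (\<lambda>z. frechet_derivative k (at z) b) (a + s *\<^sub>R x))" by auto
    then show ?thesis using smooth_partial[OF k b]
      by (intro CollectI exI[of _ "c * s"] exI[of _ "\<lambda>z. frechet_derivative k (at z) b"] conjI)
  qed
qed

section \<open>Bump functions built from exp (- 1 / s)\<close>

text \<open>The powers of 1 / s are a parameter because differentiation creates them: the family is
  closed under differentiation up to linear combinations. \<open>m = 0\<close> is the usual cutoff
  function.\<close>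

definition flat :: "nat \<Rightarrow> real \<Rightarrow> real" where
  "flat m s = (if s > 0 then (1 / s) ^ m * exp (- (1 / s)) else 0)"

lemma flat_tendsto_0: "(flat m \<longlongrightarrow> 0) (at 0)"
proof -
  have "((\<lambda>s::real. inverse s ^ m / exp (inverse s)) \<longlongrightarrow> 0) (at_right 0)"
    by (rule filterlim_compose[OF tendsto_power_div_exp_0 filterlim_inverse_at_top_right])
  then have r: "(flat m \<longlongrightarrow> 0) (at_right 0)"
    by (rule Lim_transform_eventually)
       (auto simp: eventually_at_right_field flat_def inverse_eq_divide exp_minus intro!: exI[of _ 1])
  have l: "(flat m \<longlongrightarrow> 0) (at_left 0)"
    by (rule tendsto_eventually) (auto simp: eventually_at_left_field flat_def intro!: exI[of _ "-1"])
  show ?thesis using l r by (rule filterlim_split_at)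
qed

text \<open>At s = 0 the difference quotient of \<open>flat m\<close> is
  \<open>flat (m + 1)\<close>, which tends to 0. One formula for all s spares the bump algebra any
  case distinction.\<close>

lemma flat_deriv:
  "(flat m has_real_derivative (flat (m + 2) s - real m * flat (m + 1) s)) (at s)"
proof -
  consider "s > 0" | "s < 0" | "s = 0" by linarith
  then show ?thesis
  proof cases
    case 1
    have "((\<lambda>s. (1 / s) ^ m * exp (- (1 / s))) has_real_derivative
        (flat (m + 2) s - real m * flat (m + 1) s)) (at s)"
    proof -
      have "((\<lambda>s. (1 / s) ^ m) has_real_derivative real m * (1 / s) ^ (m - 1) * (- 1 / s\<^sup>2)) (at s)"
        using 1 by (auto intro!: derivative_eq_intros simp: power2_eq_square)
      moreover have "((\<lambda>s. exp (- (1 / s))) has_real_derivative exp (- (1 / s)) / s\<^sup>2) (at s)"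
        using 1 by (auto intro!: derivative_eq_intros simp: power2_eq_square)
      ultimately have d: "((\<lambda>s. (1 / s) ^ m * exp (- (1 / s))) has_real_derivative
          (real m * (1 / s) ^ (m - 1) * (- 1 / s\<^sup>2)) * exp (- (1 / s)) + (exp (- (1 / s)) / s\<^sup>2) * (1 / s) ^ m) (at s)"
        by (rule DERIV_mult)
      have e: "real m * (1 / s) ^ (m - 1) * (- 1 / s\<^sup>2) = - (real m * (1 / s) ^ (m + 1))"
        using 1 by (cases m) (auto simp: power2_eq_square)
      show ?thesis
        using 1 by (rule_tac DERIV_cong[OF d], unfold e) (simp add: flat_def algebra_simps power2_eq_square)
    qed
    moreover have "eventually (\<lambda>x. (1 / x) ^ m * exp (- (1 / x)) = flat m x) (nhds s)"
      using eventually_nhds_in_open[of "{0<..}" s] 1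
      by (auto elim!: eventually_mono simp: flat_def)
    ultimately show ?thesis
      using DERIV_cong_ev[OF refl _ refl, of "\<lambda>x. (1 / x) ^ m * exp (- (1 / x))" "flat m"] by simp
  next
    case 2
    have "eventually (\<lambda>x. 0 = flat m x) (nhds s)"
      using eventually_nhds_in_open[of "{..<0}" s] 2
      by (auto elim!: eventually_mono simp: flat_def)
    moreover have "((\<lambda>_. 0) has_real_derivative (flat (m + 2) s - real m * flat (m + 1) s)) (at s)"
      using 2 by (simp add: flat_def)
    ultimately show ?thesis
      using DERIV_cong_ev[OF refl _ refl, of "\<lambda>x. 0" "flat m"] by simp
  next
    case 3
    have "((\<lambda>h. (flat m (0 + h) - flat m 0) / h) \<longlongrightarrow> 0) (at 0)"
      using flat_tendsto_0[of "m + 1"]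
      by (rule Lim_transform_eventually)
         (auto simp: eventually_at_filter flat_def intro!: always_eventually)
    then show ?thesis using 3 by (simp add: DERIV_def flat_def)
  qed
qed

text \<open>An algebra that contains the bump \<open>flat 0 (e\<^sup>2 - x \<bullet> x)\<close> and is closed under partial
  derivatives, so that all iterated partial derivatives exist by \<open>smooth_coinduct\<close>.\<close>

inductive_set bump_alg :: "real \<Rightarrow> ('a::euclidean_space \<Rightarrow> real) set" for e where
  const: "(\<lambda>_. c) \<in> bump_alg e"
| coord: "(\<lambda>x. x \<bullet> b) \<in> bump_alg e"
| flat: "(\<lambda>x. flat m (e\<^sup>2 - x \<bullet> x)) \<in> bump_alg e"
| add: "f \<in> bump_alg e \<Longrightarrow> g \<in> bump_alg e \<Longrightarrow> (\<lambda>x. f x + g x) \<in> bump_alg e"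
| mult: "f \<in> bump_alg e \<Longrightarrow> g \<in> bump_alg e \<Longrightarrow> (\<lambda>x. f x * g x) \<in> bump_alg e"

lemma bump_alg_derivative:
  "f \<in> bump_alg e \<Longrightarrow>
    \<exists>f'. (\<forall>x. (f has_derivative f' x) (at x)) \<and> (\<forall>b. (\<lambda>x. f' x b) \<in> bump_alg e)"
proof (induction rule: bump_alg.induct)
  case (const c)
  show ?case by (rule exI[of _ "\<lambda>x h. 0"]) (auto intro: bump_alg.const)
next
  case (coord b)
  show ?case
    by (rule exI[of _ "\<lambda>x h. h \<bullet> b"]) (auto intro!: bump_alg.const derivative_eq_intros)
next
  case (flat m)
  have "((\<lambda>x. flat m (e\<^sup>2 - x \<bullet> x)) has_derivative
      (\<lambda>h. (flat (m + 2) (e\<^sup>2 - x \<bullet> x) + (- real m) * flat (m + 1) (e\<^sup>2 - x \<bullet> x)) * ((-2) * (x \<bullet> h)))) (at x)" for x :: 'a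
  proof -
    have "((\<lambda>x. e\<^sup>2 - x \<bullet> x) has_derivative (\<lambda>h. (-2) * (x \<bullet> h))) (at x)"
      by (auto intro!: derivative_eq_intros simp: inner_commute)
    from has_derivative_compose[OF this flat_deriv[of m "e\<^sup>2 - x \<bullet> x", unfolded has_field_derivative_def]]
    show ?thesis by (simp add: o_def algebra_simps)
  qed
  moreover have "(\<lambda>x::'a. (flat (m + 2) (e\<^sup>2 - x \<bullet> x) + (- real m) * flat (m + 1) (e\<^sup>2 - x \<bullet> x)) * ((-2) * (x \<bullet> b)))
      \<in> bump_alg e" for b
    by (intro bump_alg.intros)
  ultimately show ?case
    by (intro exI[of _ "\<lambda>x h. (flat (m + 2) (e\<^sup>2 - x \<bullet> x) + (- real m) * flat (m + 1) (e\<^sup>2 - x \<bullet> x)) * ((-2) * (x \<bullet> h))"] conjI allI)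
next
  case (add f g)
  then obtain f' g' where *: "\<forall>x. (f has_derivative f' x) (at x)" "\<forall>b. (\<lambda>x. f' x b) \<in> bump_alg e"
     "\<forall>x. (g has_derivative g' x) (at x)" "\<forall>b. (\<lambda>x. g' x b) \<in> bump_alg e" by auto
  then have "\<forall>x. ((\<lambda>x. f x + g x) has_derivative (\<lambda>h. f' x h + g' x h)) (at x)"
    by (auto intro!: has_derivative_add)
  moreover have "\<forall>b. (\<lambda>x. f' x b + g' x b) \<in> bump_alg e" using * by (auto intro: bump_alg.add)
  ultimately show ?case by (intro exI[of _ "\<lambda>x h. f' x h + g' x h"]) auto
next
  case (mult f g)
  then obtain f' g' where *: "\<forall>x. (f has_derivative f' x) (at x)" "\<forall>b. (\<lambda>x. f' x b) \<in> bump_alg e"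
     "\<forall>x. (g has_derivative g' x) (at x)" "\<forall>b. (\<lambda>x. g' x b) \<in> bump_alg e" by auto
  then have "\<forall>x. ((\<lambda>x. f x * g x) has_derivative (\<lambda>h. f x * g' x h + f' x h * g x)) (at x)"
    by (auto intro!: has_derivative_mult)
  moreover have "\<forall>b. (\<lambda>x. f x * g' x b + f' x b * g x) \<in> bump_alg e"
    using * mult.hyps by (auto intro!: bump_alg.intros)
  ultimately show ?case by (intro exI[of _ "\<lambda>x h. f x * g' x h + f' x h * g x"]) auto
qed

lemma bump_alg_continuous: "f \<in> bump_alg e \<Longrightarrow> continuous_on S f"
  using bump_alg_derivative
  by (meson has_derivative_continuous continuous_at_imp_continuous_on)

section \<open>Convolution with a bump kernel\<close>

lemma convolution_has_derivative:
  fixes u f :: "'a::euclidean_space \<Rightarrow> real"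
  assumes u: "continuous_on UNIV u"
    and f: "\<And>x. (f has_derivative f' x) (at x)"
    and f': "\<And>b. continuous_on UNIV (\<lambda>x. f' x b)"
  shows "((\<lambda>x. integral (cbox a b) (\<lambda>y. u y * f (x - y))) has_derivative
      (\<lambda>h. integral (cbox a b) (\<lambda>y. u y * f' (x - y) h))) (at x)"
proof -
  \<comment> \<open>\<open>leibniz_rule\<close> asks for a derivative that is continuous as a
    bounded linear map. Rebuilding it from the partial derivatives reduces this to the continuity of
    each \<open>f' x b\<close> in x.\<close>
  define D where "D x y = u y *\<^sub>R (\<Sum>i\<in>Basis. f' (x - y) i *\<^sub>R blinfun_inner_left i)" for x y
  have lin: "linear (f' x)" for x using f has_derivative_linear by blast
  have Dapp: "blinfun_apply (D x y) h = u y * f' (x - y) h" for x y h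
  proof -
    have "f' (x - y) h = f' (x - y) (\<Sum>i\<in>Basis. (h \<bullet> i) *\<^sub>R i)" by (simp add: euclidean_representation)
    also have "\<dots> = (\<Sum>i\<in>Basis. (h \<bullet> i) * f' (x - y) i)"
      using lin by (simp add: linear_sum linear_cmul)
    finally have "f' (x - y) h = (\<Sum>i\<in>Basis. (h \<bullet> i) * f' (x - y) i)" .
    moreover have "blinfun_apply (D x y) h = u y * (\<Sum>i\<in>Basis. f' (x - y) i * (h \<bullet> i))"
      unfolding D_def by (simp add: blinfun.scaleR_left blinfun.sum_left)
    ultimately show ?thesis by (simp only: mult.commute)
  qed
  have fc: "continuous_on UNIV f"
    by (rule continuous_at_imp_continuous_on) (blast intro: has_derivative_continuous f)
  have contD: "continuous_on (UNIV \<times> cbox a b) (\<lambda>(x, y). D x y)"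
    unfolding D_def split_beta
    by (intro continuous_intros continuous_on_compose2[OF u] continuous_on_compose2[OF f']) auto
  have "((\<lambda>x. integral (cbox a b) (\<lambda>y. u y * f (x - y))) has_derivative
      blinfun_apply (integral (cbox a b) (D x))) (at x within UNIV)"
  proof (rule leibniz_rule[OF _ _ contD])
    fix x t :: 'a
    have "((\<lambda>x. f (x - t)) has_derivative f' (x - t)) (at x)"
      by (rule has_derivative_compose[where f="\<lambda>x. x - t" and f'="\<lambda>h. h", OF _ f])
         (auto intro!: derivative_eq_intros)
    then have "((\<lambda>x. u t * f (x - t)) has_derivative (\<lambda>h. u t * f' (x - t) h)) (at x)"
      by (rule has_derivative_mult_right)
    moreover have "blinfun_apply (D x t) = (\<lambda>h. u t * f' (x - t) h)" using Dapp by auto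
    ultimately show "((\<lambda>x. u t * f (x - t)) has_derivative blinfun_apply (D x t)) (at x within UNIV)"
      by simp
  next
    fix x
    show "(\<lambda>y. u y * f (x - y)) integrable_on cbox a b"
      by (intro integrable_continuous continuous_intros continuous_on_compose2[OF u] continuous_on_compose2[OF fc]) auto
  qed auto
  moreover have "blinfun_apply (integral (cbox a b) (D x)) h = integral (cbox a b) (\<lambda>y. u y * f' (x - y) h)" for h
  proof -
    have "continuous_on (cbox a b) (D x)"
      using continuous_on_compose2[OF contD, of "cbox a b" "\<lambda>y. (x, y)"]
      by (simp add: continuous_on_Pair continuous_on_const continuous_on_id image_subset_iff)
    then have "D x integrable_on cbox a b" by (rule integrable_continuous)
    from integral_linear[OF this, of "\<lambda>L. blinfun_apply L h"] show ?thesis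
      by (simp add: o_def Dapp blinfun.bounded_linear_left)
  qed
  then have "blinfun_apply (integral (cbox a b) (D x)) = (\<lambda>h. integral (cbox a b) (\<lambda>y. u y * f' (x - y) h))"
    by (rule ext)
  ultimately show ?thesis by simp
qed

text \<open>The convolutions of \<open>u\<close> with all kernels of \<open>bump_alg\<close> form
  the class for \<open>smooth_coinduct\<close>: a partial derivative falls on the kernel and turns
  it into another member of the algebra.\<close>

lemma convolution_smooth:
  fixes u f :: "'a::euclidean_space \<Rightarrow> real"
  assumes u: "continuous_on UNIV u" and f: "f \<in> bump_alg e"
  shows "smooth (\<lambda>x. integral (cbox a b) (\<lambda>y. u y * f (x - y)))"
proof (rule smooth_coinduct[where F="{\<lambda>x. integral (cbox a b) (\<lambda>y. u y * f (x - y)) | f. f \<in> bump_alg e}"])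
  show "(\<lambda>x. integral (cbox a b) (\<lambda>y. u y * f (x - y))) \<in> {\<lambda>x. integral (cbox a b) (\<lambda>y. u y * f (x - y)) | f. f \<in> bump_alg e}"
    using f by blast
next
  fix g x assume "g \<in> {\<lambda>x. integral (cbox a b) (\<lambda>y. u y * f (x - y)) | f. f \<in> bump_alg e}"
  then obtain k where g: "g = (\<lambda>x. integral (cbox a b) (\<lambda>y. u y * k (x - y)))" and k: "k \<in> bump_alg e" by blast
  from bump_alg_derivative[OF k] obtain k' where k': "\<And>x. (k has_derivative k' x) (at x)" "\<And>b. (\<lambda>x. k' x b) \<in> bump_alg e"
    by blast
  note d = convolution_has_derivative[OF u k'(1) bump_alg_continuous[OF k'(2)]]
  show "g differentiable at x" unfolding g differentiable_def using d by blast
next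
  fix g and i :: 'a assume "g \<in> {\<lambda>x. integral (cbox a b) (\<lambda>y. u y * f (x - y)) | f. f \<in> bump_alg e}"
  then obtain k where g: "g = (\<lambda>x. integral (cbox a b) (\<lambda>y. u y * k (x - y)))" and k: "k \<in> bump_alg e" by blast
  from bump_alg_derivative[OF k] obtain k' where k': "\<And>x. (k has_derivative k' x) (at x)" "\<And>b. (\<lambda>x. k' x b) \<in> bump_alg e"
    by blast
  note d = convolution_has_derivative[OF u k'(1) bump_alg_continuous[OF k'(2)]]
  have "(\<lambda>x. frechet_derivative g (at x) i) = (\<lambda>x. integral (cbox a b) (\<lambda>y. u y * k' (x - y) i))"
    unfolding g using frechet_derivative_at[OF d] by metis
  then show "(\<lambda>x. frechet_derivative g (at x) i) \<in> {\<lambda>x. integral (cbox a b) (\<lambda>y. u y * f (x - y)) | f. f \<in> bump_alg e}"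
    using k'(2)[of i] by (intro CollectI exI[of _ "\<lambda>x. k' x i"] conjI)
qed

section \<open>Test functions\<close>

lemma frechet_derivative_eq_inner_grad:
  assumes "f differentiable (at x)"
  shows "frechet_derivative f (at x) v = grad f x \<bullet> v"
proof -
  have lin: "linear (frechet_derivative f (at x))" using assms by (rule linear_frechet_derivative)
  have "frechet_derivative f (at x) v = frechet_derivative f (at x) (\<Sum>b\<in>Basis. (v \<bullet> b) *\<^sub>R b)"
    by (simp add: euclidean_representation)
  also have "\<dots> = (\<Sum>b\<in>Basis. (v \<bullet> b) * frechet_derivative f (at x) b)"
    using lin by (simp add: linear_sum linear_cmul)
  also have "\<dots> = grad f x \<bullet> v"
    by (simp add: grad_def inner_sum_left inner_commute[of v] mult.commute)
  finally show ?thesis .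
qed

lemma has_derivative_grad:
  assumes "f differentiable (at x)"
  shows "(f has_derivative (\<lambda>h. grad f x \<bullet> h)) (at x)"
proof -
  have "frechet_derivative f (at x) = (\<lambda>h. grad f x \<bullet> h)"
    using frechet_derivative_eq_inner_grad[OF assms] by blast
  then show ?thesis using assms frechet_derivative_works[of f "at x"] by simp
qed

lemma grad_eqI:
  assumes "(f has_derivative (\<lambda>h. g \<bullet> h)) (at x)"
  shows "grad f x = g"
proof -
  have "frechet_derivative f (at x) = (\<lambda>h. g \<bullet> h)" using frechet_derivative_at[OF assms] by simp
  then show ?thesis by (simp add: grad_def euclidean_representation)
qed

text \<open>Moving from x in the direction grad f x, the difference quotient tends to |grad f x|^2
  and is at most L * |grad f x|. If the gradient vanishes, \<open>0 \<le> L\<close> has to be read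
  off the hypothesis.\<close>

lemma norm_grad_le:
  assumes f: "f differentiable (at x)" and e: "e > 0"
    and L: "\<And>h. norm h < e \<Longrightarrow> \<bar>f (x + h) - f x\<bar> \<le> L * norm h"
  shows "norm (grad f x) \<le> L"
proof (cases "grad f x = 0")
  case True
  obtain b :: 'a where b: "b \<in> Basis" using nonempty_Basis by blast
  have "norm ((e/2) *\<^sub>R b) < e" using b e by simp
  from L[OF this] have "0 \<le> L * norm ((e/2) *\<^sub>R b)" by linarith
  then have "L \<ge> 0" using b e by (simp add: zero_le_mult_iff)
  then show ?thesis using True by simp
next
  case False
  define g where "g = grad f x"
  have "((\<lambda>t. f (x + t *\<^sub>R g)) has_derivative (\<lambda>t. grad f x \<bullet> (t *\<^sub>R g))) (at 0)"
  proof (rule has_derivative_compose[where f="\<lambda>t. x + t *\<^sub>R g"])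
    show "((\<lambda>t. x + t *\<^sub>R g) has_derivative (\<lambda>t. t *\<^sub>R g)) (at 0)"
      by (auto intro!: derivative_eq_intros)
    show "(f has_derivative (\<bullet>) (grad f x)) (at (x + 0 *\<^sub>R g))"
      using has_derivative_grad[OF f] by simp
  qed
  then have "((\<lambda>t. f (x + t *\<^sub>R g)) has_real_derivative (norm g)\<^sup>2) (at 0)"
    unfolding has_field_derivative_def by (simp add: g_def[symmetric] power2_norm_eq_inner mult.commute[of _ "g \<bullet> g"])
  then have "((\<lambda>t. (f (x + t *\<^sub>R g) - f x) / t) \<longlongrightarrow> (norm g)\<^sup>2) (at_right 0)"
    unfolding DERIV_def by (simp add: filterlim_at_split)
  moreover have "eventually (\<lambda>t. (f (x + t *\<^sub>R g) - f x) / t \<le> L * norm g) (at_right 0)"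
  proof -
    have "(f (x + t *\<^sub>R g) - f x) / t \<le> L * norm g" if "0 < t" "t < e / norm g" for t
    proof -
      have "norm (t *\<^sub>R g) < e" using that False by (simp add: g_def pos_less_divide_eq)
      from L[OF this] have "f (x + t *\<^sub>R g) - f x \<le> t * (L * norm g)" using that by (simp add: algebra_simps)
      then show ?thesis using that by (simp add: field_simps)
    qed
    then show ?thesis unfolding eventually_at_right_field
      using False e by (intro exI[of _ "e / norm g"]) (auto simp: g_def)
  qed
  ultimately have "(norm g)\<^sup>2 \<le> L * norm g"
    by (rule tendsto_upperbound) simp
  then show ?thesis using False by (simp add: g_def power2_eq_square)
qed

lemma smooth_continuous_grad: "smooth f \<Longrightarrow> continuous_on S (grad f)"
  unfolding grad_def by (intro continuous_intros smooth_continuous smooth_partial)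

lemma grad_cmult:
  assumes "f differentiable (at x)"
  shows "grad (\<lambda>x. c * f x) x = c *\<^sub>R grad f x"
  by (rule grad_eqI) (use has_derivative_mult_right[OF has_derivative_grad[OF assms], of c] in simp)

lemma grad_affine:
  assumes "f differentiable (at (a + s *\<^sub>R x))"
  shows "grad (\<lambda>x. f (a + s *\<^sub>R x)) x = s *\<^sub>R grad f (a + s *\<^sub>R x)"
proof (rule grad_eqI)
  have "((\<lambda>x. f (a + s *\<^sub>R x)) has_derivative (\<lambda>h. grad f (a + s *\<^sub>R x) \<bullet> (s *\<^sub>R h))) (at x)"
  proof (rule has_derivative_compose[where f="\<lambda>x. a + s *\<^sub>R x"])
    show "((\<lambda>x. a + s *\<^sub>R x) has_derivative (\<lambda>x. s *\<^sub>R x)) (at x)"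
      by (auto intro!: derivative_eq_intros)
    show "(f has_derivative (\<bullet>) (grad f (a + s *\<^sub>R x))) (at (a + s *\<^sub>R x))"
      by (rule has_derivative_grad[OF assms])
  qed
  then show "((\<lambda>x. f (a + s *\<^sub>R x)) has_derivative (\<lambda>h. (s *\<^sub>R grad f (a + s *\<^sub>R x)) \<bullet> h)) (at x)"
    by (simp only: inner_scaleR_left inner_scaleR_right)
qed

lemma zero_outside_tsupport: "x \<notin> tsupport f \<Longrightarrow> f x = 0"
  unfolding tsupport_def using closure_subset[of "{x. f x \<noteq> 0}"] by auto

lemma grad_zero_outside_tsupport:
  assumes "x \<notin> tsupport f" shows "grad f x = 0"
proof (rule grad_eqI)
  have o: "open (- tsupport f)" by (simp add: tsupport_def open_Compl)
  show "(f has_derivative (\<lambda>h. 0 \<bullet> h)) (at x)"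
    by (rule has_derivative_transform_within_open[OF _ o, of "\<lambda>_. 0"])
       (use assms zero_outside_tsupport in force)+
qed

section \<open>Integrals over the whole space and affine substitution\<close>

lemma integrable_compact_support:
  fixes f :: "'a::euclidean_space \<Rightarrow> real"
  assumes "continuous_on UNIV f" "compact S" "\<And>x. x \<notin> S \<Longrightarrow> f x = 0"
  shows "integrable lborel f"
proof -
  have "integrable lborel (\<lambda>x. indicator S x *\<^sub>R f x)"
    using assms(2) continuous_on_subset[OF assms(1)] by (intro borel_integrable_compact) auto
  moreover have "(\<lambda>x. indicator S x *\<^sub>R f x) = f"
    using assms(3) by (auto simp: fun_eq_iff indicator_def)
  ultimately show ?thesis by simp
qed

text \<open>A bridge: \<open>lambda_pq\<close> is built on the Henstock-Kurzweil integral over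
  \<Omega>, while Fubini, substitution and dominated convergence are applied to Lebesgue integrals
  over the whole space.\<close>

lemma integral_eq_lborel:
  fixes f :: "'a::euclidean_space \<Rightarrow> real"
  assumes "integrable lborel f" "\<And>x. x \<notin> S \<Longrightarrow> f x = 0"
  shows "integral S f = integral\<^sup>L lborel f"
proof -
  have "integral S f = integral UNIV (\<lambda>x. if x \<in> S then f x else 0)"
    by (simp add: integral_restrict_UNIV)
  also have "(\<lambda>x. if x \<in> S then f x else 0) = f" using assms(2) by auto
  finally show ?thesis
    using has_integral_integral_lborel[OF assms(1)] by (simp add: integral_unique)
qed

lemma lborel_integral_affine:
  fixes f :: "'a::euclidean_space \<Rightarrow> real"
  assumes "f \<in> borel_measurable borel" "c \<noteq> 0"
  shows "integral\<^sup>L lborel f = \<bar>c\<bar> ^ DIM('a) * integral\<^sup>L lborel (\<lambda>x. f (t + c *\<^sub>R x))"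
proof -
  have "integral\<^sup>L lborel f = integral\<^sup>L (density (distr lborel borel (\<lambda>x. t + c *\<^sub>R x)) (\<lambda>_. ennreal (\<bar>c\<bar> ^ DIM('a)))) f"
    using lborel_affine[OF assms(2), of t] by simp
  also have "\<dots> = integral\<^sup>L (distr lborel borel (\<lambda>x. t + c *\<^sub>R x)) (\<lambda>x. \<bar>c\<bar> ^ DIM('a) *\<^sub>R f x)"
    using assms by (intro integral_density) auto
  also have "\<dots> = \<bar>c\<bar> ^ DIM('a) * integral\<^sup>L lborel (\<lambda>x. f (t + c *\<^sub>R x))"
    using assms by (subst integral_distr) auto
  finally show ?thesis .
qed

lemma nn_integral_lborel_affine:
  fixes f :: "'a::euclidean_space \<Rightarrow> ennreal"
  assumes "f \<in> borel_measurable borel" "c \<noteq> 0"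
  shows "integral\<^sup>N lborel f = ennreal (\<bar>c\<bar> ^ DIM('a)) * (\<integral>\<^sup>+ x. f (t + c *\<^sub>R x) \<partial>lborel)"
proof -
  have "integral\<^sup>N lborel f = integral\<^sup>N (density (distr lborel borel (\<lambda>x. t + c *\<^sub>R x)) (\<lambda>_. ennreal (\<bar>c\<bar> ^ DIM('a)))) f"
    using lborel_affine[OF assms(2), of t] by simp
  also have "\<dots> = integral\<^sup>N (distr lborel borel (\<lambda>x. t + c *\<^sub>R x)) (\<lambda>x. ennreal (\<bar>c\<bar> ^ DIM('a)) * f x)"
    using assms by (intro nn_integral_density) auto
  also have "\<dots> = ennreal (\<bar>c\<bar> ^ DIM('a)) * (\<integral>\<^sup>+ x. f (t + c *\<^sub>R x) \<partial>lborel)"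
    using assms by (subst nn_integral_distr) (auto simp: nn_integral_cmult)
  finally show ?thesis .
qed

lemma C0_inftyD:
  assumes "\<psi> \<in> C0_infty \<Omega>"
  shows "smooth \<psi>" "compact (tsupport \<psi>)" "tsupport \<psi> \<subseteq> \<Omega>"
    "\<And>x. x \<notin> \<Omega> \<Longrightarrow> \<psi> x = 0" "\<And>x. x \<notin> \<Omega> \<Longrightarrow> grad \<psi> x = 0"
  using assms zero_outside_tsupport grad_zero_outside_tsupport unfolding C0_infty_def by blast+

lemma C0_infty_integrals:
  assumes "\<psi> \<in> C0_infty \<Omega>" "p > 0"
  shows "integrable lborel (\<lambda>x. \<bar>\<psi> x\<bar> powr p)"
    and "integral \<Omega> (\<lambda>x. \<bar>\<psi> x\<bar> powr p) = integral\<^sup>L lborel (\<lambda>x. \<bar>\<psi> x\<bar> powr p)"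
    and "integrable lborel (\<lambda>x. norm (grad \<psi> x) powr p)"
    and "integral \<Omega> (\<lambda>x. norm (grad \<psi> x) powr p) = integral\<^sup>L lborel (\<lambda>x. norm (grad \<psi> x) powr p)"
proof -
  note \<psi> = C0_inftyD[OF assms(1)]
  show 1: "integrable lborel (\<lambda>x. \<bar>\<psi> x\<bar> powr p)"
    using \<psi> zero_outside_tsupport[of _ \<psi>] assms(2)
    by (intro integrable_compact_support[of _ "tsupport \<psi>"] continuous_on_powr' continuous_intros smooth_continuous) auto
  show "integral \<Omega> (\<lambda>x. \<bar>\<psi> x\<bar> powr p) = integral\<^sup>L lborel (\<lambda>x. \<bar>\<psi> x\<bar> powr p)"
    using \<psi> by (intro integral_eq_lborel 1) auto
  show 2: "integrable lborel (\<lambda>x. norm (grad \<psi> x) powr p)"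
    using \<psi> grad_zero_outside_tsupport[of _ \<psi>] assms(2)
    by (intro integrable_compact_support[of _ "tsupport \<psi>"] continuous_on_powr' continuous_intros smooth_continuous_grad) auto
  show "integral \<Omega> (\<lambda>x. norm (grad \<psi> x) powr p) = integral\<^sup>L lborel (\<lambda>x. norm (grad \<psi> x) powr p)"
    using \<psi> by (intro integral_eq_lborel 2) auto
qed

lemma C0_inftyI:
  assumes "smooth \<psi>" "S \<subseteq> \<Omega>" "{x. \<psi> x \<noteq> 0} \<subseteq> S" "compact S"
  shows "\<psi> \<in> C0_infty \<Omega>"
proof -
  have "tsupport \<psi> \<subseteq> S"
    unfolding tsupport_def using compact_imp_closed[OF assms(4)] assms(3) by (simp add: closure_minimal)
  moreover have "compact (tsupport \<psi>)"
    unfolding tsupport_def using bounded_subset[OF compact_imp_bounded[OF assms(4)] assms(3)]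
    by (simp add: compact_closure)
  ultimately show ?thesis unfolding C0_infty_def using assms by auto
qed

lemma C0_infty_affine:
  assumes "\<psi> \<in> C0_infty \<Omega>" and c: "c \<noteq> 0" and sub: "\<And>x. a + c *\<^sub>R x \<in> \<Omega> \<Longrightarrow> x \<in> \<Omega>'"
  shows "(\<lambda>x. k * \<psi> (a + c *\<^sub>R x)) \<in> C0_infty \<Omega>'"
proof -
  note \<psi> = C0_inftyD[OF assms(1)]
  define S where "S = (\<lambda>y. (1 / c) *\<^sub>R (y - a)) ` tsupport \<psi>"
  have cS: "compact S" unfolding S_def using \<psi>(2) by (intro compact_continuous_image continuous_intros)
  have "S \<subseteq> \<Omega>'" unfolding S_def using \<psi>(3) c by (auto intro!: sub)
  moreover have "{x. k * \<psi> (a + c *\<^sub>R x) \<noteq> 0} \<subseteq> S"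
  proof
    fix x assume "x \<in> {x. k * \<psi> (a + c *\<^sub>R x) \<noteq> 0}"
    then have "a + c *\<^sub>R x \<in> tsupport \<psi>" using zero_outside_tsupport by fastforce
    moreover have "x = (1 / c) *\<^sub>R ((a + c *\<^sub>R x) - a)" using c by simp
    ultimately show "x \<in> S" unfolding S_def by blast
  qed
  ultimately show ?thesis
    using cS smooth_affine[OF \<psi>(1)] by (intro C0_inftyI[of _ S])
qed

lemma C0_infty_nonneg_energy:
  "\<psi> \<in> C0_infty \<Omega> \<Longrightarrow> 0 \<le> integral \<Omega> (\<lambda>x. norm (grad \<psi> x) powr p)"
  by (cases "(\<lambda>x. norm (grad \<psi> x) powr p) integrable_on \<Omega>")
     (auto intro!: Henstock_Kurzweil_Integration.integral_nonneg simp: not_integrable_integral)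

text \<open>The Rayleigh quotient bound for functions that are not normalized: the multiple of
  \<psi> by k = M powr (- 1 / q) has mass 1, and its energy carries the factor M powr (- p /
  q).\<close>

lemma lambda_pq_le:
  fixes \<Omega> :: "'a::euclidean_space set"
  assumes \<psi>: "\<psi> \<in> C0_infty \<Omega>" and p: "p > 0" and q: "q > 0"
    and pos: "0 < integral\<^sup>L lborel (\<lambda>x. \<bar>\<psi> x\<bar> powr q)"
  shows "lambda_pq p q \<Omega> * (integral\<^sup>L lborel (\<lambda>x. \<bar>\<psi> x\<bar> powr q)) powr (p / q)
          \<le> integral\<^sup>L lborel (\<lambda>x. norm (grad \<psi> x) powr p)"
proof -
  define M where "M = integral\<^sup>L lborel (\<lambda>x. \<bar>\<psi> x\<bar> powr q)"
  define k where "k = M powr (- 1 / q)"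
  have k: "k > 0" using pos by (simp add: k_def M_def)
  have kq: "k powr q = 1 / M" using pos q by (simp add: k_def M_def powr_powr powr_minus_divide del: powr_minus_divide)
  have kp: "k powr p = 1 / M powr (p / q)" using q by (simp add: k_def powr_powr) (simp add: powr_minus_divide)
  have \<phi>: "(\<lambda>x. k * \<psi> x) \<in> C0_infty \<Omega>"
    using C0_infty_affine[OF \<psi>, of 1 0 \<Omega> k] by simp
  have g: "grad (\<lambda>x. k * \<psi> x) x = k *\<^sub>R grad \<psi> x" for x
    using C0_inftyD(1)[OF \<psi>] by (intro grad_cmult smooth_differentiable)
  have "integral \<Omega> (\<lambda>x. \<bar>k * \<psi> x\<bar> powr q) = integral\<^sup>L lborel (\<lambda>x. k powr q * \<bar>\<psi> x\<bar> powr q)"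
    unfolding C0_infty_integrals(2)[OF \<phi> q] using k by (simp add: abs_mult powr_mult)
  also have "\<dots> = 1" using pos kq by (simp add: M_def)
  finally have 1: "integral \<Omega> (\<lambda>x. \<bar>k * \<psi> x\<bar> powr q) = 1" .
  have 2: "integral \<Omega> (\<lambda>x. norm (grad (\<lambda>x. k * \<psi> x) x) powr p)
      = k powr p * integral\<^sup>L lborel (\<lambda>x. norm (grad \<psi> x) powr p)"
    unfolding C0_infty_integrals(4)[OF \<phi> p] g using k C0_infty_integrals(4)[OF \<psi> p] by (simp add: powr_mult)
  have "lambda_pq p q \<Omega> \<le> integral \<Omega> (\<lambda>x. norm (grad (\<lambda>x. k * \<psi> x) x) powr p)"
    unfolding lambda_pq_def
    using 1 \<phi> C0_infty_nonneg_energy by (intro cInf_lower bdd_belowI[of _ 0]) blast+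
  then show ?thesis
    unfolding 2 kp using pos by (simp add: M_def field_simps)
qed

section \<open>Mollification\<close>

text \<open>Normalizing the bump requires a positive integral: if it were 0, the bump would vanish
  almost everywhere, but it is positive on the open ball of radius e.\<close>

lemma ex_mollifier:
  assumes e: "e > 0"
  obtains f :: "'a::euclidean_space \<Rightarrow> real"
  where "f \<in> bump_alg e" "\<And>x. f x \<ge> 0" "\<And>x. norm x \<ge> e \<Longrightarrow> f x = 0"
    "integrable lborel f" "integral\<^sup>L lborel f = 1"
proof -
  define g where "g = (\<lambda>x::'a. flat 0 (e\<^sup>2 - x \<bullet> x))"
  have g: "g \<in> bump_alg e" unfolding g_def by (rule bump_alg.flat)
  have g0: "g x \<ge> 0" for x by (simp add: g_def flat_def)
  have gz: "g x = 0" if "norm x \<ge> e" for x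
  proof -
    have "e\<^sup>2 \<le> (norm x)\<^sup>2" using that e by (intro power_mono) auto
    then show ?thesis by (simp add: g_def flat_def power2_norm_eq_inner)
  qed
  have cont: "continuous_on UNIV g" using bump_alg_continuous[OF g] .
  have int: "integrable lborel g"
    by (rule integrable_compact_support[OF cont compact_cball[of 0 e]]) (auto intro!: gz)
  have "integral\<^sup>L lborel g \<noteq> 0"
  proof
    assume "integral\<^sup>L lborel g = 0"
    then have "AE x in lborel. g x = 0"
      using integral_nonneg_eq_0_iff_AE[OF int] g0 by simp
    then have "AE x in lborel. x \<notin> ball (0::'a) e"
    proof eventually_elim
      case (elim x)
      show ?case
      proof
        assume "x \<in> ball 0 e"
        then have "(norm x)\<^sup>2 < e\<^sup>2" by (intro power_strict_mono) auto
        then show False using elim by (simp add: g_def flat_def power2_norm_eq_inner)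
      qed
    qed
    then have "emeasure lborel (ball (0::'a) e) = 0"
      by (subst (asm) AE_iff_measurable[where N="ball 0 e"]) auto
    then show False using content_ball_pos[OF e, of "0::'a"] by (simp add: measure_def)
  qed
  then have pos: "integral\<^sup>L lborel g > 0" using g0 by (simp add: order_less_le integral_nonneg)
  show ?thesis
  proof
    show "(\<lambda>x. (1 / integral\<^sup>L lborel g) * g x) \<in> bump_alg e" by (intro bump_alg.mult bump_alg.const g)
  qed (use pos g0 gz int in auto)
qed

text \<open>The kernel is a probability density supported in the ball of radius e, so \<psi> x is an
  average of u over \<open>cball x e\<close>. Averages inherit bounds on |u - c| and local Lipschitz
  constants; \<open>e < k\<close> leaves room to move x as well. One \<psi> serves all points and
  all constants at once, which later gives pointwise limits together with uniform bounds.\<close>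

lemma mollify:
  fixes u :: "'a::euclidean_space \<Rightarrow> real"
  assumes u: "continuous_on UNIV u" and S: "compact S" "\<And>x. x \<notin> S \<Longrightarrow> u x = 0"
    and e: "e > 0" and sub: "\<And>x. x \<in> S \<Longrightarrow> cball x e \<subseteq> \<Omega>"
  obtains \<psi> where "\<psi> \<in> C0_infty \<Omega>"
    "\<And>x c d. (\<And>y. y \<in> cball x e \<Longrightarrow> \<bar>u y - c\<bar> \<le> d) \<Longrightarrow> \<bar>\<psi> x - c\<bar> \<le> d"
    "\<And>x L k. e < k \<Longrightarrow> (\<And>a b. a \<in> ball x k \<Longrightarrow> b \<in> ball x k \<Longrightarrow> \<bar>u a - u b\<bar> \<le> L * norm (a - b))
        \<Longrightarrow> norm (grad \<psi> x) \<le> L"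
proof -
  obtain f :: "'a \<Rightarrow> real" where f: "f \<in> bump_alg e" "\<And>x. f x \<ge> 0" "\<And>x. norm x \<ge> e \<Longrightarrow> f x = 0"
    "integrable lborel f" "integral\<^sup>L lborel f = 1"
    using ex_mollifier[OF e] by blast
  obtain a b where ab: "S \<subseteq> cbox a b" using bounded_subset_cbox_symmetric[OF compact_imp_bounded[OF S(1)]] by blast
  define \<psi> where "\<psi> x = integral (cbox a b) (\<lambda>y. u y * f (x - y))" for x
  have fc: "continuous_on UNIV f" using bump_alg_continuous[OF f(1)] .
  have int1: "integrable lborel (\<lambda>y. u y * f (x - y))" for x
    by (rule integrable_compact_support[OF _ S(1)])
       (auto intro!: continuous_intros continuous_on_compose2[OF fc] u simp: S(2))
  have int: "integrable lborel (\<lambda>z. u (x - z) * f z)" for x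
    by (rule integrable_compact_support[OF _ compact_cball[of 0 e]])
       (auto intro!: continuous_intros continuous_on_compose2[OF u] fc f(3))
  have \<psi>: "\<psi> x = integral\<^sup>L lborel (\<lambda>z. u (x - z) * f z)" for x
  proof -
    have "\<psi> x = integral\<^sup>L lborel (\<lambda>y. u y * f (x - y))"
      unfolding \<psi>_def using int1 ab S(2) by (intro integral_eq_lborel) auto
    also have "\<dots> = \<bar>-1\<bar> ^ DIM('a) * integral\<^sup>L lborel (\<lambda>y. u (x + (-1) *\<^sub>R y) * f (x - (x + (-1) *\<^sub>R y)))"
      using int1 by (intro lborel_integral_affine) auto
    finally show ?thesis by simp
  qed
  have sm: "smooth \<psi>" unfolding \<psi>_def using convolution_smooth[OF u f(1)] .
  define T where "T = {x + y |x y. x \<in> S \<and> y \<in> cball 0 e}"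
  have mem: "\<psi> \<in> C0_infty \<Omega>"
  proof (rule C0_inftyI[OF sm, of T])
    show "compact T" unfolding T_def using S(1) by (intro compact_sums) auto
    show "T \<subseteq> \<Omega>" unfolding T_def using sub by (force simp: dist_norm)
    show "{x. \<psi> x \<noteq> 0} \<subseteq> T"
    proof (rule subsetI, rule ccontr)
      fix x assume x: "x \<in> {x. \<psi> x \<noteq> 0}" "x \<notin> T"
      have "u (x - z) * f z = 0" for z
      proof (cases "norm z \<ge> e")
        case False
        have "x - z \<notin> S"
        proof
          assume "x - z \<in> S"
          then have "(x - z) + z \<in> T" unfolding T_def using False by (intro CollectI exI[of _ "x - z"] exI[of _ z]) auto
          then show False using x(2) by simp
        qed
        then show ?thesis using S(2) by simp
      qed (simp add: f(3))
      then have "(\<lambda>z. u (x - z) * f z) = (\<lambda>z. 0)" by blast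
      then show False using x(1) by (simp add: \<psi> del: mult_eq_0_iff)
    qed
  qed
  show ?thesis
  proof
    show "\<psi> \<in> C0_infty \<Omega>" by (rule mem)
  next
    fix x c d assume *: "\<And>y. y \<in> cball x e \<Longrightarrow> \<bar>u y - c\<bar> \<le> d"
    have "\<psi> x - c = integral\<^sup>L lborel (\<lambda>z. u (x - z) * f z - c * f z)"
      using int f by (simp add: \<psi>)
    also have "\<bar>\<dots>\<bar> \<le> integral\<^sup>L lborel (\<lambda>z. d * f z)"
      unfolding real_norm_def[symmetric]
    proof (rule Bochner_Integration.integral_norm_bound_integral)
      fix z
      show "norm (u (x - z) * f z - c * f z) \<le> d * f z"
      proof (cases "norm z \<ge> e")
        case False
        then have "\<bar>u (x - z) - c\<bar> * f z \<le> d * f z"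
          by (intro mult_right_mono * f(2)) (auto simp: dist_norm)
        moreover have "norm (u (x - z) * f z - c * f z) = \<bar>u (x - z) - c\<bar> * f z"
          using f(2)[of z] by (simp add: left_diff_distrib[symmetric] abs_mult)
        ultimately show ?thesis by simp
      qed (simp add: f(3))
    qed (use int f in auto)
    finally show "\<bar>\<psi> x - c\<bar> \<le> d" using f by simp
  next
    fix x L k assume k: "e < k"
      and *: "\<And>a b. a \<in> ball x k \<Longrightarrow> b \<in> ball x k \<Longrightarrow> \<bar>u a - u b\<bar> \<le> L * norm (a - b)"
    show "norm (grad \<psi> x) \<le> L"
    proof (rule norm_grad_le[OF smooth_differentiable[OF sm], of "k - e"])
      fix h :: 'a assume h: "norm h < k - e"
      have "\<psi> (x + h) - \<psi> x = integral\<^sup>L lborel (\<lambda>z. u (x + h - z) * f z - u (x - z) * f z)"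
        using int by (simp add: \<psi>)
      also have "\<bar>\<dots>\<bar> \<le> integral\<^sup>L lborel (\<lambda>z. (L * norm h) * f z)"
        unfolding real_norm_def[symmetric]
      proof (rule Bochner_Integration.integral_norm_bound_integral)
        fix z
        show "norm (u (x + h - z) * f z - u (x - z) * f z) \<le> (L * norm h) * f z"
        proof (cases "norm z \<ge> e")
          case False
          have "norm (h - z) < k" using norm_triangle_ineq4[of h z] h False by linarith
          then have "\<bar>u (x + h - z) - u (x - z)\<bar> \<le> L * norm ((x + h - z) - (x - z))"
            using False k by (intro *) (auto simp: dist_norm norm_minus_commute algebra_simps)
          then have "\<bar>u (x + h - z) - u (x - z)\<bar> * f z \<le> (L * norm h) * f z"
            by (intro mult_right_mono f(2)) simp
          moreover have "norm (u (x + h - z) * f z - u (x - z) * f z) = \<bar>u (x + h - z) - u (x - z)\<bar> * f z"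
            using f(2)[of z] by (simp add: left_diff_distrib[symmetric] abs_mult)
          ultimately show ?thesis by simp
        qed (simp add: f(3))
      qed (use int f in auto)
      finally show "\<bar>\<psi> (x + h) - \<psi> x\<bar> \<le> L * norm h" using f by simp
    qed (use k in simp)
  qed
qed

section \<open>Polar coordinates for a gauge\<close>

text \<open>The abstraction behind polar coordinates. Its instances are the norm, which gives the
  rays of the unit ball, the Minkowski functional of the body, and that of the truncated
  body.\<close>

locale gauge =
  fixes j :: "'a::euclidean_space \<Rightarrow> real"
  assumes hom: "\<And>t x. t \<ge> 0 \<Longrightarrow> j (t *\<^sub>R x) = t * j x"
    and pos: "\<And>x. x \<noteq> 0 \<Longrightarrow> j x > 0"
    and cont: "continuous_on UNIV j"
begin

lemma j_0 [simp]: "j 0 = 0"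
  using hom[of 0 0] by simp

lemma nonneg: "j x \<ge> 0"
  using pos[of x] by (cases "x = 0") auto

lemma borel [measurable]: "j \<in> borel_measurable borel"
  using cont by (rule borel_measurable_continuous_onI)

lemma lower_bound: obtains c where "c > 0" "\<And>x. c * norm x \<le> j x"
proof -
  have "sphere (0::'a) 1 \<noteq> {}" by simp
  then obtain z :: 'a where z: "norm z = 1" "\<And>y. norm y = 1 \<Longrightarrow> j z \<le> j y"
    using continuous_attains_inf[of "sphere (0::'a) 1" j] cont continuous_on_subset by force
  have "j z * norm x \<le> j x" for x
  proof (cases "x = 0")
    case False
    then have "j z \<le> j ((1 / norm x) *\<^sub>R x)" by (intro z(2)) simp
    also have "\<dots> = j x / norm x" by (simp add: hom)
    finally show ?thesis using False by (simp add: field_simps)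
  qed simp
  moreover have "z \<noteq> 0" using z(1) by auto
  ultimately show ?thesis using pos that by blast
qed

lemma compact_sublevel: "compact {x. j x \<le> t}"
proof -
  obtain c where c: "c > 0" "\<And>x. c * norm x \<le> j x" using lower_bound by blast
  have "norm x \<le> t / c" if "j x \<le> t" for x
    using c(1) c(2)[of x] that by (simp add: pos_le_divide_eq mult.commute)
  then have "bounded {x. j x \<le> t}" unfolding bounded_iff by blast
  moreover have "closed {x. j x \<le> t}"
    using cont by (intro closed_Collect_le continuous_intros)
  ultimately show ?thesis by (simp add: compact_eq_bounded_closed)
qed

lemma open_sublevel: "open {x. j x < t}"
  using cont by (intro open_Collect_less continuous_intros)

lemma emeasure_sublevel_finite: "emeasure lborel ({x. j x < 1} \<inter> A) < \<infinity>"
proof -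
  have "bounded ({x. j x < 1} \<inter> A)"
    by (rule bounded_subset[OF compact_imp_bounded[OF compact_sublevel[of 1]]]) auto
  then show ?thesis by (rule emeasure_bounded_finite)
qed

text \<open>Inserting this kernel under \<open>\<integral>g\<close>, exchanging the integrals and rescaling \<open>x = s y\<close> yields polar
  coordinates; no surface measure is needed because directions are represented by the points of
  the unit sublevel set.\<close>

lemma radial_kernel:
  assumes "x \<noteq> 0"
  shows "(\<integral>\<^sup>+ s. ennreal (real DIM('a) * j x ^ DIM('a) / s ^ (DIM('a) + 1)) * indicator {j x <..} s \<partial>lborel) = 1"
proof -
  let ?n = "DIM('a)" and ?c = "j x"
  have c: "?c > 0" using pos assms by blast
  have "(\<integral>\<^sup>+ s. ennreal (real ?n * ?c ^ ?n / s ^ (?n + 1)) * indicator {?c <..} s \<partial>lborel)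
      = (\<integral>\<^sup>+ s. ennreal (real ?n * ?c ^ ?n / s ^ (?n + 1)) * indicator {?c ..} s \<partial>lborel)"
    using AE_lborel_singleton[of ?c] by (intro nn_integral_cong_AE) (auto elim!: eventually_mono simp: indicator_def)
  also have "\<dots> = ennreal (0 - (- (?c ^ ?n) / ?c ^ ?n))"
  proof (rule nn_integral_FTC_atLeast[where F="\<lambda>s. - (?c ^ ?n) / s ^ ?n"])
    fix s assume s: "?c \<le> s"
    obtain m where m: "?n = Suc m" using DIM_positive[where 'a='a] gr0_conv_Suc by blast
    have "((\<lambda>s. s ^ Suc m) has_real_derivative real (Suc m) * s ^ m) (at s)"
      using DERIV_pow[of "Suc m" s] by simp
    note d = DERIV_divide[OF DERIV_const[of "- (?c ^ Suc m)"] this]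
    show "((\<lambda>s. - (?c ^ ?n) / s ^ ?n) has_real_derivative real ?n * ?c ^ ?n / s ^ (?n + 1)) (at s)"
      unfolding m using s c by (intro DERIV_cong[OF d]) (auto simp: field_simps)
    show "0 \<le> real ?n * ?c ^ ?n / s ^ (?n + 1)" using s c by auto
  next
    have "filterlim (\<lambda>s::real. s ^ ?n) at_top at_top" by (intro filterlim_pow_at_top filterlim_ident) simp
    then have "((\<lambda>s::real. - (?c ^ ?n) / s ^ ?n) \<longlongrightarrow> 0) at_top"
      by (intro real_tendsto_divide_at_top[OF tendsto_const])
    then show "((\<lambda>s::real. - (?c ^ ?n) / s ^ ?n) \<longlongrightarrow> 0) at_top" .
  qed auto
  finally show ?thesis using c by simp
qed

text \<open>Here y stands for a direction, and \<open>(t / j y) *\<^sub>R y\<close> is the point of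
  gauge level t on its ray. The weight N * t^(N - 1) is the same for every gauge, which makes
  integrals over different bodies comparable ray by ray.\<close>

lemma nn_integral_polar:
  fixes g :: "'a \<Rightarrow> ennreal"
  assumes [measurable]: "g \<in> borel_measurable borel"
  shows "integral\<^sup>N lborel g =
    (\<integral>\<^sup>+ y. (\<integral>\<^sup>+ t. g ((t / j y) *\<^sub>R y) * ennreal (real DIM('a) * t ^ (DIM('a) - 1)) * indicator {0<..} t \<partial>lborel)
        * indicator {x. j x < 1} y \<partial>lborel)"
proof -
  let ?n = "DIM('a)"
  obtain m where m: "?n = Suc m" using DIM_positive[where 'a='a] gr0_conv_Suc by blast
  have nz: "AE x in lborel. x \<noteq> (0::'a)" by (rule AE_lborel_singleton)
  have [measurable]: "(\<lambda>(s, x). indicator {j x <..} s :: ennreal) \<in> borel_measurable (lborel \<Otimes>\<^sub>M lborel)"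
  proof -
    have "(\<lambda>(s, x). indicator {j x <..} s :: ennreal) = indicator {z \<in> space (lborel \<Otimes>\<^sub>M lborel). j (snd z) < fst z}"
      by (auto simp: fun_eq_iff indicator_def space_pair_measure)
    then show ?thesis by simp
  qed
  have "integral\<^sup>N lborel g =
     (\<integral>\<^sup>+ x. (\<integral>\<^sup>+ s. g x * (ennreal (real ?n * j x ^ ?n / s ^ (?n + 1)) * indicator {j x <..} s) \<partial>lborel) \<partial>lborel)"
  proof (rule nn_integral_cong_AE, use nz in eventually_elim)
    fix x :: 'a assume "x \<noteq> 0"
    moreover have "(\<integral>\<^sup>+ s. g x * (ennreal (real ?n * j x ^ ?n / s ^ (?n + 1)) * indicator {j x <..} s) \<partial>lborel)
       = g x * (\<integral>\<^sup>+ s. ennreal (real ?n * j x ^ ?n / s ^ (?n + 1)) * indicator {j x <..} s \<partial>lborel)"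
      by (rule nn_integral_cmult) measurable
    ultimately show "g x = (\<integral>\<^sup>+ s. g x * (ennreal (real ?n * j x ^ ?n / s ^ (?n + 1)) * indicator {j x <..} s) \<partial>lborel)"
      by (simp only: radial_kernel mult_1_right not_False_eq_True)
  qed
  also have "\<dots> = (\<integral>\<^sup>+ s. (\<integral>\<^sup>+ x. g x * (ennreal (real ?n * j x ^ ?n / s ^ (?n + 1)) * indicator {j x <..} s) \<partial>lborel) \<partial>lborel)"
    by (rule lborel_pair.Fubini') measurable
  \<comment> \<open>Substitution x = s y: the condition j x < s becomes j y < 1, and the powers of s
    combine to s^n * s^n / s^(n + 1) = s^(n - 1).\<close>
  also have "\<dots> = (\<integral>\<^sup>+ s. (\<integral>\<^sup>+ y. g (s *\<^sub>R y) * ennreal (real ?n * j y ^ ?n * s ^ m) * indicator {x. j x < 1} y * indicator {0<..} s \<partial>lborel) \<partial>lborel)"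
  proof (rule nn_integral_cong)
    fix s :: real
    show "(\<integral>\<^sup>+ x. g x * (ennreal (real ?n * j x ^ ?n / s ^ (?n + 1)) * indicator {j x <..} s) \<partial>lborel)
       = (\<integral>\<^sup>+ y. g (s *\<^sub>R y) * ennreal (real ?n * j y ^ ?n * s ^ m) * indicator {x. j x < 1} y * indicator {0<..} s \<partial>lborel)"
    proof (cases "s > 0")
      case False
      then have "indicator {j x <..} s = (0::ennreal)" for x using nonneg[of x] by (auto simp: indicator_def)
      then show ?thesis using False by simp
    next
      case True
      have "(\<integral>\<^sup>+ x. g x * (ennreal (real ?n * j x ^ ?n / s ^ (?n + 1)) * indicator {j x <..} s) \<partial>lborel)
        = ennreal (\<bar>s\<bar> ^ ?n) * (\<integral>\<^sup>+ y. g (0 + s *\<^sub>R y) * (ennreal (real ?n * j (0 + s *\<^sub>R y) ^ ?n / s ^ (?n + 1)) * indicator {j (0 + s *\<^sub>R y) <..} s) \<partial>lborel)"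
        using True by (intro nn_integral_lborel_affine) auto
      also have "\<dots> = (\<integral>\<^sup>+ y. ennreal (s ^ ?n) * (g (s *\<^sub>R y) * (ennreal (real ?n * j (s *\<^sub>R y) ^ ?n / s ^ (?n + 1)) * indicator {j (s *\<^sub>R y) <..} s)) \<partial>lborel)"
        using True by (subst nn_integral_cmult) auto
      also have "\<dots> = (\<integral>\<^sup>+ y. g (s *\<^sub>R y) * ennreal (real ?n * j y ^ ?n * s ^ m) * indicator {x. j x < 1} y * indicator {0<..} s \<partial>lborel)"
      proof (rule nn_integral_cong)
        fix y
        have e1: "ennreal (s ^ ?n) * ennreal (real ?n * j (s *\<^sub>R y) ^ ?n / s ^ (?n + 1)) = ennreal (real ?n * j y ^ ?n * s ^ m)"
        proof -
          have "s ^ ?n * (real ?n * j (s *\<^sub>R y) ^ ?n / s ^ (?n + 1)) = real ?n * j y ^ ?n * s ^ m"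
            using True unfolding m by (simp add: hom power_mult_distrib del: of_nat_Suc)
          then show ?thesis using True nonneg by (simp only: ennreal_mult'[symmetric] zero_le_power less_imp_le)
        qed
        have e2: "indicator {j (s *\<^sub>R y) <..} s = (indicator {x. j x < 1} y :: ennreal)"
          using True by (auto simp: hom indicator_def)
        have e3: "indicator {0<..} s = (1::ennreal)" using True by simp
        show "ennreal (s ^ ?n) * (g (s *\<^sub>R y) * (ennreal (real ?n * j (s *\<^sub>R y) ^ ?n / s ^ (?n + 1)) * indicator {j (s *\<^sub>R y) <..} s))
          = g (s *\<^sub>R y) * ennreal (real ?n * j y ^ ?n * s ^ m) * indicator {x. j x < 1} y * indicator {0<..} s"
          by (simp only: e1[symmetric] e2 e3 mult_1_right mult_1_left mult.assoc[where 'a=ennreal] mult.commute[where 'a=ennreal] mult.left_commute[where 'a=ennreal])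
      qed
      finally show ?thesis .
    qed
  qed
  also have "\<dots> = (\<integral>\<^sup>+ y. (\<integral>\<^sup>+ s. g (s *\<^sub>R y) * ennreal (real ?n * j y ^ ?n * s ^ m) * indicator {x. j x < 1} y * indicator {0<..} s \<partial>lborel) \<partial>lborel)"
    by (rule lborel_pair.Fubini'[symmetric]) measurable
  \<comment> \<open>Substitution s = t / j y: since (j y)^n * s^(n - 1) ds = t^(n - 1) dt, the
    weight loses its dependence on y.\<close>
  also have "\<dots> = (\<integral>\<^sup>+ y. (\<integral>\<^sup>+ t. g ((t / j y) *\<^sub>R y) * ennreal (real DIM('a) * t ^ (DIM('a) - 1)) * indicator {0<..} t \<partial>lborel)
        * indicator {x. j x < 1} y \<partial>lborel)"
  proof (rule nn_integral_cong_AE, use nz in eventually_elim)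
    fix y :: 'a assume "y \<noteq> 0"
    then have c: "j y > 0" by (rule pos)
    have "(\<integral>\<^sup>+ s. g (s *\<^sub>R y) * ennreal (real ?n * j y ^ ?n * s ^ m) * indicator {x. j x < 1} y * indicator {0<..} s \<partial>lborel)
      = ennreal \<bar>1 / j y\<bar> * (\<integral>\<^sup>+ t. g ((0 + 1 / j y * t) *\<^sub>R y) * ennreal (real ?n * j y ^ ?n * (0 + 1 / j y * t) ^ m) * indicator {x. j x < 1} y * indicator {0<..} (0 + 1 / j y * t) \<partial>lborel)"
      using c by (intro nn_integral_real_affine) auto
    also have "\<dots> = (\<integral>\<^sup>+ t. ennreal (1 / j y) * (g ((t / j y) *\<^sub>R y) * ennreal (real ?n * j y ^ ?n * (t / j y) ^ m) * indicator {x. j x < 1} y * indicator {0<..} (t / j y)) \<partial>lborel)"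
      using c by (subst nn_integral_cmult) auto
    also have "\<dots> = (\<integral>\<^sup>+ t. (g ((t / j y) *\<^sub>R y) * ennreal (real ?n * t ^ (?n - 1)) * indicator {0<..} t) * indicator {x. j x < 1} y \<partial>lborel)"
    proof (rule nn_integral_cong)
      fix t
      show "ennreal (1 / j y) * (g ((t / j y) *\<^sub>R y) * ennreal (real ?n * j y ^ ?n * (t / j y) ^ m) * indicator {x. j x < 1} y * indicator {0<..} (t / j y))
        = (g ((t / j y) *\<^sub>R y) * ennreal (real ?n * t ^ (?n - 1)) * indicator {0<..} t) * indicator {x. j x < 1} y"
      proof (cases "t > 0")
        case True
        have e1: "ennreal (1 / j y) * ennreal (real ?n * j y ^ ?n * (t / j y) ^ m) = ennreal (real ?n * t ^ m)"
        proof -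
          have "1 / j y * (real ?n * j y ^ ?n * (t / j y) ^ m) = real ?n * t ^ m"
            using c unfolding m by (simp add: power_divide field_simps)
          then show ?thesis using c by (simp only: ennreal_mult'[symmetric] zero_le_divide_1_iff less_imp_le)
        qed
        have e2: "indicator {0<..} (t / j y) = (1::ennreal)" "indicator {0<..} t = (1::ennreal)"
          using True c by simp_all
        have e3: "?n - 1 = m" using m by simp
        show ?thesis by (simp only: e1[symmetric] e2 e3 mult_1_right mult_1_left mult.assoc[where 'a=ennreal] mult.commute[where 'a=ennreal] mult.left_commute[where 'a=ennreal])
      next
        case False
        then have "\<not> t / j y > 0" using c by (simp add: zero_less_divide_iff)
        then show ?thesis using False by simp
      qed
    qed
    also have "\<dots> = (\<integral>\<^sup>+ t. g ((t / j y) *\<^sub>R y) * ennreal (real ?n * t ^ (?n - 1)) * indicator {0<..} t \<partial>lborel) * indicator {x. j x < 1} y"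
      by (rule nn_integral_multc) auto
    finally show "(\<integral>\<^sup>+ s. g (s *\<^sub>R y) * ennreal (real ?n * j y ^ ?n * s ^ m) * indicator {x. j x < 1} y * indicator {0<..} s \<partial>lborel) = \<dots>" .
  qed
  finally show ?thesis .
qed

text \<open>In polar coordinates f (j x) depends on the level t only, and membership in the cone A
  on the direction only, so the integral is a product. The cones used later are the whole space, C
  and its complement.\<close>

lemma nn_integral_radial:
  fixes f :: "real \<Rightarrow> ennreal"
  assumes [measurable]: "f \<in> borel_measurable borel" "A \<in> sets borel"
    and cone: "\<And>x t. t > 0 \<Longrightarrow> t *\<^sub>R x \<in> A \<longleftrightarrow> x \<in> A"
  shows "(\<integral>\<^sup>+ x. f (j x) * indicator A x \<partial>lborel) =
    emeasure lborel ({x. j x < 1} \<inter> A) *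
      (\<integral>\<^sup>+ t. f t * ennreal (real DIM('a) * t ^ (DIM('a) - 1)) * indicator {0<..} t \<partial>lborel)"
proof -
  let ?I = "\<integral>\<^sup>+ t. f t * ennreal (real DIM('a) * t ^ (DIM('a) - 1)) * indicator {0<..} t \<partial>lborel"
  have nz: "AE x in lborel. x \<noteq> (0::'a)" by (rule AE_lborel_singleton)
  have [measurable]: "{x. j x < 1} \<in> sets borel" by measurable
  have "(\<integral>\<^sup>+ x. f (j x) * indicator A x \<partial>lborel) =
    (\<integral>\<^sup>+ y. (\<integral>\<^sup>+ t. (f (j ((t / j y) *\<^sub>R y)) * indicator A ((t / j y) *\<^sub>R y)) * ennreal (real DIM('a) * t ^ (DIM('a) - 1)) * indicator {0<..} t \<partial>lborel)
        * indicator {x. j x < 1} y \<partial>lborel)"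
    by (rule nn_integral_polar) measurable
  also have "\<dots> = (\<integral>\<^sup>+ y. ?I * indicator ({x. j x < 1} \<inter> A) y \<partial>lborel)"
  proof (rule nn_integral_cong_AE, use nz in eventually_elim)
    fix y :: 'a assume "y \<noteq> 0"
    then have c: "j y > 0" by (rule pos)
    have "(\<integral>\<^sup>+ t. (f (j ((t / j y) *\<^sub>R y)) * indicator A ((t / j y) *\<^sub>R y)) * ennreal (real DIM('a) * t ^ (DIM('a) - 1)) * indicator {0<..} t \<partial>lborel)
       = (\<integral>\<^sup>+ t. (f t * ennreal (real DIM('a) * t ^ (DIM('a) - 1)) * indicator {0<..} t) * indicator A y \<partial>lborel)"
    proof (rule nn_integral_cong)
      fix t
      show "(f (j ((t / j y) *\<^sub>R y)) * indicator A ((t / j y) *\<^sub>R y)) * ennreal (real DIM('a) * t ^ (DIM('a) - 1)) * indicator {0<..} t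
        = (f t * ennreal (real DIM('a) * t ^ (DIM('a) - 1)) * indicator {0<..} t) * indicator A y"
      proof (cases "t > 0")
        case True
        then have "j ((t / j y) *\<^sub>R y) = t" using c by (subst hom) auto
        moreover have "indicator A ((t / j y) *\<^sub>R y) = (indicator A y :: ennreal)"
          using cone[of "t / j y" y] True c by (simp add: indicator_def)
        ultimately show ?thesis by (simp add: ac_simps)
      qed simp
    qed
    also have "\<dots> = ?I * indicator A y" by (rule nn_integral_multc) auto
    finally show "(\<integral>\<^sup>+ t. (f (j ((t / j y) *\<^sub>R y)) * indicator A ((t / j y) *\<^sub>R y)) * ennreal (real DIM('a) * t ^ (DIM('a) - 1)) * indicator {0<..} t \<partial>lborel)
        * indicator {x. j x < 1} y = ?I * indicator ({x. j x < 1} \<inter> A) y"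
      by (simp add: indicator_inter_arith ac_simps)
  qed
  also have "\<dots> = ?I * emeasure lborel ({x. j x < 1} \<inter> A)"
    by (rule nn_integral_cmult_indicator) measurable
  finally show ?thesis by (simp add: mult.commute)
qed

end

lemma gauge_norm: "gauge (norm :: 'a::euclidean_space \<Rightarrow> real)"
  by unfold_locales (auto intro!: continuous_intros)

section \<open>Test functions with a given profile\<close>

text \<open>Two slopes of one gauge: at most 1 / r everywhere, and 1 / h on C, where j is linear. C
  is open so that linearity holds near each of its points, and a cone so that the radial formulas
  apply to it. \<open>C = {}\<close> gives the plain Minkowski functional.\<close>

locale lipschitz_gauge = gauge j for j :: "'a::euclidean_space \<Rightarrow> real" +
  fixes r h :: real and C :: "'a set" and \<nu> :: 'a
  assumes r: "r > 0" and lip: "\<And>x y. \<bar>j x - j y\<bar> \<le> norm (x - y) / r"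
    and h: "h > 0" and \<nu>: "norm \<nu> = 1"
    and open_C: "open C" and cone: "\<And>x t. t > 0 \<Longrightarrow> t *\<^sub>R x \<in> C \<longleftrightarrow> x \<in> C"
    and on_C: "\<And>x. x \<in> C \<Longrightarrow> j x = (x \<bullet> \<nu>) / h"
begin

text \<open>An upper bound for the Lipschitz constant of j near x; it plays the part of |grad j| at
  every point, kinks included.\<close>

definition loc_lip :: "'a \<Rightarrow> real" where
  "loc_lip x = (if x \<in> C then 1 / h else 1 / r)"

lemma loc_lip_pos: "loc_lip x > 0"
  using r h by (simp add: loc_lip_def)

lemma borel_C [measurable]: "C \<in> sets borel"
  using open_C by simp

lemma borel_loc_lip [measurable]: "loc_lip \<in> borel_measurable borel"
  unfolding loc_lip_def by measurable

lemma local_lipschitz: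
  obtains k where "k > 0"
    "\<And>a b. a \<in> ball x k \<Longrightarrow> b \<in> ball x k \<Longrightarrow> \<bar>j a - j b\<bar> \<le> loc_lip x * norm (a - b)"
proof (cases "x \<in> C")
  case True
  then obtain k where k: "k > 0" "ball x k \<subseteq> C" using open_C open_contains_ball by blast
  have "\<bar>j a - j b\<bar> \<le> loc_lip x * norm (a - b)" if "a \<in> ball x k" "b \<in> ball x k" for a b
  proof -
    have "j a - j b = ((a - b) \<bullet> \<nu>) / h"
      using that k on_C by (simp add: subset_iff inner_diff_left diff_divide_distrib)
    moreover have "\<bar>(a - b) \<bullet> \<nu>\<bar> \<le> norm (a - b)"
      using Cauchy_Schwarz_ineq2[of "a - b" \<nu>] \<nu> by simp
    ultimately show ?thesis using True h by (simp add: loc_lip_def divide_right_mono)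
  qed
  then show ?thesis using k that by blast
next
  case False
  show ?thesis by (rule that[of 1]) (use lip False in \<open>auto simp: loc_lip_def\<close>)
qed

text \<open>A chain rule for Lipschitz constants: the mean value theorem for \<Phi> near j x,
  followed by \<open>local_lipschitz\<close>.\<close>

lemma profile_local_lipschitz:
  assumes \<Phi>: "\<And>t. (\<Phi> has_real_derivative \<Phi>' t) (at t)"
    and B: "\<And>t. \<bar>t - j x\<bar> < \<delta> \<Longrightarrow> \<bar>\<Phi>' t\<bar> \<le> B" and \<delta>: "\<delta> > 0"
  obtains k where "k > 0"
    "\<And>a b. a \<in> ball x k \<Longrightarrow> b \<in> ball x k \<Longrightarrow> \<bar>\<Phi> (j a) - \<Phi> (j b)\<bar> \<le> (B * loc_lip x) * norm (a - b)"
proof -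
  obtain k where k: "k > 0"
    "\<And>a b. a \<in> ball x k \<Longrightarrow> b \<in> ball x k \<Longrightarrow> \<bar>j a - j b\<bar> \<le> loc_lip x * norm (a - b)"
    using local_lipschitz by blast
  have B0: "B \<ge> 0" using B[of "j x"] \<delta> by simp
  \<comment> \<open>The bound \<delta> * r makes j map the ball around x into the
    \<delta>-neighbourhood of j x, where B controls the derivative.\<close>
  define k' where "k' = min k (\<delta> * r)"
  have k'0: "k' > 0" using k(1) \<delta> r by (simp add: k'_def)
  have near: "j a \<in> ball (j x) \<delta>" if "a \<in> ball x k'" for a
  proof -
    have "norm (x - a) / r < \<delta>" using that r by (simp add: k'_def dist_norm pos_divide_less_eq)
    then show ?thesis using lip[of x a] by (simp add: dist_real_def)
  qed
  have "\<bar>\<Phi> (j a) - \<Phi> (j b)\<bar> \<le> (B * loc_lip x) * norm (a - b)" if ab: "a \<in> ball x k'" "b \<in> ball x k'" for a b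
  proof -
    have "norm (\<Phi> (j a) - \<Phi> (j b)) \<le> B * norm (j a - j b)"
    proof (rule field_differentiable_bound[of "ball (j x) \<delta>" \<Phi> \<Phi>'])
      show "(\<Phi> has_field_derivative \<Phi>' z) (at z within ball (j x) \<delta>)" for z
        using \<Phi> has_field_derivative_at_within by blast
      show "norm (\<Phi>' z) \<le> B" if "z \<in> ball (j x) \<delta>" for z
        using B[of z] that by (simp add: dist_real_def abs_minus_commute)
    qed (use near ab in auto)
    also have "\<dots> \<le> B * (loc_lip x * norm (a - b))"
      using k(2)[of a b] ab B0 by (intro mult_left_mono) (auto simp: k'_def)
    finally show ?thesis by (simp add: mult.assoc)
  qed
  then show ?thesis using k'0 that by blast
qed

text \<open>\<Phi> (j x) is Lipschitz with compact support in {j < 1}; its mollifications at scales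
  tending to 0 are admissible, and the inequality passes to the limit by dominated convergence. If
  \<Phi> (j x) has no mass, the left side is 0 because 0 powr (p / q) = 0.\<close>

lemma lambda_pq_profile:
  fixes \<Phi> \<Phi>' :: "real \<Rightarrow> real"
  assumes sub: "{x. j x < 1} \<subseteq> \<Omega>" and p: "p > 0" and q: "q > 0"
    and \<Phi>: "\<And>t. (\<Phi> has_real_derivative \<Phi>' t) (at t)" and \<Phi>': "continuous_on UNIV \<Phi>'"
    and t0: "t0 < 1" and zero: "\<And>t. t \<ge> t0 \<Longrightarrow> \<Phi> t = 0" "\<And>t. t \<ge> t0 \<Longrightarrow> \<Phi>' t = 0"
  shows "lambda_pq p q \<Omega> * (integral\<^sup>L lborel (\<lambda>x. \<bar>\<Phi> (j x)\<bar> powr q)) powr (p / q)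
    \<le> integral\<^sup>L lborel (\<lambda>x. (\<bar>\<Phi>' (j x)\<bar> * loc_lip x) powr p)"
proof (cases "0 < integral\<^sup>L lborel (\<lambda>x. \<bar>\<Phi> (j x)\<bar> powr q)")
  case False
  moreover have "0 \<le> integral\<^sup>L lborel (\<lambda>x. \<bar>\<Phi> (j x)\<bar> powr q)" by simp
  ultimately have "integral\<^sup>L lborel (\<lambda>x. \<bar>\<Phi> (j x)\<bar> powr q) = 0" by linarith
  then show ?thesis by simp
next
  case pos: True
  define u where "u x = \<Phi> (j x)" for x
  define G where "G x = \<bar>\<Phi>' (j x)\<bar> * loc_lip x" for x
  define K where "K = {x. j x < 1}"
  define S where "S = {x. j x \<le> t0}"
  have \<Phi>c: "continuous_on UNIV \<Phi>"
    by (rule continuous_at_imp_continuous_on) (use \<Phi> DERIV_isCont in blast)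
  have uc: "continuous_on UNIV u" unfolding u_def
    using cont \<Phi>c continuous_on_compose2 by blast
  have [measurable]: "\<Phi> \<in> borel_measurable borel" "\<Phi>' \<in> borel_measurable borel"
    using \<Phi>c \<Phi>' by (auto intro: borel_measurable_continuous_onI)
  have [measurable]: "u \<in> borel_measurable borel" "G \<in> borel_measurable borel"
    unfolding u_def G_def by measurable
  have [measurable]: "K \<in> sets borel" unfolding K_def by measurable
  have S: "compact S" "\<And>x. x \<notin> S \<Longrightarrow> u x = 0"
    unfolding S_def u_def using compact_sublevel zero by auto
  have "compact (\<Phi>' ` {0..1})" "compact (\<Phi> ` {0..1})"
    using \<Phi>' \<Phi>c continuous_on_subset by (auto intro!: compact_continuous_image)
  then have "bounded (\<Phi>' ` {0..1})" "bounded (\<Phi> ` {0..1})"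
    by (auto intro: compact_imp_bounded)
  then obtain B1 B2 where "\<forall>x \<in> \<Phi>' ` {0..1}. norm x \<le> B1" "\<forall>x \<in> \<Phi> ` {0..1}. norm x \<le> B2"
    unfolding bounded_iff by blast
  then have B1: "\<And>t. t \<in> {0..1} \<Longrightarrow> \<bar>\<Phi>' t\<bar> \<le> B1" and B2: "\<And>t. t \<in> {0..1} \<Longrightarrow> \<bar>\<Phi> t\<bar> \<le> B2"
    by auto
  have B10: "B1 \<ge> 0" and B20: "B2 \<ge> 0" using B1[of 0] B2[of 0] by auto
  have B1': "\<bar>\<Phi>' (j x)\<bar> \<le> B1" for x
    using B1[of "j x"] zero(2)[of "j x"] nonneg[of x] t0 B10 by (cases "j x \<le> 1") auto
  have B2': "\<bar>u x\<bar> \<le> B2" for x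
    using B2[of "j x"] zero(1)[of "j x"] nonneg[of x] t0 B20 unfolding u_def by (cases "j x \<le> 1") auto
  \<comment> \<open>A common bound for G and for all mollified gradients; W powr p on K dominates
    the energies.\<close>
  define W where "W = (B1 + 1) * max (1 / r) (1 / h)"
  have W0: "W \<ge> 0" using B10 r h by (simp add: W_def le_max_iff_disj)
  have ll: "loc_lip x \<le> max (1 / r) (1 / h)" for x by (auto simp: loc_lip_def)
  have GW: "G x \<le> W" for x unfolding G_def W_def using B1'[of x] ll[of x] loc_lip_pos[of x] B10
    by (intro mult_mono) auto
  have G0: "G x \<ge> 0" for x unfolding G_def using loc_lip_pos[of x] by simp
  \<comment> \<open>On S one has j \<le> t0, and moving by \<epsilon> n raises j by at most
    \<epsilon> n / r < 1 - t0, so the supports stay inside K. The summand 2 makes the inequality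
    strict for n = 0 too.\<close>
  define \<epsilon> where "\<epsilon> n = r * (1 - t0) / (real n + 2)" for n :: nat
  have \<epsilon>0: "\<epsilon> n > 0" for n using r t0 by (simp add: \<epsilon>_def)
  have \<epsilon>lim: "\<epsilon> \<longlonglongrightarrow> 0" unfolding \<epsilon>_def by real_asymp
  have \<epsilon>sub: "cball x (\<epsilon> n) \<subseteq> K" if "x \<in> S" for x n
  proof
    fix y assume y: "y \<in> cball x (\<epsilon> n)"
    have "\<epsilon> n / r = (1 - t0) / (real n + 2)" using r by (simp add: \<epsilon>_def)
    also have "\<dots> < 1 - t0" using t0 by (simp add: divide_less_eq)
    finally have "\<epsilon> n / r < 1 - t0" .
    moreover have "\<bar>j y - j x\<bar> \<le> \<epsilon> n / r"
      using lip[of y x] y divide_right_mono[of "norm (y - x)" "\<epsilon> n" r] r by (simp add: dist_norm norm_minus_commute)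
    ultimately show "y \<in> K" using that by (simp add: K_def S_def)
  qed
  have "\<exists>\<psi>. \<psi> \<in> C0_infty K
      \<and> (\<forall>x c d. (\<forall>y \<in> cball x (\<epsilon> n). \<bar>u y - c\<bar> \<le> d) \<longrightarrow> \<bar>\<psi> x - c\<bar> \<le> d)
      \<and> (\<forall>x L k. \<epsilon> n < k \<longrightarrow> (\<forall>a \<in> ball x k. \<forall>b \<in> ball x k. \<bar>u a - u b\<bar> \<le> L * norm (a - b))
        \<longrightarrow> norm (grad \<psi> x) \<le> L)" for n
    by (rule mollify[OF uc S \<epsilon>0[of n] \<epsilon>sub]) (assumption | blast)+
  then obtain \<psi> where \<psi>: "\<And>n. \<psi> n \<in> C0_infty K"
      "\<And>n x c d. (\<And>y. y \<in> cball x (\<epsilon> n) \<Longrightarrow> \<bar>u y - c\<bar> \<le> d) \<Longrightarrow> \<bar>\<psi> n x - c\<bar> \<le> d"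
      "\<And>n x L k. \<epsilon> n < k \<Longrightarrow> (\<And>a b. a \<in> ball x k \<Longrightarrow> b \<in> ball x k \<Longrightarrow> \<bar>u a - u b\<bar> \<le> L * norm (a - b))
        \<Longrightarrow> norm (grad (\<psi> n) x) \<le> L"
    by metis
  have \<psi>\<Omega>: "\<psi> n \<in> C0_infty \<Omega>" for n using \<psi>(1)[of n] sub unfolding C0_infty_def K_def by auto
  have \<psi>K: "\<psi> n x = 0" "grad (\<psi> n) x = 0" if "x \<notin> K" for n x
    using C0_inftyD(4,5)[OF \<psi>(1)] that by auto
  have [measurable]: "\<psi> n \<in> borel_measurable borel" "grad (\<psi> n) \<in> borel_measurable borel" for n
    by (intro borel_measurable_continuous_onI smooth_continuous smooth_continuous_grad C0_inftyD(1)[OF \<psi>(1)])+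
  have bound_int: "integrable lborel (\<lambda>x. b * indicator K x)" for b :: real
  proof -
    have "emeasure lborel K < \<infinity>" using emeasure_sublevel_finite[of UNIV] by (simp add: K_def)
    then show ?thesis by (intro integrable_mult_right integrable_real_indicator) auto
  qed
  have uK: "u x = 0" "G x = 0" if "x \<notin> K" for x
    using that zero t0 by (auto simp: u_def G_def K_def)
  have lim1: "(\<lambda>n. \<psi> n x) \<longlonglongrightarrow> u x" for x
  proof (rule LIMSEQ_I)
    fix d :: real assume d: "d > 0"
    obtain k where k: "k > 0" "\<And>y. dist y x < k \<Longrightarrow> dist (u y) (u x) < d / 2"
      using uc d unfolding continuous_on_iff by (metis UNIV_I half_gt_zero)
    obtain n0 where n0: "\<And>n. n \<ge> n0 \<Longrightarrow> \<epsilon> n < k"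
      using order_tendstoD(2)[OF \<epsilon>lim k(1)] unfolding eventually_sequentially by blast
    have "\<bar>\<psi> n x - u x\<bar> \<le> d / 2" if "n \<ge> n0" for n
      using n0[OF that] k(2) by (intro \<psi>(2)) (force simp: dist_commute dist_real_def intro: less_imp_le)
    then show "\<exists>no. \<forall>n\<ge>no. norm (\<psi> n x - u x) < d" using d by (intro exI[of _ n0]) fastforce
  qed
  \<comment> \<open>The mollified gradients are bounded above by G in the limit but need not
    converge; their maximum with G does, and it can only increase the energy.\<close>
  have lim2: "(\<lambda>n. max (norm (grad (\<psi> n) x)) (G x)) \<longlonglongrightarrow> G x" for x
  proof (rule LIMSEQ_I)
    fix d :: real assume d: "d > 0"
    define d' where "d' = d / (2 * loc_lip x)"
    have d': "d' > 0" using d loc_lip_pos[of x] by (simp add: d'_def)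
    obtain \<delta> where \<delta>: "\<delta> > 0" "\<And>t. dist t (j x) < \<delta> \<Longrightarrow> dist (\<Phi>' t) (\<Phi>' (j x)) < d'"
      using \<Phi>' d' unfolding continuous_on_iff by (metis UNIV_I)
    have "\<bar>\<Phi>' t\<bar> \<le> \<bar>\<Phi>' (j x)\<bar> + d'" if "\<bar>t - j x\<bar> < \<delta>" for t
      using \<delta>(2)[of t] that by (simp add: dist_real_def)
    then obtain k where k: "k > 0" "\<And>a b. a \<in> ball x k \<Longrightarrow> b \<in> ball x k \<Longrightarrow>
        \<bar>\<Phi> (j a) - \<Phi> (j b)\<bar> \<le> ((\<bar>\<Phi>' (j x)\<bar> + d') * loc_lip x) * norm (a - b)"
      using profile_local_lipschitz[OF \<Phi> _ \<delta>(1), of x "\<bar>\<Phi>' (j x)\<bar> + d'"] by blast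
    obtain n0 where n0: "\<And>n. n \<ge> n0 \<Longrightarrow> \<epsilon> n < k"
      using order_tendstoD(2)[OF \<epsilon>lim k(1)] unfolding eventually_sequentially by blast
    have eq: "(\<bar>\<Phi>' (j x)\<bar> + d') * loc_lip x = G x + d / 2"
      using loc_lip_pos[of x] by (simp add: G_def d'_def field_simps)
    have "norm (grad (\<psi> n) x) \<le> G x + d / 2" if "n \<ge> n0" for n
      using n0[OF that] k(2) unfolding eq u_def[symmetric] by (intro \<psi>(3)[of n k]) auto
    then show "\<exists>no. \<forall>n\<ge>no. norm (max (norm (grad (\<psi> n) x)) (G x) - G x) < d"
      using d by (intro exI[of _ n0]) (fastforce simp: max_def)
  qed
  have gradW: "norm (grad (\<psi> n) x) \<le> W" for n x
  proof (rule \<psi>(3)[of n "\<epsilon> n + 1"])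
    fix a b
    have "\<bar>u a - u b\<bar> \<le> B1 * norm (j a - j b)"
      unfolding u_def real_norm_def[symmetric]
    proof (rule field_differentiable_bound[of "{0..}" \<Phi> \<Phi>'])
      show "(\<Phi> has_field_derivative \<Phi>' z) (at z within {0..})" for z
        using \<Phi> has_field_derivative_at_within by blast
      show "norm (\<Phi>' z) \<le> B1" if "z \<in> {0..}" for z
        using that B1[of z] zero(2)[of z] t0 B10 by (cases "z \<le> 1") auto
    qed (use nonneg in auto)
    also have "\<dots> \<le> B1 * (norm (a - b) / r)" using lip B10 by (intro mult_left_mono) auto
    also have "\<dots> = (B1 * (1 / r)) * norm (a - b)" by simp
    also have "\<dots> \<le> W * norm (a - b)"
      unfolding W_def using B10 r by (intro mult_right_mono mult_mono) auto
    finally show "\<bar>u a - u b\<bar> \<le> W * norm (a - b)" .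
  qed simp
  have \<psi>B: "\<bar>\<psi> n x\<bar> \<le> B2" for n x
    using \<psi>(2)[of x n 0 B2] B2' by simp
  have L1: "(\<lambda>n. integral\<^sup>L lborel (\<lambda>x. \<bar>\<psi> n x\<bar> powr q)) \<longlonglongrightarrow> integral\<^sup>L lborel (\<lambda>x. \<bar>u x\<bar> powr q)"
  proof (rule integral_dominated_convergence[where w="\<lambda>x. B2 powr q * indicator K x"])
    show "AE x in lborel. (\<lambda>n. \<bar>\<psi> n x\<bar> powr q) \<longlonglongrightarrow> \<bar>u x\<bar> powr q"
      using lim1 q by (intro AE_I2 tendsto_powr2 tendsto_rabs tendsto_const) auto
    show "AE x in lborel. norm (\<bar>\<psi> n x\<bar> powr q) \<le> B2 powr q * indicator K x" for n
      using \<psi>K(1) \<psi>B q by (intro AE_I2) (auto simp: indicator_def intro!: powr_mono2)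
  qed (use bound_int in auto)
  have L2: "(\<lambda>n. integral\<^sup>L lborel (\<lambda>x. max (norm (grad (\<psi> n) x)) (G x) powr p)) \<longlonglongrightarrow> integral\<^sup>L lborel (\<lambda>x. G x powr p)"
  proof (rule integral_dominated_convergence[where w="\<lambda>x. W powr p * indicator K x"])
    show "AE x in lborel. (\<lambda>n. max (norm (grad (\<psi> n) x)) (G x) powr p) \<longlonglongrightarrow> G x powr p"
      using lim2 p G0 by (intro AE_I2 tendsto_powr2 tendsto_const) (auto simp: max_def)
    show "AE x in lborel. norm (max (norm (grad (\<psi> n) x)) (G x) powr p) \<le> W powr p * indicator K x" for n
      using \<psi>K(2) uK(2) gradW GW G0 p by (intro AE_I2) (auto simp: indicator_def max_def intro!: powr_mono2)
  qed (use bound_int in auto)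
  have ev: "eventually (\<lambda>n. 0 < integral\<^sup>L lborel (\<lambda>x. \<bar>\<psi> n x\<bar> powr q)) sequentially"
    using order_tendstoD(1)[OF L1] pos unfolding u_def by blast
  have le: "eventually (\<lambda>n. lambda_pq p q \<Omega> * (integral\<^sup>L lborel (\<lambda>x. \<bar>\<psi> n x\<bar> powr q)) powr (p / q)
     \<le> integral\<^sup>L lborel (\<lambda>x. max (norm (grad (\<psi> n) x)) (G x) powr p)) sequentially"
    using ev
  proof eventually_elim
    case (elim n)
    have "lambda_pq p q \<Omega> * (integral\<^sup>L lborel (\<lambda>x. \<bar>\<psi> n x\<bar> powr q)) powr (p / q)
       \<le> integral\<^sup>L lborel (\<lambda>x. norm (grad (\<psi> n) x) powr p)"
      using lambda_pq_le[OF \<psi>\<Omega> p q elim] .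
    also have "\<dots> \<le> integral\<^sup>L lborel (\<lambda>x. max (norm (grad (\<psi> n) x)) (G x) powr p)"
    proof (rule integral_mono)
      show "integrable lborel (\<lambda>x. norm (grad (\<psi> n) x) powr p)"
        using C0_infty_integrals(3)[OF \<psi>\<Omega> p] .
      show "integrable lborel (\<lambda>x. max (norm (grad (\<psi> n) x)) (G x) powr p)"
        by (rule Bochner_Integration.integrable_bound[OF bound_int[of "W powr p"]])
           (use \<psi>K(2) uK(2) gradW GW G0 p in \<open>auto simp: indicator_def max_def intro!: AE_I2 powr_mono2\<close>)
      show "norm (grad (\<psi> n) x) powr p \<le> max (norm (grad (\<psi> n) x)) (G x) powr p" for x
        using p by (intro powr_mono2) auto
    qed
    finally show ?case .
  qed
  have "lambda_pq p q \<Omega> * (integral\<^sup>L lborel (\<lambda>x. \<bar>u x\<bar> powr q)) powr (p / q) \<le> integral\<^sup>L lborel (\<lambda>x. G x powr p)"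
  proof (rule tendsto_le[OF _ L2 _ le])
    show "(\<lambda>n. lambda_pq p q \<Omega> * (integral\<^sup>L lborel (\<lambda>x. \<bar>\<psi> n x\<bar> powr q)) powr (p / q))
      \<longlonglongrightarrow> lambda_pq p q \<Omega> * (integral\<^sup>L lborel (\<lambda>x. \<bar>u x\<bar> powr q)) powr (p / q)"
      using pos by (intro tendsto_mult tendsto_powr L1 tendsto_const) (auto simp: u_def)
  qed simp
  then show ?thesis unfolding u_def G_def .
qed

end

section \<open>Averaging over rays\<close>

text \<open>The tangent inequality of a convex power. Convexity is taken on the open half-line, so a
  = 0 is checked directly; that case matters because a ray integral may vanish.\<close>

lemma powr_above_tangent:
  fixes a c p :: real
  assumes "p \<ge> 1" "a \<ge> 0" "c > 0"
  shows "a powr p \<ge> c powr p + p * c powr (p - 1) * (a - c)"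
proof (cases "a = 0")
  case True
  have "c powr p = c powr (p - 1) * c" using assms powr_mult_base[of c "p - 1"] by (simp add: mult.commute)
  moreover have "c powr (p - 1) * c \<le> p * (c powr (p - 1) * c)"
    using assms mult_right_mono[of 1 p "c powr (p - 1) * c"] by simp
  ultimately show ?thesis using True by (simp add: algebra_simps)
next
  case False
  have "a powr p - c powr p \<ge> (p * c powr (p - 1)) * (a - c)"
  proof (rule convex_on_imp_above_tangent[OF powr_convex[OF assms(1)]])
    show "((\<lambda>x. x powr p) has_real_derivative p * c powr (p - 1)) (at c within {0<..})"
      by (rule has_field_derivative_at_within, rule has_real_derivative_powr, rule assms)
    show "c \<in> interior {0<..}" using assms by (simp add: interior_open)
    show "a \<in> {0<..}" using assms False by simp
    show "connected {0::real<..}" by simp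
  qed
  then show ?thesis by linarith
qed

text \<open>If a powr q exceeds \<delta>, write it as (a powr q) powr (1 - p / q) * a powr p; the
  exponent 1 - p / q is negative, so the first factor is at most \<delta> powr (1 - p / q). On a set
  of finite measure this controls the q-mass by the p-mass.\<close>

lemma powr_le_split:
  fixes a q p \<delta> :: real
  assumes "a \<ge> 0" "0 < q" "q < p" "\<delta> > 0"
  shows "a powr q \<le> \<delta> + \<delta> powr (1 - p / q) * a powr p"
proof (cases "a powr q \<le> \<delta>")
  case False
  then have a: "a > 0" using assms by (cases "a = 0") auto
  have "(a powr q) powr (1 - p / q) \<le> \<delta> powr (1 - p / q)"
    using False assms by (intro powr_mono2') auto
  moreover have "(a powr q) powr (1 - p / q) = a powr (q - p)"
    using assms by (simp add: powr_powr algebra_simps)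
  ultimately have "a powr (q - p) * a powr p \<le> \<delta> powr (1 - p / q) * a powr p"
    by (intro mult_right_mono) auto
  moreover have "a powr (q - p) * a powr p = a powr q" using a by (simp add: powr_add[symmetric])
  ultimately show ?thesis using assms by linarith
qed (use assms in \<open>simp add: add_increasing2\<close>)

lemma bump_alg_smooth: "f \<in> bump_alg e \<Longrightarrow> smooth f"
proof (rule smooth_coinduct[of f "bump_alg e"], assumption)
  fix g :: "'a \<Rightarrow> real" and x b assume "g \<in> bump_alg e"
  from bump_alg_derivative[OF this] obtain g' where
    g': "\<And>x. (g has_derivative g' x) (at x)" "\<And>b. (\<lambda>x. g' x b) \<in> bump_alg e" by blast
  show "g differentiable at x" using g'(1) unfolding differentiable_def by blast
  have "(\<lambda>x. frechet_derivative g (at x) b) = (\<lambda>x. g' x b)"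
    using frechet_derivative_at[OF g'(1)] by metis
  then show "(\<lambda>x. frechet_derivative g (at x) b) \<in> bump_alg e" using g'(2) by simp
qed

section \<open>Lower bounds for the infimum\<close>

text \<open>A lower bound on an \<open>Inf\<close> of reals presupposes a nonempty set, so one
  normalized test function must be exhibited: a mollifier moved to \<open>a\<close> and
  rescaled.\<close>

lemma ex_admissible:
  assumes e: "e > 0" and sub: "ball a e \<subseteq> \<Omega>" and q: "q > 0"
  obtains \<psi> where "\<psi> \<in> C0_infty \<Omega>" "integral \<Omega> (\<lambda>x. \<bar>\<psi> x\<bar> powr q) = 1"
proof -
  obtain f :: "'a \<Rightarrow> real" where f: "f \<in> bump_alg (e / 2)" "\<And>x. f x \<ge> 0" "\<And>x. norm x \<ge> e / 2 \<Longrightarrow> f x = 0"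
    "integrable lborel f" "integral\<^sup>L lborel f = 1"
    using ex_mollifier[of "e / 2"] e by auto
  have "f \<in> C0_infty (ball 0 e)"
  proof (rule C0_inftyI[OF bump_alg_smooth[OF f(1)], of "cball 0 (e / 2)"])
    show "{x. f x \<noteq> 0} \<subseteq> cball 0 (e / 2)" using f(3) by (auto intro: ccontr simp: not_le)
  qed (use e in auto)
  then have g: "(\<lambda>x. k * f (- a + 1 *\<^sub>R x)) \<in> C0_infty \<Omega>" for k
    using sub by (rule_tac C0_infty_affine[of _ "ball 0 e"]) (auto simp: dist_norm norm_minus_commute subset_iff)
  define g where "g x = f (- a + 1 *\<^sub>R x)" for x
  have g1: "(\<lambda>x. k * g x) \<in> C0_infty \<Omega>" for k using g unfolding g_def .
  have g2: "g \<in> C0_infty \<Omega>" using g1[of 1] by simp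
  have fb: "f \<in> borel_measurable borel" using f(4) by auto
  have "integral\<^sup>L lborel g = 1" using lborel_integral_affine[OF fb, of 1 "- a"] f(5) by (simp add: g_def[abs_def])
  define M where "M = integral\<^sup>L lborel (\<lambda>x. \<bar>g x\<bar> powr q)"
  have "M \<noteq> 0"
  proof
    assume "M = 0"
    then have "AE x in lborel. \<bar>g x\<bar> powr q = 0"
      using integral_nonneg_eq_0_iff_AE[OF C0_infty_integrals(1)[OF g2 q]] by (simp add: M_def)
    then have "AE x in lborel. g x = 0" by simp
    then have "integral\<^sup>L lborel g = 0" using integral_eq_zero_AE by blast
    then show False using \<open>integral\<^sup>L lborel g = 1\<close> by simp
  qed
  moreover have "M \<ge> 0" by (simp add: M_def)
  ultimately have M: "M > 0" by simp
  define k where "k = M powr (- 1 / q)"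
  have k: "k > 0" using M by (simp add: k_def)
  have kq: "k powr q = 1 / M" using M q by (simp add: k_def powr_powr powr_minus_divide del: powr_minus_divide)
  have "integral \<Omega> (\<lambda>x. \<bar>k * g x\<bar> powr q) = integral\<^sup>L lborel (\<lambda>x. k powr q * \<bar>g x\<bar> powr q)"
    unfolding C0_infty_integrals(2)[OF g1 q] using k by (simp add: abs_mult powr_mult)
  also have "\<dots> = 1" using M kq by (simp add: M_def)
  finally show ?thesis using that g1 by blast
qed

lemma lambda_pq_greatest:
  assumes e: "e > 0" and sub: "ball a e \<subseteq> \<Omega>" and q: "q > 0"
    and B: "\<And>\<psi>. \<psi> \<in> C0_infty \<Omega> \<Longrightarrow> integral\<^sup>L lborel (\<lambda>x. \<bar>\<psi> x\<bar> powr q) = 1 \<Longrightarrow>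
      B \<le> integral\<^sup>L lborel (\<lambda>x. norm (grad \<psi> x) powr p)" and p: "p > 0"
  shows "B \<le> lambda_pq p q \<Omega>"
  unfolding lambda_pq_def
proof (rule cInf_greatest)
  show "{integral \<Omega> (\<lambda>x. norm (grad \<psi> x) powr p) |\<psi>. \<psi> \<in> C0_infty \<Omega> \<and> integral \<Omega> (\<lambda>x. \<bar>\<psi> x\<bar> powr q) = 1} \<noteq> {}"
  proof -
    obtain \<psi> where "\<psi> \<in> C0_infty \<Omega>" "integral \<Omega> (\<lambda>x. \<bar>\<psi> x\<bar> powr q) = 1"
      by (rule ex_admissible[OF e sub q])
    then show ?thesis by auto
  qed
next
  fix E assume "E \<in> {integral \<Omega> (\<lambda>x. norm (grad \<psi> x) powr p) |\<psi>. \<psi> \<in> C0_infty \<Omega> \<and> integral \<Omega> (\<lambda>x. \<bar>\<psi> x\<bar> powr q) = 1}"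
  then obtain \<psi> where \<psi>: "E = integral \<Omega> (\<lambda>x. norm (grad \<psi> x) powr p)" "\<psi> \<in> C0_infty \<Omega>"
    "integral \<Omega> (\<lambda>x. \<bar>\<psi> x\<bar> powr q) = 1" by blast
  then show "B \<le> E" using B[of \<psi>] C0_infty_integrals(2)[OF \<psi>(2) q] C0_infty_integrals(4)[OF \<psi>(2) p] by simp
qed

lemma lambda_pq_nonneg:
  assumes "e > 0" "ball a e \<subseteq> \<Omega>" "q > 0" "p > 0"
  shows "lambda_pq p q \<Omega> \<ge> 0"
  by (rule lambda_pq_greatest[OF assms(1,2,3) _ assms(4)]) simp

text \<open>Up to a constant the integral along the ray through \<open>y\<close>; for \<open>y = 0\<close> it is a junk value on a null set.\<close>

definition ray_integral :: "('a::euclidean_space \<Rightarrow> real) \<Rightarrow> 'a \<Rightarrow> real" where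
  "ray_integral f y = integral\<^sup>L lborel
     (\<lambda>t. f ((t / norm y) *\<^sub>R y) * (real DIM('a) * t ^ (DIM('a) - 1)) * indicator {0<..} t)"

context
  fixes f :: "'a::euclidean_space \<Rightarrow> real"
  assumes f: "continuous_on UNIV f" "\<And>x. f x \<ge> 0" "\<And>x. norm x \<ge> 1 \<Longrightarrow> f x = 0"
begin

lemma ray_borel: "f \<in> borel_measurable borel"
  using f(1) by (rule borel_measurable_continuous_onI)

lemma nn_ray_integral:
  assumes "y \<noteq> 0"
  shows "(\<integral>\<^sup>+ t. ennreal (f ((t / norm y) *\<^sub>R y)) * ennreal (real DIM('a) * t ^ (DIM('a) - 1)) * indicator {0<..} t \<partial>lborel)
    = ennreal (ray_integral f y)"
proof -
  have "integrable lborel (\<lambda>t. f ((t / norm y) *\<^sub>R y) * (real DIM('a) * t ^ (DIM('a) - 1)))"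
  proof (rule integrable_compact_support[of _ "cball 0 1"])
    show "continuous_on UNIV (\<lambda>t. f ((t / norm y) *\<^sub>R y) * (real DIM('a) * t ^ (DIM('a) - 1)))"
      by (intro continuous_intros continuous_on_compose2[OF f(1)]) (use assms in auto)
    show "f ((t / norm y) *\<^sub>R y) * (real DIM('a) * t ^ (DIM('a) - 1)) = 0" if "t \<notin> cball 0 1" for t
      using that assms f(3)[of "(t / norm y) *\<^sub>R y"] by simp
  qed simp
  then have int: "integrable lborel (\<lambda>t. f ((t / norm y) *\<^sub>R y) * (real DIM('a) * t ^ (DIM('a) - 1)) * indicator {0<..} t)"
    by (intro integrable_real_mult_indicator) auto
  have "ennreal (ray_integral f y) =
     (\<integral>\<^sup>+ t. ennreal (f ((t / norm y) *\<^sub>R y) * (real DIM('a) * t ^ (DIM('a) - 1)) * indicator {0<..} t) \<partial>lborel)"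
    unfolding ray_integral_def
    by (rule nn_integral_eq_integral[OF int, symmetric]) (auto simp: f(2) indicator_def)
  also have "\<dots> = (\<integral>\<^sup>+ t. ennreal (f ((t / norm y) *\<^sub>R y)) * ennreal (real DIM('a) * t ^ (DIM('a) - 1)) * indicator {0<..} t \<partial>lborel)"
    by (intro nn_integral_cong) (auto simp: indicator_def f(2) ennreal_mult')
  finally show ?thesis by simp
qed

lemma ray_integral_nonneg: "ray_integral f y \<ge> 0"
  unfolding ray_integral_def by (intro integral_nonneg_AE AE_I2) (auto simp: f(2) indicator_def)

lemma borel_ray_integral: "ray_integral f \<in> borel_measurable borel"
proof -
  note [measurable] = ray_borel
  show ?thesis unfolding ray_integral_def by measurable
qed

text \<open>Polar coordinates for the norm. The points y of the unit ball sample the directions, so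
  the mean of the ray integrals over the ball is the integral of f divided by |B_1|.\<close>

lemma nn_integral_ray_integral:
  "(\<integral>\<^sup>+ y. ennreal (ray_integral f y) * indicator (ball 0 1) y \<partial>lborel) = (\<integral>\<^sup>+ x. ennreal (f x) \<partial>lborel)"
proof -
  interpret gauge "norm :: 'a \<Rightarrow> real" by (rule gauge_norm)
  note [measurable] = ray_borel
  have nz: "AE x in lborel. x \<noteq> (0::'a)" by (rule AE_lborel_singleton)
  have b: "ball 0 1 = {x::'a. norm x < 1}" by auto
  have "(\<integral>\<^sup>+ x. ennreal (f x) \<partial>lborel) = (\<integral>\<^sup>+ y. (\<integral>\<^sup>+ t. ennreal (f ((t / norm y) *\<^sub>R y)) * ennreal (real DIM('a) * t ^ (DIM('a) - 1)) * indicator {0<..} t \<partial>lborel)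
        * indicator {x. norm x < 1} y \<partial>lborel)"
    by (rule nn_integral_polar) measurable
  also have "\<dots> = (\<integral>\<^sup>+ y. ennreal (ray_integral f y) * indicator (ball 0 1) y \<partial>lborel)"
    unfolding b by (rule nn_integral_cong_AE, use nz in eventually_elim) (simp only: nn_ray_integral not_False_eq_True)
  finally show ?thesis by simp
qed

text \<open>The radial formula for j and \<open>ray_integral\<close> carry the same weight N * t^(N
  - 1). Hence transplanting the profile of f along the ray through y to the level sets of j only
  brings in a volume factor.\<close>

lemma integral_gauge_ray:
  fixes j :: "'a \<Rightarrow> real"
  assumes "gauge j" and y: "y \<noteq> 0" and A: "A \<in> sets borel"
    and cone: "\<And>x t. t > 0 \<Longrightarrow> t *\<^sub>R x \<in> A \<longleftrightarrow> x \<in> A"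
  shows "integrable lborel (\<lambda>x. f ((j x / norm y) *\<^sub>R y) * indicator A x)"
    and "integral\<^sup>L lborel (\<lambda>x. f ((j x / norm y) *\<^sub>R y) * indicator A x)
      = measure lborel ({x. j x < 1} \<inter> A) * ray_integral f y"
proof -
  interpret gauge j by (rule assms)
  note [measurable] = ray_borel
  have [measurable]: "A \<in> sets borel" by (rule A)
  have fin: "emeasure lborel ({x. j x < 1} \<inter> A) = ennreal (measure lborel ({x. j x < 1} \<inter> A))"
    using emeasure_sublevel_finite[of A] by (simp add: emeasure_eq_ennreal_measure less_top)
  have "(\<integral>\<^sup>+ x. ennreal (f ((j x / norm y) *\<^sub>R y) * indicator A x) \<partial>lborel)
     = (\<integral>\<^sup>+ x. (\<lambda>t. ennreal (f ((t / norm y) *\<^sub>R y))) (j x) * indicator A x \<partial>lborel)"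
    by (intro nn_integral_cong) (auto simp: indicator_def)
  also have "\<dots> = emeasure lborel ({x. j x < 1} \<inter> A) * (\<integral>\<^sup>+ t. ennreal (f ((t / norm y) *\<^sub>R y)) * ennreal (real DIM('a) * t ^ (DIM('a) - 1)) * indicator {0<..} t \<partial>lborel)"
    by (rule nn_integral_radial) (use A cone in auto)
  also have "\<dots> = ennreal (measure lborel ({x. j x < 1} \<inter> A) * ray_integral f y)"
    unfolding nn_ray_integral[OF y] fin by (simp add: ennreal_mult')
  finally have nn: "(\<integral>\<^sup>+ x. ennreal (f ((j x / norm y) *\<^sub>R y) * indicator A x) \<partial>lborel) =
    ennreal (measure lborel ({x. j x < 1} \<inter> A) * ray_integral f y)" .
  show "integrable lborel (\<lambda>x. f ((j x / norm y) *\<^sub>R y) * indicator A x)"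
    by (rule integrableI_nonneg) (use nn f(2) in auto)
  show "integral\<^sup>L lborel (\<lambda>x. f ((j x / norm y) *\<^sub>R y) * indicator A x)
      = measure lborel ({x. j x < 1} \<inter> A) * ray_integral f y"
    by (subst integral_eq_nn_integral) (use nn f(2) ray_integral_nonneg in auto)
qed

end

lemma compact_in_unit_ball_radius:
  fixes S :: "'a::euclidean_space set"
  assumes "compact S" "S \<subseteq> ball 0 1"
  obtains t0 where "0 < t0" "t0 < 1" "\<And>x. t0 \<le> norm x \<Longrightarrow> x \<notin> S"
proof (cases "S = {}")
  case True
  then show ?thesis using that[of "1/2"] by simp
next
  case False
  obtain z where z: "z \<in> S" "\<And>y. y \<in> S \<Longrightarrow> norm y \<le> norm z"
    using continuous_attains_sup[OF assms(1) False, of norm] by (auto intro: continuous_intros)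
  have "norm z < 1" using z assms by auto
  show ?thesis
  proof
    show "0 < (norm z + 1) / 2" by (intro half_gt_zero add_nonneg_pos) auto
    show "(norm z + 1) / 2 < 1" using \<open>norm z < 1\<close> by simp
    show "x \<notin> S" if "(norm z + 1) / 2 \<le> norm x" for x
      using z(2)[of x] that \<open>norm z < 1\<close> by force
  qed
qed

text \<open>The test function is V (j x e), with e the direction of y. The derivative of its profile
  is the component of grad V along e, at most |grad V| in size, so the energy is controlled by the
  ray integral of |grad V|^p; C and its complement contribute with their own slopes.\<close>

lemma (in lipschitz_gauge) profile_inequality:
  fixes V :: "'a \<Rightarrow> real"
  assumes sub: "{x. j x < 1} \<subseteq> \<Omega>" and p: "p > 0" and q: "q > 0"
    and V: "V \<in> C0_infty (ball 0 1)" and y: "y \<noteq> 0"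
  defines "f \<equiv> \<lambda>x. \<bar>V x\<bar> powr q" and "F \<equiv> \<lambda>x. norm (grad V x) powr p"
  shows "lambda_pq p q \<Omega> * (measure lborel {x. j x < 1} * ray_integral f y) powr (p / q)
    \<le> (measure lborel ({x. j x < 1} \<inter> C) / h powr p + measure lborel ({x. j x < 1} - C) / r powr p) * ray_integral F y"
proof -
  note V' = C0_inftyD[OF V]
  have "continuous_on UNIV f" unfolding f_def
    by (intro continuous_on_powr' continuous_intros smooth_continuous[OF V'(1)]) (use q in auto)
  then have f: "continuous_on UNIV f" "\<And>x. f x \<ge> 0" "\<And>x. norm x \<ge> 1 \<Longrightarrow> f x = 0"
    using V' q by (auto simp: f_def)
  have "continuous_on UNIV F" unfolding F_def
    by (intro continuous_on_powr' continuous_intros smooth_continuous_grad[OF V'(1)]) (use p in auto)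
  then have F: "continuous_on UNIV F" "\<And>x. F x \<ge> 0" "\<And>x. norm x \<ge> 1 \<Longrightarrow> F x = 0"
    using V' p by (auto simp: F_def)
  define e where "e = (1 / norm y) *\<^sub>R y"
  have e: "norm e = 1" using y by (simp add: e_def)
  have te: "(t / norm y) *\<^sub>R y = t *\<^sub>R e" for t by (simp add: e_def)
  define \<Phi> where "\<Phi> t = V (t *\<^sub>R e)" for t
  define \<Phi>' where "\<Phi>' t = grad V (t *\<^sub>R e) \<bullet> e" for t
  obtain t0 where t0: "0 < t0" "t0 < 1" "\<And>x. t0 \<le> norm x \<Longrightarrow> x \<notin> tsupport V"
    using compact_in_unit_ball_radius[OF V'(2,3)] by blast
  have der: "(\<Phi> has_real_derivative \<Phi>' t) (at t)" for t
  proof -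
    have "((\<lambda>t. V (t *\<^sub>R e)) has_derivative (\<lambda>s. grad V (t *\<^sub>R e) \<bullet> (s *\<^sub>R e))) (at t)"
    proof (rule has_derivative_compose[where f="\<lambda>t. t *\<^sub>R e"])
      show "((\<lambda>t. t *\<^sub>R e) has_derivative (\<lambda>s. s *\<^sub>R e)) (at t)"
        by (auto intro!: derivative_eq_intros)
      show "(V has_derivative (\<bullet>) (grad V (t *\<^sub>R e))) (at (t *\<^sub>R e))"
        by (intro has_derivative_grad smooth_differentiable V')
    qed
    then show ?thesis unfolding \<Phi>_def[abs_def] \<Phi>'_def has_field_derivative_def
      by (simp add: mult.commute[of _ "grad V (t *\<^sub>R e) \<bullet> e"])
  qed
  have cont': "continuous_on UNIV \<Phi>'" unfolding \<Phi>'_def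
    by (intro continuous_intros continuous_on_compose2[OF smooth_continuous_grad[OF V'(1), of UNIV]]) auto
  have zero: "\<Phi> t = 0" "\<Phi>' t = 0" if "t \<ge> t0" for t
  proof -
    have "t *\<^sub>R e \<notin> tsupport V" using t0 that e by (intro t0(3)) simp
    then show "\<Phi> t = 0" "\<Phi>' t = 0"
      by (simp_all add: \<Phi>_def \<Phi>'_def zero_outside_tsupport grad_zero_outside_tsupport)
  qed
  have nC: "- C \<in> sets borel" using open_C by auto
  have g: "gauge j" by unfold_locales
  have 1: "integral\<^sup>L lborel (\<lambda>x. \<bar>\<Phi> (j x)\<bar> powr q) = measure lborel {x. j x < 1} * ray_integral f y"
    using integral_gauge_ray(2)[OF f g y, of UNIV] unfolding te by (simp add: f_def \<Phi>_def)
  have i: "integrable lborel (\<lambda>x. F (j x *\<^sub>R e) * indicator C x)" "integrable lborel (\<lambda>x. F (j x *\<^sub>R e) * indicator (- C) x)"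
    using integral_gauge_ray(1)[OF F g y borel_C cone] integral_gauge_ray(1)[OF F g y nC] cone
    unfolding te by auto
  have I: "integral\<^sup>L lborel (\<lambda>x. F (j x *\<^sub>R e) * indicator C x) = measure lborel ({x. j x < 1} \<inter> C) * ray_integral F y"
      "integral\<^sup>L lborel (\<lambda>x. F (j x *\<^sub>R e) * indicator (- C) x) = measure lborel ({x. j x < 1} \<inter> - C) * ray_integral F y"
    using integral_gauge_ray(2)[OF F g y borel_C cone] integral_gauge_ray(2)[OF F g y nC] cone
    unfolding te by auto
  have split: "F (j x *\<^sub>R e) * loc_lip x powr p =
      (1 / h powr p) * (F (j x *\<^sub>R e) * indicator C x) + (1 / r powr p) * (F (j x *\<^sub>R e) * indicator (- C) x)" for x
    using r h by (simp add: loc_lip_def powr_divide indicator_def)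
  have int: "integrable lborel (\<lambda>x. F (j x *\<^sub>R e) * loc_lip x powr p)"
    unfolding split using i by (intro Bochner_Integration.integrable_add integrable_mult_right)
  have "lambda_pq p q \<Omega> * (measure lborel {x. j x < 1} * ray_integral f y) powr (p / q)
     \<le> integral\<^sup>L lborel (\<lambda>x. (\<bar>\<Phi>' (j x)\<bar> * loc_lip x) powr p)"
    unfolding 1[symmetric] by (rule lambda_pq_profile[OF sub p q der cont' t0(2) zero])
  also have "\<dots> \<le> integral\<^sup>L lborel (\<lambda>x. F (j x *\<^sub>R e) * loc_lip x powr p)"
  proof (rule integral_mono')
    show "integrable lborel (\<lambda>x. F (j x *\<^sub>R e) * loc_lip x powr p)" by (rule int)
    show "(\<bar>\<Phi>' (j x)\<bar> * loc_lip x) powr p \<le> F (j x *\<^sub>R e) * loc_lip x powr p" for x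
    proof -
      have "\<bar>\<Phi>' (j x)\<bar> \<le> norm (grad V (j x *\<^sub>R e))"
        unfolding \<Phi>'_def using Cauchy_Schwarz_ineq2[of "grad V (j x *\<^sub>R e)" e] e by simp
      then have "\<bar>\<Phi>' (j x)\<bar> powr p \<le> F (j x *\<^sub>R e)"
        unfolding F_def using p by (intro powr_mono2) auto
      then show ?thesis using loc_lip_pos[of x] by (simp add: powr_mult mult_right_mono)
    qed
    show "0 \<le> F (j x *\<^sub>R e) * loc_lip x powr p" for x using F(2) by simp
  qed
  also have "\<dots> = (measure lborel ({x. j x < 1} \<inter> C) / h powr p + measure lborel ({x. j x < 1} - C) / r powr p) * ray_integral F y"
    unfolding split Bochner_Integration.integral_add[OF integrable_mult_right[OF i(1)] integrable_mult_right[OF i(2)]]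
      Bochner_Integration.integral_mult_right[OF i(1)] Bochner_Integration.integral_mult_right[OF i(2)] I Diff_eq
    by (simp add: distrib_right)
  finally show ?thesis .
qed

lemma C0_infty_powr_continuous:
  assumes "\<psi> \<in> C0_infty \<Omega>" "s > 0"
  shows "continuous_on UNIV (\<lambda>x. \<bar>\<psi> x\<bar> powr s)" "continuous_on UNIV (\<lambda>x. norm (grad \<psi> x) powr s)"
  by (intro continuous_on_powr' continuous_intros smooth_continuous smooth_continuous_grad C0_inftyD(1)[OF assms(1)],
      use assms(2) in auto)+

text \<open>\<open>profile_inequality\<close> integrated over y in the unit ball. For normalized V
  the ray integrals of |V|^q have mean 1 / \<omega>, so by convexity their powers of exponent s = p
  / q integrate to at least \<omega> * (1 / \<omega>) powr s; this is the origin of the exponent 1 -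
  p / q.\<close>

lemma (in lipschitz_gauge) comparison:
  assumes sub: "{x. j x < 1} \<subseteq> \<Omega>" and q: "1 \<le> q" and pq: "q < p"
  shows "lambda_pq p q \<Omega> * measure lborel {x. j x < 1} powr (p / q)
      * measure lborel (ball (0::'a) 1) powr (1 - p / q)
    \<le> (measure lborel ({x. j x < 1} \<inter> C) / h powr p + measure lborel ({x. j x < 1} - C) / r powr p)
      * lambda_pq p q (ball (0::'a) 1)"
proof -
  define \<omega> where "\<omega> = measure lborel (ball (0::'a) 1)"
  define k where "k = measure lborel {x. j x < 1}"
  define A where "A = measure lborel ({x. j x < 1} \<inter> C) / h powr p + measure lborel ({x. j x < 1} - C) / r powr p"
  define s where "s = p / q"
  define l where "l = lambda_pq p q \<Omega>"
  have \<omega>: "\<omega> > 0" unfolding \<omega>_def using content_ball_pos[of 1] by auto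
  have s: "s > 1" using q pq by (simp add: s_def)
  have p0: "p > 0" and q0: "q > 0" using q pq by auto
  have ball: "ball 0 r \<subseteq> {x. j x < 1}"
  proof
    fix x :: 'a assume "x \<in> ball 0 r"
    then have "norm x / r < 1" using r by simp
    then show "x \<in> {x. j x < 1}" using lip[of x 0] by simp
  qed
  have l0: "l \<ge> 0" unfolding l_def
    by (rule lambda_pq_nonneg[OF r _ q0 p0]) (use ball sub in blast)
  have fin: "emeasure lborel ({x. j x < 1} \<inter> B) < \<infinity>" for B by (rule emeasure_sublevel_finite)
  have meas: "{x. j x < 1} \<in> fmeasurable lborel"
    using fin[of UNIV] by (intro fmeasurableI) auto
  have "measure lborel (ball (0::'a) r) \<le> k" unfolding k_def
    by (rule measure_mono_fmeasurable[OF ball _ meas]) auto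
  then have k0: "k > 0" using content_ball_pos[OF r, of "0::'a"] by linarith
  have kd: "k = measure lborel ({x. j x < 1} \<inter> C) + measure lborel ({x. j x < 1} - C)"
  proof -
    have "measure lborel (({x. j x < 1} \<inter> C) \<union> ({x. j x < 1} - C))
        = measure lborel ({x. j x < 1} \<inter> C) + measure lborel ({x. j x < 1} - C)"
      using fin[of C] fin[of "- C"] open_C by (intro measure_Union) (auto simp: Diff_eq)
    then show ?thesis by (simp add: k_def Int_Diff_Un)
  qed
  \<comment> \<open>The bound is divided by A below; A is positive since at least one of the two
    pieces of the sublevel set has positive volume.\<close>
  have A0: "A > 0"
  proof (cases "measure lborel ({x. j x < 1} \<inter> C) = 0")
    case True
    then show ?thesis using kd k0 r h by (simp add: A_def)
  next
    case False
    then have "measure lborel ({x. j x < 1} \<inter> C) > 0" by (simp add: zero_less_measure_iff)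
    then show ?thesis using r h unfolding A_def by (intro add_pos_nonneg) auto
  qed
  define c where "c = 1 / \<omega>"
  have c: "c > 0" using \<omega> by (simp add: c_def)
  \<comment> \<open>The tangent of \<open>a powr s\<close> at the mean value \<open>c\<close> of the ray integrals replaces Jensen's inequality.\<close>
  define \<alpha> \<beta> where "\<alpha> = l * k powr s * (s * c powr (s - 1))" and "\<beta> = l * k powr s * ((s - 1) * c powr s)"
  have \<alpha>0: "\<alpha> \<ge> 0" and \<beta>0: "\<beta> \<ge> 0" using l0 s by (auto simp: \<alpha>_def \<beta>_def)
  have "l * k powr s * \<omega> powr (1 - s) / A \<le> lambda_pq p q (ball (0::'a) 1)"
  proof (rule lambda_pq_greatest[OF zero_less_one order_refl q0 _ p0])
    fix V :: "'a \<Rightarrow> real"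
    assume V: "V \<in> C0_infty (ball 0 1)" and V1: "integral\<^sup>L lborel (\<lambda>x. \<bar>V x\<bar> powr q) = 1"
    define f where "f x = \<bar>V x\<bar> powr q" for x
    define F where "F x = norm (grad V x) powr p" for x
    define E where "E = integral\<^sup>L lborel F"
    have f: "continuous_on UNIV f" "\<And>x. f x \<ge> 0" "\<And>x. norm x \<ge> 1 \<Longrightarrow> f x = 0"
      unfolding f_def using C0_infty_powr_continuous(1)[OF V q0] C0_inftyD(4)[OF V] by auto
    have F: "continuous_on UNIV F" "\<And>x. F x \<ge> 0" "\<And>x. norm x \<ge> 1 \<Longrightarrow> F x = 0"
      unfolding F_def using C0_infty_powr_continuous(2)[OF V p0] C0_inftyD(5)[OF V] by auto
    have [measurable]: "ray_integral f \<in> borel_measurable borel" "ray_integral F \<in> borel_measurable borel"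
      using borel_ray_integral[OF f] borel_ray_integral[OF F] by blast+
    have [measurable]: "ball (0::'a) 1 \<in> sets borel" by simp
    have polar: "(\<integral>\<^sup>+ y. ennreal (ray_integral f y) * indicator (ball 0 1) y \<partial>lborel) = (\<integral>\<^sup>+ x. ennreal (f x) \<partial>lborel)"
      "(\<integral>\<^sup>+ y. ennreal (ray_integral F y) * indicator (ball 0 1) y \<partial>lborel) = (\<integral>\<^sup>+ x. ennreal (F x) \<partial>lborel)"
      by (rule nn_integral_ray_integral; use f F in blast)+
    \<comment> \<open>The tangent inequality inserted into \<open>profile_inequality\<close>. Being
      linear in the ray integrals, this form can be integrated over y.\<close>
    have pt: "\<alpha> * ray_integral f y \<le> A * ray_integral F y + \<beta>" if y: "y \<noteq> 0" for y
    proof -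
      define a where "a = ray_integral f y"
      have a0: "a \<ge> 0" unfolding a_def by (rule ray_integral_nonneg) (use f in auto)
      have "\<alpha> * a - \<beta> = l * k powr s * (c powr s + s * c powr (s - 1) * (a - c))"
      proof -
        have "c powr s = c powr (s - 1) * c" using c powr_mult_base[of c "s - 1"] by (simp add: mult.commute)
        then show ?thesis unfolding \<alpha>_def \<beta>_def by (simp add: algebra_simps)
      qed
      also have "\<dots> \<le> l * k powr s * a powr s"
        using powr_above_tangent[of s a c] s a0 c l0 by (intro mult_left_mono) auto
      also have "\<dots> = l * (k * a) powr s" using k0 a0 by (simp add: powr_mult)
      also have "\<dots> \<le> A * ray_integral F y"
        using profile_inequality[OF sub p0 q0 V y]
        unfolding l_def k_def s_def a_def A_def f_def[abs_def] F_def[abs_def] .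
      finally show ?thesis by (simp add: a_def)
    qed
    have nz: "AE x in lborel. x \<noteq> (0::'a)" by (rule AE_lborel_singleton)
    have nf: "(\<integral>\<^sup>+ x. ennreal (f x) \<partial>lborel) = 1"
      using nn_integral_eq_integral[OF C0_infty_integrals(1)[OF V q0]] V1 by (simp add: f_def)
    have nF: "(\<integral>\<^sup>+ x. ennreal (F x) \<partial>lborel) = ennreal E"
      unfolding E_def F_def by (rule nn_integral_eq_integral[OF C0_infty_integrals(3)[OF V p0]]) auto
    have E0: "E \<ge> 0" unfolding E_def using F(2) by simp
    have "ennreal \<alpha> = ennreal \<alpha> * (\<integral>\<^sup>+ y. ennreal (ray_integral f y) * indicator (ball 0 1) y \<partial>lborel)"
      unfolding polar nf by simp
    also have "\<dots> = (\<integral>\<^sup>+ y. ennreal \<alpha> * (ennreal (ray_integral f y) * indicator (ball 0 1) y) \<partial>lborel)"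
      by (rule nn_integral_cmult[symmetric]) measurable
    also have "\<dots> \<le> (\<integral>\<^sup>+ y. ennreal A * (ennreal (ray_integral F y) * indicator (ball 0 1) y) + ennreal \<beta> * indicator (ball 0 1) y \<partial>lborel)"
    proof (rule nn_integral_mono_AE, use nz in eventually_elim)
      fix y :: 'a assume "y \<noteq> 0"
      then have "ennreal (\<alpha> * ray_integral f y) \<le> ennreal (A * ray_integral F y + \<beta>)"
        by (intro ennreal_leI pt)
      then have "ennreal \<alpha> * ennreal (ray_integral f y) \<le> ennreal A * ennreal (ray_integral F y) + ennreal \<beta>"
        using \<alpha>0 \<beta>0 A0 ray_integral_nonneg[of F] F by (simp add: ennreal_mult' ennreal_plus)
      then show "ennreal \<alpha> * (ennreal (ray_integral f y) * indicator (ball 0 1) y)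
        \<le> ennreal A * (ennreal (ray_integral F y) * indicator (ball 0 1) y) + ennreal \<beta> * indicator (ball 0 1) y"
        by (simp add: indicator_def)
    qed
    also have "\<dots> = (\<integral>\<^sup>+ y. ennreal A * (ennreal (ray_integral F y) * indicator (ball 0 1) y) \<partial>lborel) + (\<integral>\<^sup>+ y. ennreal \<beta> * indicator (ball (0::'a) 1) y \<partial>lborel)"
      by (rule nn_integral_add) measurable
    also have "(\<integral>\<^sup>+ y. ennreal A * (ennreal (ray_integral F y) * indicator (ball 0 1) y) \<partial>lborel) = ennreal A * ennreal E"
      unfolding nF[symmetric] polar(2)[symmetric] by (rule nn_integral_cmult) measurable
    also have "(\<integral>\<^sup>+ y. ennreal \<beta> * indicator (ball (0::'a) 1) y \<partial>lborel) = ennreal \<beta> * ennreal \<omega>"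
      unfolding \<omega>_def using emeasure_lborel_ball_finite[of "0::'a" 1]
      by (simp add: nn_integral_cmult_indicator emeasure_eq_ennreal_measure less_top)
    also have "ennreal A * ennreal E + ennreal \<beta> * ennreal \<omega> = ennreal (A * E + \<beta> * \<omega>)"
      using A0 E0 \<beta>0 \<omega> by (simp add: ennreal_mult' ennreal_plus)
    finally have "\<alpha> \<le> A * E + \<beta> * \<omega>"
      using A0 E0 \<beta>0 \<omega> by (subst (asm) ennreal_le_iff) auto
    \<comment> \<open>Here c * \<omega> = 1 enters: the difference of \<alpha> and \<beta> *
      \<omega> is then l * k powr s * c powr (s - 1).\<close>
    moreover have "\<beta> * \<omega> = l * k powr s * ((s - 1) * c powr (s - 1))"
    proof -
      have "c powr s = c powr (s - 1) * c" using c powr_mult_base[of c "s - 1"] by (simp add: mult.commute)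
      then have "c powr s * \<omega> = c powr (s - 1)" using \<omega> by (simp add: c_def)
      moreover have "\<beta> * \<omega> = l * k powr s * ((s - 1) * (c powr s * \<omega>))" by (simp add: \<beta>_def)
      ultimately show ?thesis by simp
    qed
    ultimately have "l * k powr s * c powr (s - 1) \<le> A * E"
      unfolding \<alpha>_def by (simp add: algebra_simps)
    moreover have "c powr (s - 1) = \<omega> powr (1 - s)"
      using \<omega> powr_minus_divide[of \<omega> "s - 1"] by (simp add: c_def powr_divide)
    ultimately show "l * k powr s * \<omega> powr (1 - s) / A \<le> integral\<^sup>L lborel (\<lambda>x. norm (grad V x) powr p)"
      using A0 by (simp add: E_def F_def[abs_def] divide_le_eq mult.commute)
  qed
  then show ?thesis using A0
    unfolding l_def k_def s_def A_def \<omega>_def by (simp add: divide_le_eq mult.commute)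
qed

section \<open>Poincare inequality and scaling\<close>

text \<open>A segment of length 2 that starts in the unit ball ends outside it, so V vanishes at its
  end and |V x| is at most the integral of |grad V| along it. The passage to the power p is Jensen's
  inequality on an interval of length 2.\<close>

lemma C0_infty_line_bound:
  fixes V :: "'a::euclidean_space \<Rightarrow> real"
  assumes V: "V \<in> C0_infty (ball 0 1)" and p: "p \<ge> 1" and x: "norm x < 1" and e: "norm e = 1"
  shows "\<bar>V x\<bar> powr p \<le> 2 powr (p - 1) * integral {0..2} (\<lambda>s. norm (grad V (x - s *\<^sub>R e)) powr p)"
proof (cases "V x = 0")
  case True
  have "0 \<le> integral {0..2} (\<lambda>s. norm (grad V (x - s *\<^sub>R e)) powr p)"
    by (cases "(\<lambda>s. norm (grad V (x - s *\<^sub>R e)) powr p) integrable_on {0..2}")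
       (auto intro!: Henstock_Kurzweil_Integration.integral_nonneg simp: not_integrable_integral)
  then show ?thesis using True p by simp
next
  case False
  \<comment> \<open>The mean slope of |V| along the segment, used as the point of tangency.\<close>
  define c where "c = \<bar>V x\<bar> / 2"
  have c: "c > 0" using False by (simp add: c_def)
  define \<sigma> where "\<sigma> = sgn (V x)"
  define D where "D s = - (grad V (x - s *\<^sub>R e) \<bullet> e)" for s
  have V': "smooth V" using C0_inftyD[OF V] by simp
  have der: "((\<lambda>s. V (x - s *\<^sub>R e)) has_real_derivative D s) (at s)" for s
  proof -
    have "((\<lambda>s. V (x - s *\<^sub>R e)) has_derivative (\<lambda>t. grad V (x - s *\<^sub>R e) \<bullet> (- (t *\<^sub>R e)))) (at s)"
    proof (rule has_derivative_compose[where f="\<lambda>s. x - s *\<^sub>R e"])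
      show "((\<lambda>s. x - s *\<^sub>R e) has_derivative (\<lambda>s. - (s *\<^sub>R e))) (at s)"
        by (auto intro!: derivative_eq_intros)
      show "(V has_derivative (\<bullet>) (grad V (x - s *\<^sub>R e))) (at (x - s *\<^sub>R e))"
        by (intro has_derivative_grad smooth_differentiable V')
    qed
    then show ?thesis unfolding D_def has_field_derivative_def
      by (rule has_derivative_eq_rhs) (auto simp: fun_eq_iff)
  qed
  \<comment> \<open>W is an antiderivative of the tangent bound w at the signed slope - \<sigma> * D
    s. Between 0 and 2 its linear correction cancels, which leaves 2 * c powr p.\<close>
  define W where "W s = c powr p * s + p * c powr (p - 1) * (- \<sigma> * V (x - s *\<^sub>R e) - c * s)" for s
  define w where "w s = c powr p + p * c powr (p - 1) * (- \<sigma> * D s - c)" for s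
  have dW: "(W has_real_derivative w s) (at s)" for s
    unfolding W_def w_def by (auto intro!: derivative_eq_intros der)
  have hi: "(w has_integral (W 2 - W 0)) {0..2}"
    by (rule fundamental_theorem_of_calculus)
       (auto intro: has_vector_derivative_at_within dW[unfolded has_real_derivative_iff_has_vector_derivative])
  have "norm (x - 2 *\<^sub>R e) \<ge> 1" using norm_triangle_ineq2[of "2 *\<^sub>R e" x] x e by (simp add: norm_minus_commute)
  then have "V (x - 2 *\<^sub>R e) = 0" using C0_inftyD(4)[OF V, of "x - 2 *\<^sub>R e"] by simp
  then have W: "W 2 - W 0 = 2 * c powr p"
    unfolding W_def \<sigma>_def c_def by (simp add: abs_sgn[symmetric] mult.commute sgn_mult_self_eq[symmetric])
  have int: "(\<lambda>s. norm (grad V (x - s *\<^sub>R e)) powr p) integrable_on {0..2}"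
    by (intro integrable_continuous_interval continuous_on_compose2[OF C0_infty_powr_continuous(2)[OF V]] continuous_intros)
       (use p in auto)
  have "2 * c powr p \<le> integral {0..2} (\<lambda>s. norm (grad V (x - s *\<^sub>R e)) powr p)"
    unfolding W[symmetric]
  proof (rule has_integral_le[OF hi integrable_integral[OF int]])
    fix s :: real
    have "\<bar>- \<sigma> * D s\<bar> \<le> norm (grad V (x - s *\<^sub>R e))"
      using Cauchy_Schwarz_ineq2[of "grad V (x - s *\<^sub>R e)" e] e by (simp add: D_def \<sigma>_def abs_mult abs_sgn_eq)
    then have "- \<sigma> * D s \<le> norm (grad V (x - s *\<^sub>R e))" by linarith
    then have "w s \<le> c powr p + p * c powr (p - 1) * (norm (grad V (x - s *\<^sub>R e)) - c)"
      unfolding w_def using p by (intro add_left_mono mult_left_mono) auto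
    also have "\<dots> \<le> norm (grad V (x - s *\<^sub>R e)) powr p"
      using p c by (intro powr_above_tangent) auto
    finally show "w s \<le> norm (grad V (x - s *\<^sub>R e)) powr p" .
  qed
  moreover have "\<bar>V x\<bar> powr p = 2 powr (p - 1) * (2 * c powr p)"
    by (simp add: c_def powr_divide powr_diff)
  ultimately show ?thesis by simp
qed

text \<open>Integrate \<open>C0_infty_line_bound\<close> over x and exchange the integrals: all
  translates of F have the same integral, and the interval of length 2 turns 2 powr (p - 1) into 2
  powr p.\<close>

lemma lp_poincare:
  fixes V :: "'a::euclidean_space \<Rightarrow> real"
  assumes V: "V \<in> C0_infty (ball 0 1)" and p: "p \<ge> 1"
  shows "integral\<^sup>L lborel (\<lambda>x. \<bar>V x\<bar> powr p) \<le> 2 powr p * integral\<^sup>L lborel (\<lambda>x. norm (grad V x) powr p)"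
proof -
  obtain e :: 'a where "e \<in> Basis" using nonempty_Basis by blast
  then have e: "norm e = 1" by simp
  have p0: "p > 0" using p by simp
  define F where "F x = norm (grad V x) powr p" for x
  have Fc: "continuous_on UNIV F" unfolding F_def using C0_infty_powr_continuous(2)[OF V p0] .
  have [measurable]: "F \<in> borel_measurable borel" using Fc by (rule borel_measurable_continuous_onI)
  define E where "E = integral\<^sup>L lborel F"
  have E0: "E \<ge> 0" by (simp add: E_def F_def)
  have nF: "(\<integral>\<^sup>+ x. ennreal (F x) \<partial>lborel) = ennreal E"
    unfolding E_def F_def by (rule nn_integral_eq_integral[OF C0_infty_integrals(3)[OF V p0]]) auto
  have pt: "ennreal (\<bar>V x\<bar> powr p) \<le> ennreal (2 powr (p - 1)) * (\<integral>\<^sup>+ s. ennreal (F (x - s *\<^sub>R e)) * indicator {0..2} s \<partial>lborel)" for x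
  proof (cases "norm x < 1")
    case False
    then have "V x = 0" using C0_inftyD(4)[OF V, of x] by simp
    then show ?thesis by simp
  next
    case True
    have c: "continuous_on {0..2} (\<lambda>s. F (x - s *\<^sub>R e))"
      by (intro continuous_on_compose2[OF Fc] continuous_intros) auto
    have int: "integrable lborel (\<lambda>s. indicator {0..2} s *\<^sub>R F (x - s *\<^sub>R e))"
      by (intro borel_integrable_compact c) simp
    have "integral {0..2} (\<lambda>s. F (x - s *\<^sub>R e)) = integral {0..2} (\<lambda>s. indicator {0..2} s *\<^sub>R F (x - s *\<^sub>R e))"
      by (intro Henstock_Kurzweil_Integration.integral_cong) simp
    also have "\<dots> = integral\<^sup>L lborel (\<lambda>s. indicator {0..2} s *\<^sub>R F (x - s *\<^sub>R e))"
      using int by (intro integral_eq_lborel) auto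
    finally have "ennreal (integral {0..2} (\<lambda>s. F (x - s *\<^sub>R e))) = (\<integral>\<^sup>+ s. ennreal (indicator {0..2} s *\<^sub>R F (x - s *\<^sub>R e)) \<partial>lborel)"
      using nn_integral_eq_integral[OF int] by (simp add: F_def)
    also have "\<dots> = (\<integral>\<^sup>+ s. ennreal (F (x - s *\<^sub>R e)) * indicator {0..2} s \<partial>lborel)"
      by (intro nn_integral_cong) (auto simp: indicator_def)
    finally show ?thesis
      using ennreal_leI[OF C0_infty_line_bound[OF V p True e]] by (simp add: F_def ennreal_mult')
  qed
  have "(\<integral>\<^sup>+ x. ennreal (\<bar>V x\<bar> powr p) \<partial>lborel)
     \<le> (\<integral>\<^sup>+ x. ennreal (2 powr (p - 1)) * (\<integral>\<^sup>+ s. ennreal (F (x - s *\<^sub>R e)) * indicator {0..2} s \<partial>lborel) \<partial>lborel)"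
    by (intro nn_integral_mono pt)
  also have "\<dots> = ennreal (2 powr (p - 1)) * (\<integral>\<^sup>+ x. (\<integral>\<^sup>+ s. ennreal (F (x - s *\<^sub>R e)) * indicator {0..2} s \<partial>lborel) \<partial>lborel)"
    by (rule nn_integral_cmult) measurable
  also have "(\<integral>\<^sup>+ x. (\<integral>\<^sup>+ s. ennreal (F (x - s *\<^sub>R e)) * indicator {0..2} s \<partial>lborel) \<partial>lborel)
     = (\<integral>\<^sup>+ s. (\<integral>\<^sup>+ x. ennreal (F (x - s *\<^sub>R e)) * indicator {0..2} s \<partial>lborel) \<partial>lborel)"
    by (rule lborel_pair.Fubini') measurable
  also have "\<dots> = (\<integral>\<^sup>+ s. ennreal E * indicator {0..2::real} s \<partial>lborel)"
  proof (rule nn_integral_cong)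
    fix s :: real
    have "(\<integral>\<^sup>+ x. ennreal (F x) \<partial>lborel) = ennreal (\<bar>1\<bar> ^ DIM('a)) * (\<integral>\<^sup>+ x. ennreal (F (- (s *\<^sub>R e) + 1 *\<^sub>R x)) \<partial>lborel)"
      by (rule nn_integral_lborel_affine) auto
    then have "(\<integral>\<^sup>+ x. ennreal (F (x - s *\<^sub>R e)) \<partial>lborel) = ennreal E"
      unfolding nF by simp
    then show "(\<integral>\<^sup>+ x. ennreal (F (x - s *\<^sub>R e)) * indicator {0..2} s \<partial>lborel) = ennreal E * indicator {0..2} s"
      by (simp add: nn_integral_multc)
  qed
  also have "\<dots> = ennreal E * 2" by (simp add: nn_integral_cmult_indicator)
  also have "ennreal (2 powr (p - 1)) * (ennreal E * 2) = ennreal (2 powr p * E)"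
  proof -
    have "ennreal (2 powr (p - 1)) * (ennreal E * 2) = ennreal (2 powr (p - 1) * (E * 2))"
      using E0 by (simp add: ennreal_mult' ennreal_mult'')
    also have "2 powr (p - 1) * (E * 2) = 2 powr p * E" by (simp add: powr_diff)
    finally show ?thesis .
  qed
  finally have "ennreal (integral\<^sup>L lborel (\<lambda>x. \<bar>V x\<bar> powr p)) \<le> ennreal (2 powr p * E)"
    using nn_integral_eq_integral[OF C0_infty_integrals(1)[OF V p0]] by simp
  then show ?thesis using E0 unfolding E_def F_def[abs_def] by (subst (asm) ennreal_le_iff) auto
qed

text \<open>Positivity keeps the strict inequality from degenerating to 0 < 0. It follows from
  \<open>lp_poincare\<close> once the q-mass is bounded by the p-mass.\<close>

lemma lambda_pq_unit_ball_pos: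
  assumes q: "0 < q" and p: "1 \<le> p" and pq: "q < p"
  shows "lambda_pq p q (ball (0::'a::euclidean_space) 1) > 0"
proof -
  define \<omega> where "\<omega> = measure lborel (ball (0::'a) 1)"
  have \<omega>: "\<omega> > 0" unfolding \<omega>_def using content_ball_pos[of 1] by auto
  \<comment> \<open>With this \<delta> the first term of \<open>powr_le_split\<close> integrates to
    1 / 2 over the ball, so the p-mass must account for the remaining half of the
    normalization.\<close>
  define \<delta> where "\<delta> = 1 / (2 * \<omega>)"
  have \<delta>: "\<delta> > 0" using \<omega> by (simp add: \<delta>_def)
  define K where "K = \<delta> powr (1 - p / q) * 2 powr p"
  have K: "K > 0" using \<delta> by (simp add: K_def)
  have p0: "p > 0" using p by simp
  have "1 / (2 * K) \<le> lambda_pq p q (ball (0::'a) 1)"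
  proof (rule lambda_pq_greatest[OF zero_less_one order_refl q _ p0])
    fix V :: "'a \<Rightarrow> real"
    assume V: "V \<in> C0_infty (ball 0 1)" and V1: "integral\<^sup>L lborel (\<lambda>x. \<bar>V x\<bar> powr q) = 1"
    have ib: "integrable lborel (\<lambda>x::'a. \<delta> * indicator (ball 0 1) x)"
      using emeasure_lborel_ball_finite[of "0::'a" 1]
      by (intro integrable_mult_right integrable_real_indicator) (auto simp: less_top)
    have ip: "integrable lborel (\<lambda>x. \<delta> powr (1 - p / q) * \<bar>V x\<bar> powr p)"
      by (intro integrable_mult_right C0_infty_integrals(1)[OF V p0])
    have "integral\<^sup>L lborel (\<lambda>x. \<bar>V x\<bar> powr q)
        \<le> integral\<^sup>L lborel (\<lambda>x. \<delta> * indicator (ball 0 1) x + \<delta> powr (1 - p / q) * \<bar>V x\<bar> powr p)"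
    proof (rule integral_mono[OF C0_infty_integrals(1)[OF V q]])
      show "integrable lborel (\<lambda>x. \<delta> * indicator (ball 0 1) x + \<delta> powr (1 - p / q) * \<bar>V x\<bar> powr p)"
        using ib ip by (rule Bochner_Integration.integrable_add)
      show "\<bar>V x\<bar> powr q \<le> \<delta> * indicator (ball 0 1) x + \<delta> powr (1 - p / q) * \<bar>V x\<bar> powr p" for x
        using powr_le_split[of "\<bar>V x\<bar>" q p \<delta>] q pq \<delta> C0_inftyD(4)[OF V, of x] by (cases "x \<in> ball 0 1") auto
    qed
    also have "\<dots> = \<delta> * \<omega> + \<delta> powr (1 - p / q) * integral\<^sup>L lborel (\<lambda>x. \<bar>V x\<bar> powr p)"
      unfolding Bochner_Integration.integral_add[OF ib ip] by (simp add: \<omega>_def)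
    also have "\<delta> * \<omega> = 1 / 2" using \<omega> by (simp add: \<delta>_def)
    finally have "1 / 2 \<le> \<delta> powr (1 - p / q) * integral\<^sup>L lborel (\<lambda>x. \<bar>V x\<bar> powr p)"
      unfolding V1 by simp
    also have "\<dots> \<le> \<delta> powr (1 - p / q) * (2 powr p * integral\<^sup>L lborel (\<lambda>x. norm (grad V x) powr p))"
      by (intro mult_left_mono lp_poincare[OF V p]) simp
    finally show "1 / (2 * K) \<le> integral\<^sup>L lborel (\<lambda>x. norm (grad V x) powr p)"
      using K by (simp add: K_def divide_le_eq mult_ac)
  qed
  moreover have "1 / (2 * K) > 0" using K by simp
  ultimately show ?thesis by linarith
qed

text \<open>The pullback of a normalized \<psi> under the map a + c x has mass c^(-N) and c^(p - N)
  times the energy of \<psi>. With c = 1 this compares translates, with c = r a ball and the unit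
  ball.\<close>

lemma lambda_pq_affine_le:
  fixes \<Omega> \<Omega>' :: "'a::euclidean_space set"
  assumes c: "c > 0" and sub: "\<And>x. a + c *\<^sub>R x \<in> \<Omega>' \<Longrightarrow> x \<in> \<Omega>"
    and b: "e > 0" "ball z e \<subseteq> \<Omega>'" and p: "p > 0" and q: "q > 0"
  shows "lambda_pq p q \<Omega> * (1 / c ^ DIM('a)) powr (p / q) \<le> c powr p / c ^ DIM('a) * lambda_pq p q \<Omega>'"
proof -
  define k where "k = c ^ DIM('a)"
  have k: "k > 0" using c by (simp add: k_def)
  have "lambda_pq p q \<Omega> * (1 / k) powr (p / q) * k / c powr p \<le> lambda_pq p q \<Omega>'"
  proof (rule lambda_pq_greatest[OF b q _ p])
    fix \<psi> :: "'a \<Rightarrow> real"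
    assume \<psi>: "\<psi> \<in> C0_infty \<Omega>'" and \<psi>1: "integral\<^sup>L lborel (\<lambda>x. \<bar>\<psi> x\<bar> powr q) = 1"
    define \<phi> where "\<phi> x = \<psi> (a + c *\<^sub>R x)" for x
    have \<phi>: "\<phi> \<in> C0_infty \<Omega>"
      using C0_infty_affine[OF \<psi>, of c a \<Omega> 1] c sub unfolding \<phi>_def[abs_def] by simp
    have g: "grad \<phi> x = c *\<^sub>R grad \<psi> (a + c *\<^sub>R x)" for x
      unfolding \<phi>_def[abs_def] by (intro grad_affine smooth_differentiable C0_inftyD(1)[OF \<psi>])
    have "k * integral\<^sup>L lborel (\<lambda>x. \<bar>\<phi> x\<bar> powr q) = 1"
      using lborel_integral_affine[of "\<lambda>x. \<bar>\<psi> x\<bar> powr q" c a] C0_infty_integrals(1)[OF \<psi> q] c \<psi>1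
      by (simp add: \<phi>_def k_def)
    then have 1: "integral\<^sup>L lborel (\<lambda>x. \<bar>\<phi> x\<bar> powr q) = 1 / k" using k by (simp add: field_simps)
    have "integral\<^sup>L lborel (\<lambda>x. norm (grad \<phi> x) powr p)
      = c powr p * integral\<^sup>L lborel (\<lambda>x. norm (grad \<psi> (a + c *\<^sub>R x)) powr p)"
      unfolding g using c by (simp add: powr_mult)
    moreover have "k * integral\<^sup>L lborel (\<lambda>x. norm (grad \<psi> (a + c *\<^sub>R x)) powr p) = integral\<^sup>L lborel (\<lambda>x. norm (grad \<psi> x) powr p)"
      using lborel_integral_affine[of "\<lambda>x. norm (grad \<psi> x) powr p" c a] C0_infty_integrals(3)[OF \<psi> p] c
      by (simp add: k_def)
    ultimately have 2: "k * integral\<^sup>L lborel (\<lambda>x. norm (grad \<phi> x) powr p) = c powr p * integral\<^sup>L lborel (\<lambda>x. norm (grad \<psi> x) powr p)"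
      by (simp add: algebra_simps)
    have "lambda_pq p q \<Omega> * (1 / k) powr (p / q) \<le> integral\<^sup>L lborel (\<lambda>x. norm (grad \<phi> x) powr p)"
      using lambda_pq_le[OF \<phi> p q] k unfolding 1 by simp
    then have "lambda_pq p q \<Omega> * (1 / k) powr (p / q) * k \<le> c powr p * integral\<^sup>L lborel (\<lambda>x. norm (grad \<psi> x) powr p)"
      using k unfolding 2[symmetric] by (simp add: mult.commute)
    then show "lambda_pq p q \<Omega> * (1 / k) powr (p / q) * k / c powr p \<le> integral\<^sup>L lborel (\<lambda>x. norm (grad \<psi> x) powr p)"
      using c by (simp add: divide_le_eq mult.commute)
  qed
  then show ?thesis using k c unfolding k_def[symmetric] by (simp add: field_simps)
qed

section \<open>Minkowski functionals and cutting off a cap\<close>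

definition minkowski :: "'a::euclidean_space set \<Rightarrow> 'a \<Rightarrow> real" where
  "minkowski \<Omega> x = Inf {t. t > 0 \<and> (1 / t) *\<^sub>R x \<in> \<Omega>}"

text \<open>The ball is centred at the origin so that the Minkowski functional has Lipschitz
  constant 1 / R.\<close>

locale convex_body =
  fixes \<Omega> :: "'a::euclidean_space set" and R :: real
  assumes conv: "convex \<Omega>" and op: "open \<Omega>" and bdd: "bounded \<Omega>"
    and R: "R > 0" and ball_sub: "ball 0 R \<subseteq> \<Omega>"
begin

lemma scale_down:
  assumes "x \<in> \<Omega>" "0 \<le> t" "t \<le> 1" shows "t *\<^sub>R x \<in> \<Omega>"
proof -
  have "0 \<in> \<Omega>" using ball_sub R by auto
  then have "(1 - t) *\<^sub>R 0 + t *\<^sub>R x \<in> \<Omega>" using assms by (intro convexD[OF conv]) auto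
  then show ?thesis by simp
qed

text \<open>Openness makes the inequality strict: if x / t lies in \<Omega>, so does x / s for some
  smaller s. The other direction uses that \<Omega> is star-shaped about 0. For t = 1 it identifies
  \<Omega> with the open sublevel set.\<close>

lemma minkowski_less_iff:
  assumes "t > 0" shows "minkowski \<Omega> x < t \<longleftrightarrow> (1 / t) *\<^sub>R x \<in> \<Omega>"
proof
  let ?S = "{t. t > 0 \<and> (1 / t) *\<^sub>R x \<in> \<Omega>}"
  have bd: "bdd_below ?S" by (rule bdd_belowI[of _ 0]) auto
  assume less: "minkowski \<Omega> x < t"
  \<comment> \<open>A witness that the infimum is over a nonempty set: dividing by it shrinks x into
    the inball.\<close>
  have "norm x / R + 1 \<in> ?S"
  proof -
    have "norm x < (norm x / R + 1) * R" using R by (simp add: distrib_right)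
    moreover have "norm x / R + 1 > 0" using R by (simp add: add_nonneg_pos)
    ultimately have "(1 / (norm x / R + 1)) *\<^sub>R x \<in> ball 0 R"
      by (simp add: pos_divide_less_eq mult.commute)
    then show ?thesis using ball_sub \<open>norm x / R + 1 > 0\<close> by blast
  qed
  then obtain s where s: "s \<in> ?S" "s < t" using less cInf_less_iff[OF _ bd] unfolding minkowski_def by blast
  have "(s / t) *\<^sub>R ((1 / s) *\<^sub>R x) \<in> \<Omega>" using s assms by (rule_tac scale_down) auto
  then show "(1 / t) *\<^sub>R x \<in> \<Omega>" using s by simp
next
  let ?S = "{t. t > 0 \<and> (1 / t) *\<^sub>R x \<in> \<Omega>}"
  have bd: "bdd_below ?S" by (rule bdd_belowI[of _ 0]) auto
  assume "(1 / t) *\<^sub>R x \<in> \<Omega>"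
  moreover have "((\<lambda>s. (1 / s) *\<^sub>R x) \<longlongrightarrow> (1 / t) *\<^sub>R x) (at_left t)"
    using assms by (intro tendsto_intros) auto
  ultimately have "eventually (\<lambda>s. (1 / s) *\<^sub>R x \<in> \<Omega>) (at_left t)"
    using op topological_tendstoD by blast
  moreover have "eventually (\<lambda>s. s \<in> {0<..<t}) (at_left t)"
    using assms by (rule eventually_at_left_real)
  ultimately have "eventually (\<lambda>s. s \<in> ?S \<and> s < t) (at_left t)"
    by eventually_elim auto
  then obtain s where "s \<in> ?S" "s < t"
    using eventually_happens[of _ "at_left t"] by auto
  then show "minkowski \<Omega> x < t" unfolding minkowski_def using cInf_lower[OF _ bd, of s] by linarith
qed

lemma minkowski_nonneg: "minkowski \<Omega> x \<ge> 0"
proof (rule ccontr)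
  assume "\<not> minkowski \<Omega> x \<ge> 0"
  then have neg: "minkowski \<Omega> x < 0" by simp
  let ?S = "{t. t > 0 \<and> (1 / t) *\<^sub>R x \<in> \<Omega>}"
  have "minkowski \<Omega> x < norm x / R + 1" using neg R by (smt (verit) divide_nonneg_pos norm_ge_zero)
  then have "?S \<noteq> {}" using minkowski_less_iff[of "norm x / R + 1" x] R
    by (smt (verit, best) divide_nonneg_pos empty_iff mem_Collect_eq norm_ge_zero)
  then have "0 \<le> minkowski \<Omega> x" unfolding minkowski_def by (rule cInf_greatest) auto
  then show False using neg by simp
qed

lemma minkowski_eqI:
  assumes "a \<ge> 0" "\<And>t. t > 0 \<Longrightarrow> (1 / t) *\<^sub>R x \<in> \<Omega> \<longleftrightarrow> a < t"
  shows "minkowski \<Omega> x = a"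
proof (rule ccontr)
  assume "minkowski \<Omega> x \<noteq> a"
  then consider "minkowski \<Omega> x < a" | "a < minkowski \<Omega> x" by linarith
  then show False
  proof cases
    case 1
    then have "a > 0" using minkowski_nonneg[of x] by linarith
    then show False using 1 minkowski_less_iff[of a x] assms(2)[of a] by simp
  next
    case 2
    then have "minkowski \<Omega> x > 0" using assms(1) by linarith
    then show False using 2 minkowski_less_iff[of "minkowski \<Omega> x" x] assms(2)[of "minkowski \<Omega> x"] by simp
  qed
qed

lemma minkowski_hom:
  assumes "s \<ge> 0" shows "minkowski \<Omega> (s *\<^sub>R x) = s * minkowski \<Omega> x"
proof (cases "s = 0")
  case True
  have "minkowski \<Omega> (s *\<^sub>R x) = 0"
    using True ball_sub R by (intro minkowski_eqI) (auto simp: subset_iff)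
  then show ?thesis using True by simp
next
  case False
  then have s: "s > 0" using assms by simp
  show ?thesis
  proof (rule minkowski_eqI)
    show "0 \<le> s * minkowski \<Omega> x" using s minkowski_nonneg by simp
    fix t :: real assume t: "t > 0"
    have "(1 / t) *\<^sub>R s *\<^sub>R x = (1 / (t / s)) *\<^sub>R x" by simp
    then have "(1 / t) *\<^sub>R s *\<^sub>R x \<in> \<Omega> \<longleftrightarrow> minkowski \<Omega> x < t / s"
      using minkowski_less_iff[of "t / s" x] s t by simp
    then show "(1 / t) *\<^sub>R s *\<^sub>R x \<in> \<Omega> \<longleftrightarrow> s * minkowski \<Omega> x < t"
      using s by (simp add: pos_less_divide_eq mult.commute)
  qed
qed

lemma minkowski_triangle: "minkowski \<Omega> (x + y) \<le> minkowski \<Omega> x + minkowski \<Omega> y"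
proof (rule field_le_epsilon)
  fix e :: real assume e: "e > 0"
  define a b where "a = minkowski \<Omega> x + e / 2" and "b = minkowski \<Omega> y + e / 2"
  have ab: "a > 0" "b > 0" using e minkowski_nonneg[of x] minkowski_nonneg[of y] by (auto simp: a_def b_def)
  have "(1 / a) *\<^sub>R x \<in> \<Omega>" "(1 / b) *\<^sub>R y \<in> \<Omega>"
    using minkowski_less_iff[OF ab(1), of x] minkowski_less_iff[OF ab(2), of y] e by (auto simp: a_def b_def)
  then have "(a / (a + b)) *\<^sub>R ((1 / a) *\<^sub>R x) + (b / (a + b)) *\<^sub>R ((1 / b) *\<^sub>R y) \<in> \<Omega>"
    using ab by (intro convexD[OF conv]) (auto simp: add_divide_distrib[symmetric])
  also have "(a / (a + b)) *\<^sub>R ((1 / a) *\<^sub>R x) + (b / (a + b)) *\<^sub>R ((1 / b) *\<^sub>R y) = (1 / (a + b)) *\<^sub>R (x + y)"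
    using ab by (simp add: scaleR_add_right)
  finally have "minkowski \<Omega> (x + y) < a + b"
    using minkowski_less_iff[of "a + b" "x + y"] ab by simp
  then show "minkowski \<Omega> (x + y) \<le> minkowski \<Omega> x + minkowski \<Omega> y + e" by (simp add: a_def b_def)
qed

lemma minkowski_le: "minkowski \<Omega> x \<le> norm x / R"
proof (rule field_le_epsilon)
  fix e :: real assume e: "e > 0"
  define t where "t = norm x / R + e"
  have t: "t > 0" using e R by (simp add: t_def add_nonneg_pos)
  have "norm x < t * R" using R e by (simp add: t_def distrib_right)
  then have "(1 / t) *\<^sub>R x \<in> ball 0 R" using t by (simp add: pos_divide_less_eq mult.commute)
  then have "minkowski \<Omega> x < t" using minkowski_less_iff[OF t] ball_sub by blast
  then show "minkowski \<Omega> x \<le> norm x / R + e" by (simp add: t_def)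
qed

lemma minkowski_lipschitz: "\<bar>minkowski \<Omega> x - minkowski \<Omega> y\<bar> \<le> norm (x - y) / R"
  using minkowski_triangle[of "x - y" y] minkowski_triangle[of "y - x" x] minkowski_le[of "x - y"] minkowski_le[of "y - x"]
  by (simp add: norm_minus_commute)

lemma minkowski_sublevel: "{x. minkowski \<Omega> x < 1} = \<Omega>"
  using minkowski_less_iff[of 1] by auto

lemma minkowski_pos:
  assumes "x \<noteq> 0" shows "minkowski \<Omega> x > 0"
proof -
  obtain B where B: "\<And>y. y \<in> \<Omega> \<Longrightarrow> norm y \<le> B" using bdd bounded_iff by blast
  define t where "t = norm x / (\<bar>B\<bar> + 1)"
  have t: "t > 0" using assms by (simp add: t_def add_nonneg_pos)
  have "norm ((1 / t) *\<^sub>R x) = \<bar>B\<bar> + 1" using assms by (simp add: t_def)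
  then have "(1 / t) *\<^sub>R x \<notin> \<Omega>" using B[of "(1 / t) *\<^sub>R x"] by linarith
  then show ?thesis using minkowski_less_iff[OF t, of x] t by linarith
qed

lemma lipschitz_continuous:
  fixes j :: "'a \<Rightarrow> real"
  assumes "\<And>x y. \<bar>j x - j y\<bar> \<le> norm (x - y) / R"
  shows "continuous_on UNIV j"
  by (rule lipschitz_on_continuous_on[of "1 / R"], rule lipschitz_onI)
     (use assms R in \<open>auto simp: dist_norm\<close>)

lemma gauge_minkowski: "gauge (minkowski \<Omega>)"
  by unfold_locales
     (auto intro: minkowski_hom minkowski_pos lipschitz_continuous minkowski_lipschitz)

text \<open>The case \<open>C = {}\<close> of \<open>comparison\<close>, with slope 1 / R
  everywhere. It is the inequality of the theorem multiplied by |\<Omega>| and divided by |B_1| powr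
  (p / q - 1).\<close>

lemma lambda_pq_inball_le:
  assumes q: "1 \<le> q" and pq: "q < p"
  shows "lambda_pq p q \<Omega> * measure lborel \<Omega> powr (p / q) * measure lborel (ball (0::'a) 1) powr (1 - p / q)
    \<le> measure lborel \<Omega> / R powr p * lambda_pq p q (ball (0::'a) 1)"
proof -
  obtain \<nu> :: 'a where "\<nu> \<in> Basis" using nonempty_Basis by blast
  interpret gauge "minkowski \<Omega>" by (rule gauge_minkowski)
  interpret lipschitz_gauge "minkowski \<Omega>" R 1 "{}" \<nu>
    by unfold_locales (use R minkowski_lipschitz \<open>\<nu> \<in> Basis\<close> in auto)
  show ?thesis using comparison[OF _ q pq, of \<Omega>] minkowski_sublevel by simp
qed

text \<open>k and d are the volumes of the truncated body K and of its part D under the cut face,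
  seen from the origin. The test functions are supported in K, a subset of \<Omega>, so they bound
  \<open>lambda_pq\<close> of \<Omega> itself; the volume estimate serves to get back from k to
  |\<Omega>|.\<close>

lemma lambda_pq_cut:
  assumes q: "1 \<le> q" and pq: "q < p"
    and \<nu>: "norm \<nu> = 1" and H: "\<And>x. x \<in> \<Omega> \<Longrightarrow> x \<bullet> \<nu> < H"
    and h: "R < h" "h < H" and z: "z \<in> \<Omega>" "h < z \<bullet> \<nu>"
  obtains k d where "0 < d" "d \<le> k" "measure lborel \<Omega> \<le> k + ((H / h) ^ DIM('a) - 1) * d"
    "lambda_pq p q \<Omega> * k powr (p / q) * measure lborel (ball (0::'a) 1) powr (1 - p / q)
      \<le> (d / h powr p + (k - d) / R powr p) * lambda_pq p q (ball (0::'a) 1)"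
proof -
  interpret m: gauge "minkowski \<Omega>" by (rule gauge_minkowski)
  have h0: "h > 0" using h R by linarith
  \<comment> \<open>The Minkowski functional of \<Omega> cut by x . \<nu> < h; on C the cut is the
    binding constraint.\<close>
  define j where "j x = max (minkowski \<Omega> x) ((x \<bullet> \<nu>) / h)" for x
  define C where "C = {x. minkowski \<Omega> x < (x \<bullet> \<nu>) / h}"
  have Ccone: "t *\<^sub>R x \<in> C \<longleftrightarrow> x \<in> C" if "t > 0" for t x
    using that by (simp add: C_def minkowski_hom times_divide_eq_right[symmetric] del: times_divide_eq_right)
  have jhom: "j (t *\<^sub>R x) = t * j x" if "t \<ge> 0" for t x
    using that by (simp add: j_def minkowski_hom max_mult_distrib_left)
  have jlip: "\<bar>j x - j y\<bar> \<le> norm (x - y) / R" for x y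
  proof -
    have "\<bar>(x \<bullet> \<nu>) / h - (y \<bullet> \<nu>) / h\<bar> = \<bar>(x - y) \<bullet> \<nu>\<bar> / h"
      using h0 by (simp add: inner_diff_left diff_divide_distrib[symmetric])
    also have "\<dots> \<le> norm (x - y) / h"
      using Cauchy_Schwarz_ineq2[of "x - y" \<nu>] \<nu> h0 by (simp add: divide_right_mono)
    \<comment> \<open>Here R < h keeps the slope of the linear piece below 1 / R.\<close>
    also have "\<dots> \<le> norm (x - y) / R" using h R by (intro divide_left_mono) auto
    finally show ?thesis using minkowski_lipschitz[of x y] unfolding j_def by linarith
  qed
  interpret j: gauge j
    by unfold_locales (use jhom minkowski_pos lipschitz_continuous[OF jlip] in \<open>auto simp: j_def less_max_iff_disj\<close>)
  interpret j: lipschitz_gauge j R h C \<nu>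
  proof unfold_locales
    show "open C" unfolding C_def using m.cont h0 by (intro open_Collect_less continuous_intros) auto
    show "j x = (x \<bullet> \<nu>) / h" if "x \<in> C" for x using that by (simp add: C_def j_def)
  qed (use R h0 \<nu> jlip Ccone in auto)
  define K where "K = {x. j x < 1}"
  define D where "D = K \<inter> C"
  define k d where "k = measure lborel K" and "d = measure lborel D"
  have KO: "K \<subseteq> \<Omega>" using minkowski_sublevel unfolding K_def j_def by auto
  have oK: "open K" unfolding K_def by (rule j.open_sublevel)
  have oD: "open D" unfolding D_def using oK j.open_C by blast
  have fm: "B \<in> fmeasurable lborel" if "open B" "bounded B" for B :: "'a set"
    using that emeasure_bounded_finite[of B] by (intro fmeasurableI) auto
  have fK: "K \<in> fmeasurable lborel" using oK bounded_subset[OF bdd KO] by (rule fm)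
  have fD: "D \<in> fmeasurable lborel" using oD bounded_subset[OF bdd, of D] KO D_def by (intro fm) auto
  have dk: "d \<le> k" unfolding d_def k_def using fK fD D_def by (intro measure_mono_fmeasurable) auto
  have d0: "d > 0"
  proof -
    have zh: "z \<bullet> \<nu> > 0" using z h0 by linarith
    \<comment> \<open>Scales z down to height h / 2, where j has the value 1 / 2; a small ball
      around this point lies in D.\<close>
    define t where "t = (h / 2) / (z \<bullet> \<nu>)"
    have t: "t > 0" using zh h0 by (simp add: t_def)
    have "minkowski \<Omega> z < 1" using z minkowski_sublevel by auto
    also have "1 < (z \<bullet> \<nu>) / h" using z h0 by simp
    finally have "z \<in> C" by (simp add: C_def)
    then have tC: "t *\<^sub>R z \<in> C" using Ccone t by blast
    moreover have "j (t *\<^sub>R z) < 1" using j.on_C[OF tC] zh h0 by (simp add: t_def)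
    ultimately have "t *\<^sub>R z \<in> D" by (simp add: D_def K_def)
    then obtain e where e: "e > 0" "ball (t *\<^sub>R z) e \<subseteq> D" using oD open_contains_ball by blast
    have "measure lborel (ball (t *\<^sub>R z) e) \<le> d" unfolding d_def by (rule measure_mono_fmeasurable[OF e(2) _ fD]) auto
    then show ?thesis using content_ball_pos[OF e(1), of "t *\<^sub>R z"] by linarith
  qed
  define \<kappa> where "\<kappa> = H / h"
  have \<kappa>: "\<kappa> > 1" using h h0 by (simp add: \<kappa>_def)
  \<comment> \<open>The dilation by \<kappa> = H / h carries the cut face from height h to height H,
    above every point of \<Omega>.\<close>
  define D' where "D' = (*\<^sub>R) \<kappa> ` D"
  have D'mem: "x \<in> D' \<longleftrightarrow> (1 / \<kappa>) *\<^sub>R x \<in> D" for x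
  proof
    assume "(1 / \<kappa>) *\<^sub>R x \<in> D"
    then show "x \<in> D'" unfolding D'_def using \<kappa> by (intro image_eqI[of _ _ "(1 / \<kappa>) *\<^sub>R x"]) auto
  qed (use \<kappa> in \<open>auto simp: D'_def\<close>)
  have oD': "open D'" unfolding D'_def using oD \<kappa> by (intro open_scaling) auto
  have fD': "D' \<in> fmeasurable lborel"
    using oD' bounded_scaling[of D \<kappa>] bounded_subset[OF bdd, of D] KO unfolding D'_def D_def by (intro fm) auto
  have mD': "measure lborel D' = \<kappa> ^ DIM('a) * d"
    using measure_lebesgue_affine[of \<kappa> 0 D] \<kappa> oD oD' unfolding D'_def d_def by simp
  have DD': "D \<subseteq> D'"
  proof
    fix x assume x: "x \<in> D"
    have "(1 / \<kappa>) * j x \<le> 1 * j x" using \<kappa> j.nonneg[of x] by (intro mult_right_mono) auto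
    then have "j ((1 / \<kappa>) *\<^sub>R x) < 1" using jhom[of "1 / \<kappa>" x] \<kappa> x by (simp add: D_def K_def)
    then show "x \<in> D'" unfolding D'mem using x Ccone[of "1 / \<kappa>" x] \<kappa> by (simp add: D_def K_def)
  qed
  \<comment> \<open>A point cut off from \<Omega> lies in the cone C and below height H, so dividing
    it by \<kappa> brings it below height h, into D.\<close>
  have cover: "\<Omega> \<subseteq> K \<union> (D' - D)"
  proof
    fix x assume x: "x \<in> \<Omega>"
    show "x \<in> K \<union> (D' - D)"
    proof (cases "x \<in> K")
      case False
      have mx: "minkowski \<Omega> x < 1" using x minkowski_sublevel by auto
      then have "1 \<le> (x \<bullet> \<nu>) / h" using False by (simp add: K_def j_def)
      then have xC: "x \<in> C" using mx by (simp add: C_def)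
      then have yC: "(1 / \<kappa>) *\<^sub>R x \<in> C" using Ccone[of "1 / \<kappa>" x] \<kappa> by simp
      have "j ((1 / \<kappa>) *\<^sub>R x) = (x \<bullet> \<nu>) / H"
        using j.on_C[OF yC] h0 by (simp add: \<kappa>_def)
      also have "\<dots> < 1" using H[OF x] h h0 by simp
      finally show ?thesis using yC False by (simp add: D'mem D_def K_def)
    qed simp
  qed
  have "measure lborel \<Omega> \<le> measure lborel (K \<union> (D' - D))"
    using cover op fK fD' fD by (intro measure_mono_fmeasurable fmeasurable.Un fmeasurable.Diff) auto
  also have "\<dots> \<le> k + measure lborel (D' - D)"
    unfolding k_def using oK oD' oD by (intro measure_Un_le) auto
  also have "measure lborel (D' - D) = (\<kappa> ^ DIM('a) - 1) * d"
    using measurable_measure_Diff[OF fD' _ DD'] oD mD' by (simp add: d_def algebra_simps)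
  finally have m: "measure lborel \<Omega> \<le> k + ((H / h) ^ DIM('a) - 1) * d" by (simp add: \<kappa>_def)
  have kd: "measure lborel (K - C) = k - d"
  proof -
    have "K - C = K - D" by (auto simp: D_def)
    then show ?thesis using measurable_measure_Diff[OF fK _ , of D] oD unfolding k_def d_def D_def by auto
  qed
  show ?thesis
    using that[OF d0 dk m] j.comparison[OF _ q pq, of \<Omega>] KO kd
    unfolding K_def[symmetric] D_def[symmetric] k_def[symmetric] d_def[symmetric] by simp
qed

end

section \<open>Strict inequality for bodies other than the inball\<close>

text \<open>By 1 + t \<le> exp t the product is at most exp ((\<sigma> * \<alpha> - \<beta>) * x).
  In the application x = d / k is dictated by the cut, so a bound for small x would not do.\<close>

lemma powr_mult_less_one:
  fixes \<sigma> \<alpha> \<beta> x y :: real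
  assumes "\<sigma> > 0" "\<sigma> * \<alpha> < \<beta>" "\<alpha> \<ge> 0" "0 < x" "0 < y" "y \<le> 1 + \<alpha> * x" "0 \<le> 1 - \<beta> * x"
  shows "y powr \<sigma> * (1 - \<beta> * x) < 1"
proof -
  have "y \<le> exp (\<alpha> * x)" using assms(6) exp_ge_add_one_self[of "\<alpha> * x"] by linarith
  then have "y powr \<sigma> \<le> exp (\<alpha> * x) powr \<sigma>" using assms by (intro powr_mono2) auto
  also have "\<dots> = exp (\<sigma> * \<alpha> * x)" by (simp add: powr_def)
  finally have "y powr \<sigma> * (1 - \<beta> * x) \<le> exp (\<sigma> * \<alpha> * x) * exp (- (\<beta> * x))"
    using assms exp_ge_add_one_self[of "- (\<beta> * x)"] by (intro mult_mono) auto
  also have "\<dots> = exp ((\<sigma> * \<alpha> - \<beta>) * x)" by (simp add: exp_add[symmetric] algebra_simps)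
  also have "\<dots> < 1" using assms by (simp add: mult_neg_pos)
  finally show ?thesis .
qed

text \<open>With m = |\<Omega>|, the estimate of \<open>lambda_pq_cut\<close> is the non-strict
  bound times (m / k) powr \<sigma> * (1 - \<beta> * (d / k)). The first factor pays for the lost
  volume, the second is the gain in slope; their product is below 1 as soon as \<sigma> * \<alpha> <
  \<beta>.\<close>

lemma (in convex_body) lambda_pq_strict:
  assumes q: "1 \<le> q" and pq: "q < p" and ne: "\<Omega> \<noteq> ball 0 R"
  shows "lambda_pq p q \<Omega> * measure lborel \<Omega> powr (p / q - 1)
    < measure lborel (ball (0::'a) 1) powr (p / q - 1) * lambda_pq p q (ball (0::'a) 1) / R powr p"
proof -
  define \<omega> where "\<omega> = measure lborel (ball (0::'a) 1)"
  have \<omega>: "\<omega> > 0" unfolding \<omega>_def using content_ball_pos[of 1] by auto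
  define \<sigma> where "\<sigma> = p / q - 1"
  have \<sigma>: "\<sigma> > 0" using q pq by (simp add: \<sigma>_def)
  have p0: "p > 0" using q pq by linarith
  define L where "L = lambda_pq p q (ball (0::'a) 1)"
  have L: "L > 0" unfolding L_def using q pq by (intro lambda_pq_unit_ball_pos) auto
  define l where "l = lambda_pq p q \<Omega>"
  have l0: "l \<ge> 0" unfolding l_def using R ball_sub q p0 by (intro lambda_pq_nonneg[of R 0]) auto
  define N where "N = DIM('a)"
  obtain y where y: "y \<in> \<Omega>" "R \<le> norm y" using ne ball_sub by (force simp: not_less)
  obtain e where e: "e > 0" "ball y e \<subseteq> \<Omega>" using op y open_contains_ball by blast
  \<comment> \<open>y may lie on the sphere of radius R; openness lets it move outward to z with |z|
    > R, which gives H > R in the direction of z.\<close>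
  define z where "z = y + (e / 2 / norm y) *\<^sub>R y"
  have y0: "norm y > 0" using y R by linarith
  have "z \<in> \<Omega>" using e y0 by (auto simp: z_def subset_iff dist_norm)
  have "z = (1 + e / 2 / norm y) *\<^sub>R y" by (simp add: z_def scaleR_add_left)
  then have "norm z = \<bar>1 + e / 2 / norm y\<bar> * norm y" by simp
  also have "\<dots> = norm y + e / 2" using y0 e by (simp add: abs_of_pos add_pos_pos distrib_right)
  finally have z: "norm z > R" using y e by linarith
  define \<nu> where "\<nu> = (1 / norm z) *\<^sub>R z"
  have z0: "norm z > 0" using z R by linarith
  have \<nu>: "norm \<nu> = 1" using z0 by (simp add: \<nu>_def)
  have z\<nu>: "z \<bullet> \<nu> = norm z" using z0 by (simp add: \<nu>_def power2_norm_eq_inner[symmetric] power2_eq_square)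
  define H where "H = Sup ((\<lambda>x. x \<bullet> \<nu>) ` \<Omega>)"
  obtain B where B: "\<And>x. x \<in> \<Omega> \<Longrightarrow> norm x \<le> B" using bdd bounded_iff by blast
  have bdH: "bdd_above ((\<lambda>x. x \<bullet> \<nu>) ` \<Omega>)"
  proof (rule bdd_aboveI2)
    fix x assume "x \<in> \<Omega>"
    then show "x \<bullet> \<nu> \<le> B" using B[of x] Cauchy_Schwarz_ineq2[of x \<nu>] \<nu> by simp
  qed
  have Hle: "x \<bullet> \<nu> \<le> H" if "x \<in> \<Omega>" for x unfolding H_def using that bdH by (intro cSup_upper) auto
  \<comment> \<open>The supremum is not attained because \<Omega> is open;
    \<open>lambda_pq_cut\<close> is stated with the strict form.\<close>
  have H: "x \<bullet> \<nu> < H" if x: "x \<in> \<Omega>" for x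
  proof -
    obtain e where e: "e > 0" "ball x e \<subseteq> \<Omega>" using op x open_contains_ball by blast
    have "x + (e / 2) *\<^sub>R \<nu> \<in> \<Omega>" using e \<nu> by (auto simp: subset_iff dist_norm)
    from Hle[OF this] have "x \<bullet> \<nu> + e / 2 \<le> H"
      using \<nu> by (simp add: inner_add_left power2_norm_eq_inner[symmetric])
    then show ?thesis using e by linarith
  qed
  have HR: "H > R" using H[OF \<open>z \<in> \<Omega>\<close>] z z\<nu> by linarith
  \<comment> \<open>g h < 0 is the condition \<sigma> * \<alpha> < \<beta>. As h increases to H, g h
    tends to (R / H) powr p - 1 < 0, so some h between R and H works.\<close>
  define g where "g h = \<sigma> * ((H / h) ^ N - 1) - (1 - (R / h) powr p)" for h
  have "(g \<longlongrightarrow> \<sigma> * ((H / H) ^ N - 1) - (1 - (R / H) powr p)) (at_left H)"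
    unfolding g_def using HR R by (intro tendsto_intros) auto
  moreover have "(R / H) powr p < 1"
    using HR R p0 powr_less_mono2[of p "R / H" 1] by simp
  ultimately have "eventually (\<lambda>h. g h < 0) (at_left H)"
    using HR R by (intro order_tendstoD(2)[of g]) auto
  moreover have "eventually (\<lambda>h. h \<in> {R<..<H}) (at_left H)" using HR by (rule eventually_at_left_real)
  ultimately have "eventually (\<lambda>h. g h < 0 \<and> R < h \<and> h < H) (at_left H)" by eventually_elim auto
  then obtain h where h: "g h < 0" "R < h" "h < H" using eventually_happens[of _ "at_left H"] by auto
  have h0: "h > 0" using h R by linarith
  obtain x where x: "x \<in> \<Omega>" "h < x \<bullet> \<nu>"
    using less_cSup_iff[OF _ bdH, of h] h \<open>z \<in> \<Omega>\<close> unfolding H_def by auto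
  obtain k d where kd: "0 < d" "d \<le> k" "measure lborel \<Omega> \<le> k + ((H / h) ^ N - 1) * d"
    and cmp: "l * k powr (p / q) * \<omega> powr (1 - p / q) \<le> (d / h powr p + (k - d) / R powr p) * L"
    using lambda_pq_cut[OF q pq \<nu> H h(2,3) x] unfolding N_def l_def L_def \<omega>_def by blast
  define m where "m = measure lborel \<Omega>"
  have "measure lborel (ball (0::'a) R) \<le> m" unfolding m_def
    using ball_sub op emeasure_bounded_finite[OF bdd] by (intro measure_mono_fmeasurable fmeasurableI) auto
  then have m: "m > 0" using content_ball_pos[OF R, of "0::'a"] by linarith
  have k: "k > 0" using kd by linarith
  define \<alpha> \<beta> where "\<alpha> = (H / h) ^ N - 1" and "\<beta> = 1 - (R / h) powr p"
  have \<alpha>: "\<alpha> \<ge> 0" unfolding \<alpha>_def using h h0 by simp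
  have \<beta>1: "\<beta> \<le> 1" by (simp add: \<beta>_def)
  have x1: "d / k \<le> 1" using kd k by simp
  have sa: "\<sigma> * \<alpha> < \<beta>" using h(1) by (simp add: g_def \<alpha>_def \<beta>_def)
  then have \<beta>0: "\<beta> > 0" using \<sigma> \<alpha> by (smt (verit) mult_nonneg_nonneg)
  have "\<beta> * (d / k) \<le> 1 * 1" using \<beta>1 x1 kd k by (intro mult_mono) auto
  moreover have "m / k \<le> 1 + \<alpha> * (d / k)"
  proof -
    have "m / k \<le> (k + \<alpha> * d) / k" using kd(3) k unfolding m_def \<alpha>_def by (intro divide_right_mono) auto
    then show ?thesis using k by (simp add: add_divide_distrib)
  qed
  ultimately have less: "(m / k) powr \<sigma> * (1 - \<beta> * (d / k)) < 1"
    using \<sigma> sa \<alpha> m k kd by (intro powr_mult_less_one[of \<sigma> \<alpha>]) auto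
  \<comment> \<open>Slope 1 / h instead of 1 / R on the share d / k of the volume lowers the bound
    by the factor 1 - \<beta> * (d / k).\<close>
  have "d / h powr p + (k - d) / R powr p = k / R powr p * (1 - \<beta> * (d / k))"
  proof -
    have "(R / h) powr p / R powr p = 1 / h powr p" using R h0 by (simp add: powr_divide)
    then have "1 / h powr p = (1 - \<beta>) / R powr p" by (simp add: \<beta>_def)
    then have "d / h powr p = (1 - \<beta>) * d / R powr p" by (metis mult.commute mult.right_neutral times_divide_eq_right)
    then have "d / h powr p + (k - d) / R powr p = ((1 - \<beta>) * d + (k - d)) / R powr p"
      by (simp add: add_divide_distrib)
    also have "(1 - \<beta>) * d + (k - d) = k * (1 - \<beta> * (d / k))" using k by (simp add: algebra_simps)
    finally show ?thesis by simp
  qed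
  then have cmp': "l * k powr (p / q) * \<omega> powr (1 - p / q) \<le> k / R powr p * (1 - \<beta> * (d / k)) * L"
    using cmp by simp
  have ks: "k powr (p / q) = k powr \<sigma> * k" using k by (simp add: \<sigma>_def powr_diff)
  have \<omega>s: "\<omega> powr (1 - p / q) = 1 / \<omega> powr \<sigma>" using powr_minus_divide[of \<omega> \<sigma>] by (simp add: \<sigma>_def)
  have "l * k powr \<sigma> \<le> \<omega> powr \<sigma> * L / R powr p * (1 - \<beta> * (d / k))"
  proof -
    have "k * (l * k powr \<sigma> / \<omega> powr \<sigma>) \<le> k * (1 / R powr p * (1 - \<beta> * (d / k)) * L)"
      using cmp' unfolding ks \<omega>s by (simp add: mult_ac)
    then have "l * k powr \<sigma> / \<omega> powr \<sigma> \<le> 1 / R powr p * (1 - \<beta> * (d / k)) * L"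
      using k by (rule mult_left_le_imp_le)
    then show ?thesis using \<omega> by (simp add: pos_divide_le_eq mult_ac)
  qed
  \<comment> \<open>Multiplying by (m / k) powr \<sigma> replaces the volume of the truncated body
    by that of \<Omega>.\<close>
  then have "l * k powr \<sigma> * (m / k) powr \<sigma> \<le> \<omega> powr \<sigma> * L / R powr p * (1 - \<beta> * (d / k)) * (m / k) powr \<sigma>"
    by (rule mult_right_mono) simp
  also have "\<dots> = \<omega> powr \<sigma> * L / R powr p * ((m / k) powr \<sigma> * (1 - \<beta> * (d / k)))" by simp
  also have "\<dots> < \<omega> powr \<sigma> * L / R powr p * 1"
    using less \<omega> L R by (intro mult_strict_left_mono) auto
  finally have "l * k powr \<sigma> * (m / k) powr \<sigma> < \<omega> powr \<sigma> * L / R powr p" by simp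
  moreover have "k powr \<sigma> * (m / k) powr \<sigma> = m powr \<sigma>" using k m by (simp add: powr_divide)
  ultimately show ?thesis unfolding l_def L_def \<omega>_def \<sigma>_def m_def by (simp add: mult.assoc)
qed

section \<open>Incentres and inradii\<close>

text \<open>Centres of balls with radii approaching the supremum stay in the bounded set \<Omega>.
  Along a convergent subsequence every point of the open limit ball eventually lies in one of these
  balls, so the supremum is attained.\<close>

lemma ex_incenter:
  fixes \<Omega> :: "'a::euclidean_space set"
  assumes op: "open \<Omega>" and bdd: "bounded \<Omega>" and ne: "\<Omega> \<noteq> {}"
  obtains x where "inradius \<Omega> > 0" "ball x (inradius \<Omega>) \<subseteq> \<Omega>"
proof -
  define S where "S = {r. \<exists>x. ball x r \<subseteq> \<Omega>}"
  define R where "R = inradius \<Omega>"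
  have RS: "R = Sup S" by (simp add: R_def S_def inradius_def)
  obtain B where B: "B > 0" "\<Omega> \<subseteq> cball 0 B"
    using bounded_subset_ballD[OF bdd, of 0] ball_subset_cball by blast
  have bd: "bdd_above S"
  proof (rule bdd_aboveI)
    fix r assume "r \<in> S"
    then obtain x where "ball x r \<subseteq> \<Omega>" unfolding S_def by blast
    with B(2) have "ball x r \<subseteq> cball 0 B" by blast
    then show "r \<le> B" using B(1) unfolding ball_subset_cball_iff
      by (smt (verit) zero_le_dist)
  qed
  obtain y where "y \<in> \<Omega>" using ne by blast
  then obtain e where e: "e > 0" "ball y e \<subseteq> \<Omega>" using op open_contains_ball by blast
  then have "e \<in> S" by (auto simp: S_def)
  then have R0: "R > 0" unfolding RS using cSup_upper[OF _ bd, of e] e by linarith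
  \<comment> \<open>These radii are at least R / 2, so each ball contains its centre; this puts the
    centres into \<Omega>.\<close>
  have "\<exists>x. ball x (R - R / (real n + 2)) \<subseteq> \<Omega>" for n :: nat
  proof -
    have "R - R / (real n + 2) < Sup S" using R0 by (simp add: RS[symmetric])
    then obtain r where "r \<in> S" "R - R / (real n + 2) < r"
      using less_cSup_iff[OF _ bd] \<open>e \<in> S\<close> by blast
    then show ?thesis unfolding S_def using subset_ball[of "R - R / (real n + 2)" r] by fastforce
  qed
  then obtain x where x: "\<And>n. ball (x n) (R - R / (real n + 2)) \<subseteq> \<Omega>" by metis
  have "x n \<in> \<Omega>" for n
  proof -
    have "R / (real n + 2) < R" using R0 by (simp add: divide_less_eq)
    then show ?thesis using x[of n] by auto
  qed
  then have "bounded (range x)" using bounded_subset[OF bdd] by blast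
  then obtain l r where lr: "strict_mono r" "(x \<circ> r) \<longlonglongrightarrow> l"
    using bounded_imp_convergent_subsequence by blast
  have "ball l R \<subseteq> \<Omega>"
  proof
    fix z assume z: "z \<in> ball l R"
    have "(\<lambda>n. R - R / (real n + 2)) \<longlonglongrightarrow> R" by real_asymp
    from LIMSEQ_subseq_LIMSEQ[OF this lr(1)]
    have "(\<lambda>n. (R - R / (real (r n) + 2)) - dist ((x \<circ> r) n) z) \<longlonglongrightarrow> R - dist l z"
      by (intro tendsto_intros lr(2)) (simp add: o_def)
    moreover have "R - dist l z > 0" using z by simp
    ultimately have "eventually (\<lambda>n. 0 < (R - R / (real (r n) + 2)) - dist ((x \<circ> r) n) z) sequentially"
      by (rule order_tendstoD(1))
    then obtain n where "0 < (R - R / (real (r n) + 2)) - dist (x (r n)) z"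
      using eventually_happens[of _ sequentially] by auto
    then show "z \<in> \<Omega>" using x[of "r n"] by (auto simp: subset_iff)
  qed
  then show ?thesis using that R0 unfolding R_def by blast
qed

text \<open>Balls of nonpositive radius are empty and hence contained in every set, so the
  admissible radii form the whole half-line {..r}.\<close>

lemma inradius_ball:
  assumes "r > 0" shows "inradius (ball (x::'a::euclidean_space) r) = r"
proof -
  have "{s. \<exists>y. ball y s \<subseteq> ball x r} = {..r}"
  proof (intro equalityI subsetI)
    fix s assume "s \<in> {s. \<exists>y. ball y s \<subseteq> ball x r}"
    then obtain y where "ball y s \<subseteq> ball x r" by blast
    then have "dist y x + s \<le> r \<or> s \<le> 0" unfolding ball_subset_ball_iff .
    then have "s \<le> r" using assms zero_le_dist[of y x] by linarith
    then show "s \<in> {..r}" by simp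
  next
    fix s assume "s \<in> {..r}"
    then show "s \<in> {s. \<exists>y. ball y s \<subseteq> ball x r}" using subset_ball[of s r x] by auto
  qed
  then show ?thesis unfolding inradius_def by simp
qed

theorem theorem4p2:
  fixes \<Omega> :: "'a::euclidean_space set" and p q :: real
  assumes "DIM('a) \<ge> 2"
    and "1 \<le> q" and "q < p"
    and "bounded \<Omega>" and "convex \<Omega>" and "open \<Omega>" and "\<Omega> \<noteq> {}"
  shows "lambda_pq p q \<Omega> * measure lebesgue \<Omega> powr ((p - q) / q)
           \<le> measure lebesgue (ball (0::'a) 1) powr ((p - q) / q) * lambda_pq p q (ball (0::'a) 1)
             / inradius \<Omega> powr p
       \<and> (lambda_pq p q \<Omega> * measure lebesgue \<Omega> powr ((p - q) / q)
           = measure lebesgue (ball (0::'a) 1) powr ((p - q) / q) * lambda_pq p q (ball (0::'a) 1)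
             / inradius \<Omega> powr p
         \<longleftrightarrow> (\<exists>x r. \<Omega> = ball x r))"
proof -
  define \<omega> where "\<omega> = measure lborel (ball (0::'a) 1)"
  have \<omega>: "\<omega> > 0" unfolding \<omega>_def using content_ball_pos[of 1] by auto
  define \<sigma> where "\<sigma> = (p - q) / q"
  have p0: "p > 0" and q0: "q > 0" and \<sigma>: "\<sigma> = p / q - 1" using assms by (auto simp: \<sigma>_def diff_divide_distrib)
  define L where "L = lambda_pq p q (ball (0::'a) 1)"
  define l where "l = lambda_pq p q \<Omega>"
  define m where "m = measure lborel \<Omega>"
  define R where "R = inradius \<Omega>"
  obtain c where R0: "R > 0" and c: "ball c R \<subseteq> \<Omega>"
    using ex_incenter[OF assms(6,4,7)] unfolding R_def by blast
  \<comment> \<open>Moves the incentre to the origin, as \<open>convex_body\<close> demands.\<close>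
  define \<Omega>' where "\<Omega>' = (\<lambda>x. - c + x) ` \<Omega>"
  have mem: "x \<in> \<Omega>' \<longleftrightarrow> c + x \<in> \<Omega>" for x by (auto simp: \<Omega>'_def image_iff algebra_simps intro: bexI[of _ "c + x"])
  interpret convex_body \<Omega>' R
  proof
    show "convex \<Omega>'" unfolding \<Omega>'_def by (rule convex_translation[OF assms(5)])
    show "open \<Omega>'" unfolding \<Omega>'_def by (rule open_translation[OF assms(6)])
    show "bounded \<Omega>'" unfolding \<Omega>'_def by (rule bounded_translation[OF assms(4)])
    show "ball 0 R \<subseteq> \<Omega>'" using c by (auto simp: mem subset_iff dist_norm)
  qed (rule R0)
  have m': "measure lborel \<Omega>' = m"
    using measure_translation[of "- c" \<Omega>] op assms(6) by (simp add: \<Omega>'_def m_def)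
  have m0: "m > 0"
  proof -
    have "measure lborel (ball c R) \<le> m" unfolding m_def
      using c assms(6) emeasure_bounded_finite[OF assms(4)] by (intro measure_mono_fmeasurable fmeasurableI) auto
    then show ?thesis using content_ball_pos[OF R0, of c] by linarith
  qed
  \<comment> \<open>\<open>lambda_pq\<close> of \<Omega> is to be bounded from above, which fixes
    the direction in which the translates are compared.\<close>
  have ll': "l \<le> lambda_pq p q \<Omega>'"
    using lambda_pq_affine_le[of 1 "- c" \<Omega>' \<Omega> R 0 p q] R0 ball_sub p0 q0 by (simp add: mem l_def)
  have le: "l * m powr \<sigma> \<le> \<omega> powr \<sigma> * L / R powr p"
  proof -
    have "l * m powr \<sigma> \<le> lambda_pq p q \<Omega>' * m powr \<sigma>" using ll' by (intro mult_right_mono) auto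
    moreover have "lambda_pq p q \<Omega>' * (m powr \<sigma> * m) * (1 / \<omega> powr \<sigma>) \<le> m / R powr p * L"
    proof -
      have "m powr (p / q) = m powr \<sigma> * m" using m0 by (simp add: \<sigma> powr_diff)
      moreover have "\<omega> powr (1 - p / q) = 1 / \<omega> powr \<sigma>" using powr_minus_divide[of \<omega> \<sigma>] by (simp add: \<sigma>)
      ultimately show ?thesis
        using lambda_pq_inball_le[OF assms(2,3)] unfolding m' \<omega>_def[symmetric] L_def[symmetric] by simp
    qed
    then have "m * (lambda_pq p q \<Omega>' * m powr \<sigma> / \<omega> powr \<sigma>) \<le> m * (L / R powr p)" by (simp add: mult_ac)
    then have "lambda_pq p q \<Omega>' * m powr \<sigma> / \<omega> powr \<sigma> \<le> L / R powr p" using m0 by (rule mult_left_le_imp_le)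
    then have "lambda_pq p q \<Omega>' * m powr \<sigma> \<le> \<omega> powr \<sigma> * L / R powr p" using \<omega> by (simp add: pos_divide_le_eq mult_ac)
    ultimately show ?thesis by linarith
  qed
  have less: "l * m powr \<sigma> < \<omega> powr \<sigma> * L / R powr p" if "\<nexists>x r. \<Omega> = ball x r"
  proof -
    have "\<Omega>' \<noteq> ball 0 R"
    proof
      assume "\<Omega>' = ball 0 R"
      then have "x \<in> \<Omega> \<longleftrightarrow> x \<in> ball c R" for x using mem[of "x - c"] by (simp add: dist_norm norm_minus_commute)
      then show False using that by blast
    qed
    then have "lambda_pq p q \<Omega>' * m powr \<sigma> < \<omega> powr \<sigma> * L / R powr p"
      using lambda_pq_strict[OF assms(2,3)] unfolding m' \<omega>_def L_def \<sigma> by simp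
    moreover have "l * m powr \<sigma> \<le> lambda_pq p q \<Omega>' * m powr \<sigma>" using ll' by (intro mult_right_mono) auto
    ultimately show ?thesis by linarith
  qed
  \<comment> \<open>For a ball the reverse inequality is scaling: test functions of the ball are
    pulled back to the unit ball, and the inradius is the radius.\<close>
  have ge: "\<omega> powr \<sigma> * L / R powr p \<le> l * m powr \<sigma>" if eq: "\<Omega> = ball x r" for x r
  proof -
    \<comment> \<open>A nonpositive radius would make \<Omega> empty.\<close>
    have r: "r > 0" using eq assms(7) by auto
    have Rr: "R = r" using inradius_ball[OF r] eq by (simp add: R_def)
    define k where "k = r ^ DIM('a)"
    have k: "k > 0" using r by (simp add: k_def)
    have mk: "m = k * \<omega>" using content_ball_conv_unit_ball[of r x] r by (simp add: m_def \<omega>_def eq k_def)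
    have "L * (1 / k) powr (p / q) \<le> r powr p / k * l"
      unfolding L_def l_def k_def
      by (rule lambda_pq_affine_le[of r x \<Omega> "ball 0 1" r x]) (use r p0 q0 in \<open>auto simp: eq dist_norm\<close>)
    moreover have "(1 / k) powr (p / q) = 1 / (k * k powr \<sigma>)" using k by (simp add: \<sigma> powr_divide powr_diff)
    ultimately have "L \<le> r powr p * l * k powr \<sigma>" using k by (simp add: field_simps)
    then have "\<omega> powr \<sigma> * L \<le> \<omega> powr \<sigma> * (r powr p * l * k powr \<sigma>)" by (intro mult_left_mono) auto
    also have "\<dots> = r powr p * (l * m powr \<sigma>)" unfolding mk using k \<omega> by (simp add: powr_mult)
    finally show ?thesis using r unfolding Rr by (simp add: pos_divide_le_eq mult.commute)
  qed
  have leb: "measure lebesgue \<Omega> = m" "measure lebesgue (ball (0::'a) 1) = \<omega>"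
    using assms(6) by (simp_all add: m_def \<omega>_def)
  show ?thesis
    unfolding leb \<sigma>_def[symmetric] l_def[symmetric] L_def[symmetric] R_def[symmetric]
    using le less ge by (metis antisym less_irrefl)
qed

end
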